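(* Let $K$ be a non-archimedean local field whose characteristic is not $2$, let $D$ be a central simple algebra over $K$ of degree $2$, let $D_0$ be a maximal order of $D$, and let $\mathrm{Nrd}\colon D^\times\to K^\times$ be the reduced norm. Then $\rho(D_0^\times\cap\ker\mathrm{Nrd})=1$.
   Context: $D_0^\times\cap\ker\mathrm{Nrd}$ is a profinite group. For a topological group $U$, let $r_n(U)$ be the number of isomorphism classes of continuous irreducible complex representations of $U$ of dimension $n$ and $R_n(U)=\sum_{i=1}^n r_i(U)$; then $\rho(U)=\limsup_{n\to\infty}\frac{\log R_n(U)}{\log n}$ (with $\rho(U)=\infty$ if some $R_n(U)$ is infinite or $R_n(U)$ is not polynomially bounded). *)

theory Defs
  imports Complex_Main "HOL-Library.Liminf_Limsup" "HOL-Library.Extended_Real"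
    "Jordan_Normal_Form.Char_Poly"
begin

definition nonarch_abs :: "('k::field \<Rightarrow> real) \<Rightarrow> bool" where
  "nonarch_abs v \<longleftrightarrow>
     (\<forall>x. v x \<ge> 0) \<and> (\<forall>x. v x = 0 \<longleftrightarrow> x = 0) \<and>
     (\<forall>x y. v (x * y) = v x * v y) \<and> (\<forall>x y. v (x + y) \<le> max (v x) (v y))"

definition nonarch_local_field :: "('k::field \<Rightarrow> real) \<Rightarrow> bool" where
  "nonarch_local_field v \<longleftrightarrow>
     nonarch_abs v \<and>
     (\<exists>\<pi>. 0 < v \<pi> \<and> v \<pi> < 1 \<and> (\<forall>x. x \<noteq> 0 \<longrightarrow> (\<exists>k::int. v x = v \<pi> powi k))) \<and>
     (\<forall>X::nat \<Rightarrow> 'k. (\<forall>\<epsilon>>0. \<exists>N. \<forall>m\<ge>N. \<forall>n\<ge>N. v (X m - X n) < \<epsilon>) \<longrightarrow>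
        (\<exists>L. \<forall>\<epsilon>>0. \<exists>N. \<forall>n\<ge>N. v (X n - L) < \<epsilon>)) \<and>
     finite ({x. v x \<le> 1} // {(x, y). v x \<le> 1 \<and> v y \<le> 1 \<and> v (x - y) < 1})"

definition K_algebra :: "('k::field \<Rightarrow> 'd::ring_1) \<Rightarrow> bool" where
  "K_algebra emb \<longleftrightarrow> inj emb \<and> emb 1 = 1 \<and>
     (\<forall>a b. emb (a + b) = emb a + emb b) \<and> (\<forall>a b. emb (a * b) = emb a * emb b) \<and>
     (\<forall>a x. emb a * x = x * emb a)"

definition K_basis4 :: "('k::field \<Rightarrow> 'd::ring_1) \<Rightarrow> (nat \<Rightarrow> 'd) \<Rightarrow> bool" where
  "K_basis4 emb e \<longleftrightarrow>
     (\<forall>x. \<exists>!c::nat \<Rightarrow> 'k. (\<forall>i\<ge>4. c i = 0) \<and> x = (\<Sum>i<4. emb (c i) * e i))"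

definition two_sided_ideal :: "'d::ring_1 set \<Rightarrow> bool" where
  "two_sided_ideal I \<longleftrightarrow> 0 \<in> I \<and> (\<forall>x\<in>I. \<forall>y\<in>I. x + y \<in> I \<and> - x \<in> I) \<and>
     (\<forall>x\<in>I. \<forall>a. a * x \<in> I \<and> x * a \<in> I)"

definition central_simple_deg2 :: "('k::field \<Rightarrow> 'd::ring_1) \<Rightarrow> bool" where
  "central_simple_deg2 emb \<longleftrightarrow>
     K_algebra emb \<and> (\<exists>e. K_basis4 emb e) \<and>
     {z. \<forall>x. z * x = x * z} = range emb \<and>
     (\<forall>I::'d set. two_sided_ideal I \<longrightarrow> I = {0} \<or> I = UNIV)"

definition the_basis :: "('k::field \<Rightarrow> 'd::ring_1) \<Rightarrow> nat \<Rightarrow> 'd" where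
  "the_basis emb = (SOME e. K_basis4 emb e)"

definition coord :: "('k::field \<Rightarrow> 'd::ring_1) \<Rightarrow> 'd \<Rightarrow> nat \<Rightarrow> 'k" where
  "coord emb x = (THE c. (\<forall>i\<ge>4. c i = 0) \<and> x = (\<Sum>i<4. emb (c i) * the_basis emb i))"

definition left_mult_mat :: "('k::field \<Rightarrow> 'd::ring_1) \<Rightarrow> 'd \<Rightarrow> 'k mat" where
  "left_mult_mat emb x = mat 4 4 (\<lambda>(i, j). coord emb (x * the_basis emb j) i)"

text \<open>Reduced norm: the reduced characteristic polynomial X^2 - t X + n of x is the unique
  monic quadratic whose square is the characteristic polynomial of left multiplication
  by x on D; Nrd x is its constant term n.\<close>
definition Nrd :: "('k::field \<Rightarrow> 'd::ring_1) \<Rightarrow> 'd \<Rightarrow> 'k" where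
  "Nrd emb x = (THE n. \<exists>t. char_poly (left_mult_mat emb x) = [:n, - t, 1:] ^ 2)"

definition is_order :: "('k::field \<Rightarrow> real) \<Rightarrow> ('k \<Rightarrow> 'd::ring_1) \<Rightarrow> 'd set \<Rightarrow> bool" where
  "is_order v emb A \<longleftrightarrow>
     1 \<in> A \<and> (\<forall>x\<in>A. \<forall>y\<in>A. x + y \<in> A \<and> - x \<in> A \<and> x * y \<in> A) \<and>
     (\<exists>gs::'d list. A = {x. \<exists>a::nat \<Rightarrow> 'k. (\<forall>i<length gs. v (a i) \<le> 1) \<and>
                              x = (\<Sum>i<length gs. emb (a i) * gs ! i)}) \<and>
     (\<exists>e. K_basis4 emb e \<and> (\<forall>i<4. e i \<in> A))"

definition maximal_order :: "('k::field \<Rightarrow> real) \<Rightarrow> ('k \<Rightarrow> 'd::ring_1) \<Rightarrow> 'd set \<Rightarrow> bool" where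
  "maximal_order v emb A \<longleftrightarrow> is_order v emb A \<and> (\<forall>B. is_order v emb B \<and> A \<subseteq> B \<longrightarrow> B = A)"

definition units_of_set :: "'d::ring_1 set \<Rightarrow> 'd set" where
  "units_of_set A = {x \<in> A. \<exists>y\<in>A. x * y = 1 \<and> y * x = 1}"

text \<open>Norm on D from coordinates in the K-basis; its topology is the natural one on D = K^4.\<close>
definition dnorm :: "('k::field \<Rightarrow> real) \<Rightarrow> ('k \<Rightarrow> 'd::ring_1) \<Rightarrow> 'd \<Rightarrow> real" where
  "dnorm v emb x = Max ((\<lambda>i. v (coord emb x i)) ` {..<4})"

definition cont_rep ::
  "('k::field \<Rightarrow> real) \<Rightarrow> ('k \<Rightarrow> 'd::ring_1) \<Rightarrow> 'd set \<Rightarrow> nat \<Rightarrow> ('d \<Rightarrow> complex mat) \<Rightarrow> bool" where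
  "cont_rep v emb U n \<rho> \<longleftrightarrow>
     (\<forall>g\<in>U. \<rho> g \<in> carrier_mat n n) \<and> \<rho> 1 = 1\<^sub>m n \<and>
     (\<forall>g\<in>U. \<forall>h\<in>U. \<rho> (g * h) = \<rho> g * \<rho> h) \<and>
     (\<forall>g\<in>U. \<forall>\<epsilon>>0. \<exists>\<delta>>0. \<forall>h\<in>U. dnorm v emb (h - g) < \<delta> \<longrightarrow>
        (\<forall>i<n. \<forall>j<n. cmod (\<rho> h $$ (i, j) - \<rho> g $$ (i, j)) < \<epsilon>))"

definition irreducible_rep :: "'d set \<Rightarrow> nat \<Rightarrow> ('d \<Rightarrow> complex mat) \<Rightarrow> bool" where
  "irreducible_rep U n \<rho> \<longleftrightarrow> n \<ge> 1 \<and>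
     \<not> (\<exists>W. W \<subseteq> carrier_vec n \<and> 0\<^sub>v n \<in> W \<and>
            (\<forall>x\<in>W. \<forall>y\<in>W. x + y \<in> W) \<and> (\<forall>c. \<forall>x\<in>W. c \<cdot>\<^sub>v x \<in> W) \<and>
            W \<noteq> {0\<^sub>v n} \<and> W \<noteq> carrier_vec n \<and>
            (\<forall>g\<in>U. \<forall>x\<in>W. \<rho> g *\<^sub>v x \<in> W))"

definition irr_reps :: "('k::field \<Rightarrow> real) \<Rightarrow> ('k \<Rightarrow> 'd::ring_1) \<Rightarrow> 'd set \<Rightarrow> nat \<Rightarrow> ('d \<Rightarrow> complex mat) set" where
  "irr_reps v emb U n = {\<rho>. cont_rep v emb U n \<rho> \<and> irreducible_rep U n \<rho>}"

definition rep_iso :: "'d::ring_1 set \<Rightarrow> ('d \<Rightarrow> complex mat) \<Rightarrow> ('d \<Rightarrow> complex mat) \<Rightarrow> bool" where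
  "rep_iso U \<rho> \<sigma> \<longleftrightarrow> (\<exists>n. \<rho> 1 \<in> carrier_mat n n \<and> \<sigma> 1 \<in> carrier_mat n n \<and>
     (\<exists>P \<in> carrier_mat n n. invertible_mat P \<and> (\<forall>g\<in>U. P * \<rho> g = \<sigma> g * P)))"

definition irr_classes_le ::
  "('k::field \<Rightarrow> real) \<Rightarrow> ('k \<Rightarrow> 'd::ring_1) \<Rightarrow> 'd set \<Rightarrow> nat \<Rightarrow> ('d \<Rightarrow> complex mat) set set" where
  "irr_classes_le v emb U n =
     (\<Union>i\<in>{1..n}. irr_reps v emb U i) // {(\<rho>, \<sigma>). rep_iso U \<rho> \<sigma>}"

definition R_count :: "('k::field \<Rightarrow> real) \<Rightarrow> ('k \<Rightarrow> 'd::ring_1) \<Rightarrow> 'd set \<Rightarrow> nat \<Rightarrow> nat" where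
  "R_count v emb U n = card (irr_classes_le v emb U n)"

definition rep_growth :: "('k::field \<Rightarrow> real) \<Rightarrow> ('k \<Rightarrow> 'd::ring_1) \<Rightarrow> 'd set \<Rightarrow> ereal" where
  "rep_growth v emb U =
     (if \<exists>n. infinite (irr_classes_le v emb U n) then \<infinity>
      else limsup (\<lambda>n. ereal (ln (real (R_count v emb U n)) / ln (real n))))"

end

(* Write U for the group in question and U_m for its congruence subgroup of level m; U/U_m has
   order O(q^(3m)), q being the size of the residue field.  Away from characteristic 2 the Cayley
   transform y |-> (1+y)/(1-y) identifies small pure quaternions with elements of U near 1, turning
   the deep congruence subgroups into additive groups modulo U_m.  Let an irreducible representation
   be trivial on U_m but not on U_(m-1), and restrict it to the image of the pure quaternions of norm
   at most that of pi^(m/2): a common eigenvector gives an additive character phi.  If phi is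
   nontrivial on a multiple of f3, where [f1,f2] is a multiple of f3, then the conjugates of phi by the
   Cayley transforms of s f1 + t f2 are pairwise distinct for s, t in distinct classes modulo about
   pi^(m/2), so the dimension is at least c q^m.

   Upper bound: the sum of the squares of the dimensions is at most |U/U_m|, hence there are O(q^m)
   irreducible representations of level m, all of dimension at least c q^m.
   Lower bound: the traces of a one-parameter torus show that U/U_m has at least c q^m conjugacy
   classes, hence as many irreducible representations; by the same sum of squares at most half of
   them have dimension above A q^m if A is large. *)

theory Submission
  imports Defs "Jordan_Normal_Form.Spectral_Radius"
begin

section \<open>Linear algebra\<close>

text \<open>Split and division algebras are treated alike: both have a basis
  \<open>1, i, j, i * j\<close> with \<open>i * j = - (j * i)\<close>. The Cayley transform replaces
  the exponential, whose series makes no sense in positive characteristic: it is rational, defined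
  on the whole open unit ball of pure quaternions, lands exactly in reduced norm 1, commutes with
  conjugation and has a rational inverse near 1. The obstacle is that 2, \<open>i * i\<close> and
  \<open>j * j\<close> need not be units and that \<open>D0\<close> is only commensurable with the
  lattice spanned by the basis, so each passage between \<open>U\<close>, its congruence ideals and
  the pure quaternions loses a power of \<open>\<pi>\<close>. All losses are bounded by multiples of
  one exponent \<open>\<kappa>\<close>; they become constant factors in the counts and vanish after
  division by \<open>ln n\<close>. Only rates in \<open>m\<close> matter, so no constant is
  optimised. Comparing two conjugates of phi, however, needs an error small relative to the
  difference of the two parameters, not merely small; hence the Lipschitz estimate for conjugation
  with the commutator as main term.\<close>

lemma homogeneous_system:
  fixes a :: "'i \<Rightarrow> 'j \<Rightarrow> 'a::field"
  assumes "finite J" "finite I" "card J < card I"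
  shows "\<exists>c. (\<exists>i\<in>I. c i \<noteq> 0) \<and> (\<forall>j\<in>J. (\<Sum>i\<in>I. c i * a i j) = 0)"
  using assms
proof (induction J arbitrary: I a rule: finite_induct)
  case empty
  then obtain i where "i \<in> I" by fastforce
  then show ?case by (intro exI[of _ "\<lambda>_. 1"]) auto
next
  case (insert j0 J)
  show ?case
  proof (cases "\<forall>i\<in>I. a i j0 = 0")
    case True
    have "card J < card I" using insert by simp
    from insert.IH[OF insert.prems(1) this, of a] obtain c where
      "\<exists>i\<in>I. c i \<noteq> 0" "\<forall>j\<in>J. (\<Sum>i\<in>I. c i * a i j) = 0" by blast
    then show ?thesis using True by (intro exI[of _ c]) auto
  next
    case False
    then obtain i0 where i0: "i0 \<in> I" "a i0 j0 \<noteq> 0" by blast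
    let ?I = "I - {i0}"
    have "card J < card ?I" using insert i0 by simp
    with insert.IH[of ?I "\<lambda>i j. a i j - a i j0 / a i0 j0 * a i0 j"] insert.prems(1)
    obtain c where c: "\<exists>i\<in>?I. c i \<noteq> 0"
      "\<forall>j\<in>J. (\<Sum>i\<in>?I. c i * (a i j - a i j0 / a i0 j0 * a i0 j)) = 0" by auto
    \<comment> \<open>The pivot unknown \<open>i0\<close> is solved from the equation
      \<open>j0\<close>; the coefficients passed to the induction hypothesis are what this
      substitution leaves of the other equations.\<close>
    define c' where "c' i = (if i = i0 then - (\<Sum>i\<in>?I. c i * a i j0 / a i0 j0) else c i)" for i
    have s: "(\<Sum>i\<in>I. c' i * a i j) = (\<Sum>i\<in>?I. c i * (a i j - a i j0 / a i0 j0 * a i0 j))" for j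
    proof -
      have "(\<Sum>i\<in>I. c' i * a i j) = c' i0 * a i0 j + (\<Sum>i\<in>?I. c' i * a i j)"
        by (rule sum.remove[OF insert.prems(1) i0(1)])
      also have "(\<Sum>i\<in>?I. c' i * a i j) = (\<Sum>i\<in>?I. c i * a i j)"
        by (rule sum.cong) (auto simp: c'_def)
      finally show ?thesis
        by (simp add: c'_def algebra_simps sum_subtractf sum_distrib_left sum_distrib_right
            sum_negf sum_divide_distrib)
    qed
    have "(\<Sum>i\<in>I. c' i * a i j0) = 0" unfolding s using i0 by simp
    moreover have "\<exists>i\<in>I. c' i \<noteq> 0" using c(1) by (auto simp: c'_def)
    ultimately show ?thesis using c(2) s by (intro exI[of _ c']) auto
  qed
qed

lemma mult_mat_vec_index:
  "A \<in> carrier_mat n m \<Longrightarrow> v \<in> carrier_vec m \<Longrightarrow> i < n \<Longrightarrow> (A *\<^sub>v v) $ i = (\<Sum>j<m. A $$ (i,j) * v $ j)"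
  by (auto simp: scalar_prod_def atLeast0LessThan intro!: sum.cong)

lemma mult_mat_index:
  "A \<in> carrier_mat n m \<Longrightarrow> B \<in> carrier_mat m k \<Longrightarrow> i < n \<Longrightarrow> j < k \<Longrightarrow>
     (A * B) $$ (i,j) = (\<Sum>l<m. A $$ (i,l) * B $$ (l,j))"
  by (auto simp: scalar_prod_def atLeast0LessThan intro!: sum.cong)

text \<open>Linear independence of the columns. Subspaces are handled below as ranges of such
  matrices, the number of columns being the dimension.\<close>

definition inj_mat :: "'a::field mat \<Rightarrow> bool" where
  "inj_mat B \<longleftrightarrow> (\<forall>v\<in>carrier_vec (dim_col B). B *\<^sub>v v = 0\<^sub>v (dim_row B) \<longrightarrow> v = 0\<^sub>v (dim_col B))"

lemma inj_mat_le:
  fixes B :: "'a::field mat"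
  assumes B: "B \<in> carrier_mat n d" and inj: "inj_mat B"
  shows "d \<le> n"
proof (rule ccontr)
  assume "\<not> d \<le> n"
  then have "card {..<n} < card {..<d}" by simp
  from homogeneous_system[OF _ _ this, of "\<lambda>i j. B $$ (j,i)"]
  obtain c where c: "\<exists>i<d. c i \<noteq> 0" "\<forall>j<n. (\<Sum>i<d. c i * B $$ (j,i)) = 0" by auto
  have "B *\<^sub>v vec d c = 0\<^sub>v n"
  proof (rule eq_vecI)
    fix i assume "i < dim_vec (0\<^sub>v n :: 'a vec)"
    then show "(B *\<^sub>v vec d c) $ i = 0\<^sub>v n $ i"
      using c(2) B by (subst mult_mat_vec_index[OF B]) (auto simp: mult.commute)
  qed (use B in auto)
  then have "vec d c = 0\<^sub>v d" using inj B unfolding inj_mat_def by auto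
  then show False using c(1) by (metis index_vec index_zero_vec(1))
qed

lemma inj_mat_square_invertible:
  fixes B :: "'a::field mat"
  assumes B: "B \<in> carrier_mat n n" and inj: "inj_mat B"
  obtains C where "C \<in> carrier_mat n n" "C * B = 1\<^sub>m n" "B * C = 1\<^sub>m n"
proof -
  have "det B \<noteq> 0"
    using det_0_iff_vec_prod_zero_field[OF B] inj B unfolding inj_mat_def by auto
  from det_non_zero_imp_unit[OF B this, of undefined]
  show ?thesis using that unfolding Units_def ring_mat_def by auto
qed

lemma inj_mat_range_UNIV:
  fixes B :: "'a::field mat"
  assumes B: "B \<in> carrier_mat n n" and inj: "inj_mat B" and x: "x \<in> carrier_vec n"
  shows "\<exists>v\<in>carrier_vec n. x = B *\<^sub>v v"
proof -
  from inj_mat_square_invertible[OF B inj] obtain C where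
    C: "C \<in> carrier_mat n n" "C * B = 1\<^sub>m n" "B * C = 1\<^sub>m n" .
  have "x = B *\<^sub>v (C *\<^sub>v x)"
    using C x B by (metis assoc_mult_mat_vec one_mult_mat_vec)
  then show ?thesis using C x by (metis mult_mat_vec_carrier)
qed

text \<open>Preimages of the unit vectors, taken as columns, form a right inverse of
  \<open>B\<close>; it is injective, so \<open>inj_mat_le\<close> applies to it.\<close>

lemma surj_mat_le:
  fixes B :: "'a::field mat"
  assumes B: "B \<in> carrier_mat n k" and surj: "\<And>x. x \<in> carrier_vec n \<Longrightarrow> \<exists>v\<in>carrier_vec k. x = B *\<^sub>v v"
  shows "n \<le> k"
proof -
  have "\<forall>i. \<exists>w\<in>carrier_vec k. i < n \<longrightarrow> unit_vec n i = B *\<^sub>v w" using surj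
    by (metis unit_vec_carrier zero_carrier_vec)
  then obtain w where w: "\<And>i. w i \<in> carrier_vec k" "\<And>i. i < n \<Longrightarrow> unit_vec n i = B *\<^sub>v w i" by metis
  define W where "W = mat k n (\<lambda>(i,j). w j $ i)"
  have W: "W \<in> carrier_mat k n" by (simp add: W_def)
  have BW: "B * W = 1\<^sub>m n"
  proof (rule eq_matI)
    fix i j assume "i < dim_row (1\<^sub>m n :: 'a mat)" "j < dim_col (1\<^sub>m n :: 'a mat)"
    then have ij: "i < n" "j < n" by auto
    have "(B * W) $$ (i,j) = (\<Sum>l<k. B $$ (i,l) * w j $ l)"
      using ij by (subst mult_mat_index[OF B W]) (auto simp: W_def)
    also have "\<dots> = (B *\<^sub>v w j) $ i" using mult_mat_vec_index[OF B w(1)] ij by simp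
    also have "\<dots> = (1\<^sub>m n) $$ (i,j)" using w(2)[OF ij(2), symmetric] ij by simp
    finally show "(B * W) $$ (i,j) = 1\<^sub>m n $$ (i,j)" .
  qed (use B W in auto)
  have "inj_mat W"
    unfolding inj_mat_def
  proof (intro ballI impI)
    fix v assume "v \<in> carrier_vec (dim_col W)" "W *\<^sub>v v = 0\<^sub>v (dim_row W)"
    then have v: "v \<in> carrier_vec n" "W *\<^sub>v v = 0\<^sub>v k" using W by auto
    have "v = B *\<^sub>v (W *\<^sub>v v)" using BW v(1) B W by (metis assoc_mult_mat_vec one_mult_mat_vec)
    also have "\<dots> = 0\<^sub>v n" unfolding v(2) using B by (auto intro!: eq_vecI)
    finally show "v = 0\<^sub>v (dim_col W)" using W by simp
  qed
  then show ?thesis using inj_mat_le[OF W] by simp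
qed

definition vsubspace :: "nat \<Rightarrow> 'a::field vec set \<Rightarrow> bool" where
  "vsubspace n W \<longleftrightarrow> W \<subseteq> carrier_vec n \<and> 0\<^sub>v n \<in> W \<and> (\<forall>x\<in>W. \<forall>y\<in>W. x + y \<in> W) \<and>
     (\<forall>c. \<forall>x\<in>W. c \<cdot>\<^sub>v x \<in> W)"

text \<open>Take an injective matrix into \<open>W\<close> with the most columns; a vector of
  \<open>W\<close> outside its range could be appended as a further column. The maximum exists
  because \<open>inj_mat_le\<close> bounds the columns by \<open>n\<close>, and the matrix without
  columns starts the search.\<close>

lemma vsubspace_basis:
  fixes W :: "'a::field vec set"
  assumes W: "vsubspace n W"
  obtains d B where "B \<in> carrier_mat n d" "inj_mat B" "W = (\<lambda>v. B *\<^sub>v v) ` carrier_vec d"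
proof -
  define P where "P d \<longleftrightarrow> (\<exists>B\<in>carrier_mat n d. inj_mat B \<and> (\<forall>v\<in>carrier_vec d. B *\<^sub>v v \<in> W))" for d
  have P0: "P 0"
  proof -
    have "(0\<^sub>m n 0 :: 'a mat) *\<^sub>v v = 0\<^sub>v n" if "v \<in> carrier_vec 0" for v
      using that by (auto intro!: eq_vecI simp: scalar_prod_def)
    then show ?thesis unfolding P_def using W
      by (intro bexI[of _ "0\<^sub>m n 0"]) (auto simp: inj_mat_def vsubspace_def)
  qed
  have bd: "d \<le> n" if "P d" for d using that inj_mat_le unfolding P_def by blast
  define d where "d = (GREATEST d. P d)"
  have Pd: "P d" unfolding d_def by (rule GreatestI_nat[of P, OF P0]) (use bd in auto)
  have nP: "\<not> P (Suc d)"
    using Greatest_le_nat[of P "Suc d" n] bd unfolding d_def by fastforce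
  from Pd obtain B where B: "B \<in> carrier_mat n d" "inj_mat B" "\<And>v. v \<in> carrier_vec d \<Longrightarrow> B *\<^sub>v v \<in> W"
    unfolding P_def by auto
  have "x \<in> (\<lambda>v. B *\<^sub>v v) ` carrier_vec d" if x: "x \<in> W" for x
  proof (rule ccontr)
    assume nx: "x \<notin> (\<lambda>v. B *\<^sub>v v) ` carrier_vec d"
    have xc: "x \<in> carrier_vec n" using x W unfolding vsubspace_def by auto
    define B' where "B' = mat n (Suc d) (\<lambda>(i,j). if j < d then B $$ (i,j) else x $ i)"
    have B': "B' \<in> carrier_mat n (Suc d)" by (simp add: B'_def)
    have eq: "B' *\<^sub>v v = B *\<^sub>v (vec d (\<lambda>i. v $ i)) + v $ d \<cdot>\<^sub>v x" if v: "v \<in> carrier_vec (Suc d)" for v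
    proof (rule eq_vecI)
      fix i assume "i < dim_vec (B *\<^sub>v (vec d (\<lambda>i. v $ i)) + v $ d \<cdot>\<^sub>v x)"
      then have i: "i < n" using xc by auto
      show "(B' *\<^sub>v v) $ i = (B *\<^sub>v (vec d (\<lambda>i. v $ i)) + v $ d \<cdot>\<^sub>v x) $ i"
        using i xc B(1) mult_mat_vec_index[OF B' v i] mult_mat_vec_index[OF B(1) vec_carrier i]
        by (simp add: B'_def mult.commute)
    qed (use B' xc B in auto)
    have "B' *\<^sub>v v \<in> W" if "v \<in> carrier_vec (Suc d)" for v
      unfolding eq[OF that] using B(3) W x unfolding vsubspace_def by auto
    moreover have "inj_mat B'"
      unfolding inj_mat_def
    proof (intro ballI impI)
      fix v assume "v \<in> carrier_vec (dim_col B')" "B' *\<^sub>v v = 0\<^sub>v (dim_row B')"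
      then have v: "v \<in> carrier_vec (Suc d)" and z: "B' *\<^sub>v v = 0\<^sub>v n" using B' by auto
      let ?w = "vec d (\<lambda>i. v $ i)"
      have z': "B *\<^sub>v ?w + v $ d \<cdot>\<^sub>v x = 0\<^sub>v n" using z eq[OF v] by simp
      have vd: "v $ d = 0"
      proof (rule ccontr)
        assume vd: "v $ d \<noteq> 0"
        have "x = B *\<^sub>v ((- 1 / v $ d) \<cdot>\<^sub>v ?w)"
        proof (rule eq_vecI)
          fix i assume "i < dim_vec (B *\<^sub>v ((- 1 / v $ d) \<cdot>\<^sub>v ?w))"
          then have i: "i < n" using B by auto
          have "(B *\<^sub>v ?w) $ i + v $ d * x $ i = 0"
            using arg_cong[OF z', of "\<lambda>u. u $ i"] i xc B by auto
          moreover have "B *\<^sub>v ((- 1 / v $ d) \<cdot>\<^sub>v ?w) = (- 1 / v $ d) \<cdot>\<^sub>v (B *\<^sub>v ?w)"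
            by (rule mult_mat_vec[OF B(1)]) simp
          ultimately show "x $ i = (B *\<^sub>v ((- 1 / v $ d) \<cdot>\<^sub>v ?w)) $ i"
            using i B vd by (simp add: field_simps eq_neg_iff_add_eq_0 add.commute del: mult_mat_vec index_mult_mat_vec) 
        qed (use B xc in auto)
        then show False using nx by (metis image_eqI smult_carrier_vec vec_carrier)
      qed
      have "B *\<^sub>v ?w = 0\<^sub>v n"
      proof (rule eq_vecI)
        fix i assume "i < dim_vec (0\<^sub>v n :: 'a vec)"
        then have i: "i < n" by auto
        then show "(B *\<^sub>v ?w) $ i = 0\<^sub>v n $ i"
          using arg_cong[OF z', of "\<lambda>u. u $ i"] i xc B vd by auto
      qed (use B in auto)
      then have "?w = 0\<^sub>v d" using B(1,2) unfolding inj_mat_def by auto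
      then have "v $ i = 0" if "i < d" for i using that by (metis index_vec index_zero_vec(1))
      then show "v = 0\<^sub>v (dim_col B')" using vd v B' by (auto simp: less_Suc_eq intro!: eq_vecI)
    qed
    ultimately have "P (Suc d)" unfolding P_def using B' by blast
    then show False using nP by simp
  qed
  then have "W = (\<lambda>v. B *\<^sub>v v) ` carrier_vec d" using B(3) by auto
  then show ?thesis using that B by blast
qed

lemma inj_matD:
  "inj_mat B \<Longrightarrow> B \<in> carrier_mat n d \<Longrightarrow> v \<in> carrier_vec d \<Longrightarrow> B *\<^sub>v v = 0\<^sub>v n \<Longrightarrow> v = 0\<^sub>v d"
  unfolding inj_mat_def by auto

lemma inj_mat_cancel_vec:
  fixes B :: "'a::field mat"
  assumes "inj_mat B" "B \<in> carrier_mat n d" "v \<in> carrier_vec d" "w \<in> carrier_vec d" "B *\<^sub>v v = B *\<^sub>v w"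
  shows "v = w"
proof -
  have "B *\<^sub>v (v - w) = 0\<^sub>v n"
    using assms by (subst mult_minus_distrib_mat_vec[of _ n d]) auto
  then have "v - w = 0\<^sub>v d" using assms inj_matD[of B n d "v - w"] by auto
  then show ?thesis using assms
    by (intro eq_vecI) (metis carrier_vecD eq_iff_diff_eq_0 index_minus_vec(1) index_zero_vec(1), auto)
qed

lemma mat_eq_if_mult_vec_eq:
  fixes A B :: "'a::field mat"
  assumes "A \<in> carrier_mat n m" "B \<in> carrier_mat n m" "\<And>v. v \<in> carrier_vec m \<Longrightarrow> A *\<^sub>v v = B *\<^sub>v v"
  shows "A = B"
proof (rule eq_matI)
  fix i j assume "i < dim_row B" "j < dim_col B"
  then have ij: "i < n" "j < m" using assms by auto
  have *: "(C *\<^sub>v unit_vec m j) $ i = C $$ (i,j)" if "C \<in> carrier_mat n m" for C :: "'a mat"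
    using that ij by (subst mult_mat_vec_index[OF that]) (auto simp: sum.delta if_distrib[of "\<lambda>x. _ * x"] cong: if_cong)
  show "A $$ (i,j) = B $$ (i,j)"
    using *[OF assms(1)] *[OF assms(2)] assms(3)[of "unit_vec m j"] by simp
qed (use assms in auto)

lemma inj_mat_cancel:
  fixes B :: "'a::field mat"
  assumes "inj_mat B" "B \<in> carrier_mat n d" "X \<in> carrier_mat d m" "Y \<in> carrier_mat d m" "B * X = B * Y"
  shows "X = Y"
proof (rule mat_eq_if_mult_vec_eq[OF assms(3,4)])
  fix v :: "'a vec" assume v: "v \<in> carrier_vec m"
  have "B *\<^sub>v (X *\<^sub>v v) = B *\<^sub>v (Y *\<^sub>v v)"
    using assoc_mult_mat_vec[OF assms(2,3) v] assoc_mult_mat_vec[OF assms(2,4) v] assms(5) by simp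
  then show "X *\<^sub>v v = Y *\<^sub>v v"
    using assms v inj_mat_cancel_vec[OF assms(1,2), of "X *\<^sub>v v" "Y *\<^sub>v v"] by auto
qed

section \<open>Invariant subspaces and Schur's lemma for families of matrices\<close>

lemma irreducible_rep_iff:
  "irreducible_rep U n \<rho> \<longleftrightarrow> n \<ge> 1 \<and>
    (\<forall>W. vsubspace n W \<longrightarrow> (\<forall>g\<in>U. \<forall>x\<in>W. \<rho> g *\<^sub>v x \<in> W) \<longrightarrow> W = {0\<^sub>v n} \<or> W = carrier_vec n)"
  unfolding irreducible_rep_def vsubspace_def by blast

text \<open>The columns of \<open>B\<close> span an irreducible invariant subspace of \<open>X\<close>, on which \<open>R\<close> acts by \<open>\<rho>\<close>.\<close>
lemma irreducible_subrep:
  fixes R :: "'a \<Rightarrow> complex mat"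
  assumes R': "\<forall>a\<in>A. R a \<in> carrier_mat n n"
    and X: "vsubspace n X" "X \<noteq> {0\<^sub>v n}"
    and inv': "\<forall>a\<in>A. \<forall>x\<in>X. R a *\<^sub>v x \<in> X"
  shows "\<exists>d B \<rho>. d \<ge> 1 \<and> B \<in> carrier_mat n d \<and> inj_mat B \<and> (\<forall>v\<in>carrier_vec d. B *\<^sub>v v \<in> X) \<and>
    (\<forall>a\<in>A. \<rho> a \<in> carrier_mat d d \<and> R a * B = B * \<rho> a) \<and> irreducible_rep A d \<rho>"
proof -
  note R = bspec[OF R'] and inv = bspec[OF bspec[OF inv']]
  \<comment> \<open>Only invariance of the range is recorded, not a matrix of the action. A
    candidate with the fewest columns is irreducible, and the action \<open>\<rho>\<close> is read
    off afterwards from the images of the unit vectors.\<close>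
  define Q where "Q d B \<longleftrightarrow> d \<ge> 1 \<and> B \<in> carrier_mat n d \<and> inj_mat B \<and>
     (\<forall>v\<in>carrier_vec d. B *\<^sub>v v \<in> X \<and> (\<forall>a\<in>A. \<exists>w\<in>carrier_vec d. R a *\<^sub>v (B *\<^sub>v v) = B *\<^sub>v w))" for d B
  from vsubspace_basis[OF X(1)] obtain d0 B0 where B0: "B0 \<in> carrier_mat n d0" "inj_mat B0"
    "X = (\<lambda>v. B0 *\<^sub>v v) ` carrier_vec d0" .
  have d0: "d0 \<ge> 1"
  proof (rule ccontr)
    assume "\<not> d0 \<ge> 1"
    then have "B0 *\<^sub>v v = 0\<^sub>v n" if "v \<in> carrier_vec d0" for v
      using B0(1) that by (auto intro!: eq_vecI simp: scalar_prod_def)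
    then have "X \<subseteq> {0\<^sub>v n}" using B0(3) by auto
    then show False using X unfolding vsubspace_def by auto
  qed
  have "Q d0 B0" unfolding Q_def using B0 d0 inv by (auto simp: image_iff) 
  then have ex: "\<exists>d. \<exists>B. Q d B" by blast
  define d where "d = (LEAST d. \<exists>B. Q d B)"
  obtain B where QB: "Q d B" unfolding d_def using LeastI_ex[OF ex] by blast
  have least: "d \<le> d'" if "Q d' B'" for d' B' unfolding d_def using that by (intro Least_le) blast
  have B: "d \<ge> 1" "B \<in> carrier_mat n d" "inj_mat B" "\<And>v. v \<in> carrier_vec d \<Longrightarrow> B *\<^sub>v v \<in> X"
    and ex_w: "\<And>v a. v \<in> carrier_vec d \<Longrightarrow> a \<in> A \<Longrightarrow> \<exists>w\<in>carrier_vec d. R a *\<^sub>v (B *\<^sub>v v) = B *\<^sub>v w"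
    using QB unfolding Q_def by auto
  have "\<exists>r\<in>carrier_mat d d. R a * B = B * r" if a: "a \<in> A" for a
  proof -
    have "\<forall>j. \<exists>w\<in>carrier_vec d. R a *\<^sub>v (B *\<^sub>v unit_vec d j) = B *\<^sub>v w" using ex_w a by simp
    then obtain w where w: "\<And>j. w j \<in> carrier_vec d" "\<And>j. R a *\<^sub>v (B *\<^sub>v unit_vec d j) = B *\<^sub>v w j" by metis
    define r where "r = mat d d (\<lambda>(i,j). w j $ i)"
    have r: "r \<in> carrier_mat d d" by (simp add: r_def)
    have colw: "col r j = w j" if "j < d" for j using that w(1)[of j] by (auto simp: r_def intro!: eq_vecI)
    have "R a * B = B * r"
    proof (rule eq_matI)
      fix i j assume "i < dim_row (B * r)" "j < dim_col (B * r)"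
      then have ij: "i < n" "j < d" using B r by auto
      have RB: "R a * B \<in> carrier_mat n d" using R[OF a] B by auto
      have "(R a * B) $$ (i,j) = ((R a * B) *\<^sub>v unit_vec d j) $ i"
        using ij RB by (subst mult_mat_vec_index[OF RB]) 
           (auto simp: sum.delta if_distrib[of "\<lambda>x. _ * x"] cong: if_cong)
      also have "\<dots> = (B *\<^sub>v w j) $ i" using w(2)[of j] R[OF a] B(2) by simp
      also have "\<dots> = (B * r) $$ (i,j)" using ij B r colw by simp
      finally show "(R a * B) $$ (i,j) = (B * r) $$ (i,j)" .
    qed (use R[OF a] B r in auto)
    then show ?thesis using r by blast
  qed
  then obtain \<rho> where \<rho>: "\<And>a. a \<in> A \<Longrightarrow> \<rho> a \<in> carrier_mat d d" "\<And>a. a \<in> A \<Longrightarrow> R a * B = B * \<rho> a"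
    by metis
  have "irreducible_rep A d \<rho>"
    unfolding irreducible_rep_iff
  proof (intro conjI allI impI B(1))
    fix W assume W: "vsubspace d W" "\<forall>g\<in>A. \<forall>x\<in>W. \<rho> g *\<^sub>v x \<in> W"
    show "W = {0\<^sub>v d} \<or> W = carrier_vec d"
    proof (rule ccontr)
      assume neg: "\<not> ?thesis"
      from vsubspace_basis[OF W(1)] obtain e C where C: "C \<in> carrier_mat d e" "inj_mat C"
        "W = (\<lambda>v. C *\<^sub>v v) ` carrier_vec e" .
      have e1: "e \<ge> 1"
      proof (rule ccontr)
        assume "\<not> e \<ge> 1"
        then have "C *\<^sub>v v = 0\<^sub>v d" if "v \<in> carrier_vec e" for v
          using C(1) that by (auto intro!: eq_vecI simp: scalar_prod_def)
        then have "W \<subseteq> {0\<^sub>v d}" using C(3) by auto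
        then show False using W neg unfolding vsubspace_def by auto
      qed
      have "e \<noteq> d"
      proof
        assume "e = d"
        then have "W = carrier_vec d" using inj_mat_range_UNIV[of C d] C by (auto simp: image_iff)
        then show False using neg by simp
      qed
      then have ed: "e < d" using inj_mat_le[OF C(1,2)] by simp
      \<comment> \<open>A proper invariant subspace with basis \<open>C\<close> would make the range
        of \<open>B * C\<close> invariant, with fewer columns than the least
        \<open>d\<close>.\<close>
      have "Q e (B * C)"
        unfolding Q_def
      proof (intro conjI ballI e1)
        show BC: "B * C \<in> carrier_mat n e" using B C by auto
        show "inj_mat (B * C)" unfolding inj_mat_def
        proof (intro ballI impI)
          fix v assume "v \<in> carrier_vec (dim_col (B * C))" "B * C *\<^sub>v v = 0\<^sub>v (dim_row (B * C))"
          then have v: "v \<in> carrier_vec e" and "B *\<^sub>v (C *\<^sub>v v) = 0\<^sub>v n" using B C by auto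
          then have "C *\<^sub>v v = 0\<^sub>v d" using inj_matD[OF B(3,2), of "C *\<^sub>v v"] C by auto
          then show "v = 0\<^sub>v (dim_col (B * C))" using inj_matD[OF C(2,1) v] C by auto
        qed
        fix v :: "complex vec" assume v: "v \<in> carrier_vec e"
        have Cv: "C *\<^sub>v v \<in> carrier_vec d" using C v by auto
        then show "B * C *\<^sub>v v \<in> X" using B C v by auto
        fix a assume a: "a \<in> A"
        have "\<rho> a *\<^sub>v (C *\<^sub>v v) \<in> W" using W(2) a C(3) v by auto
        then obtain w where w: "w \<in> carrier_vec e" "\<rho> a *\<^sub>v (C *\<^sub>v v) = C *\<^sub>v w" using C(3) by auto
        have "R a *\<^sub>v (B * C *\<^sub>v v) = (R a * B) *\<^sub>v (C *\<^sub>v v)" using R[OF a] B C v Cv by simp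
        also have "\<dots> = B *\<^sub>v (\<rho> a *\<^sub>v (C *\<^sub>v v))" using \<rho>(1)[OF a] B(2) Cv by (simp add: \<rho>(2)[OF a])
        also have "\<dots> = B * C *\<^sub>v w" using w B C by simp
        finally show "\<exists>w\<in>carrier_vec e. R a *\<^sub>v (B * C *\<^sub>v v) = B * C *\<^sub>v w" using w by blast
      qed
      from least[OF this] ed show False by simp
    qed
  qed
  then show ?thesis
    by (intro exI[of _ d] exI[of _ B] exI[of _ \<rho>] conjI B(1-3) ballI B(4) \<rho>)
qed

lemma mat_mult_zero_vec: "A \<in> carrier_mat n m \<Longrightarrow> A *\<^sub>v 0\<^sub>v m = 0\<^sub>v n"
  by (auto intro!: eq_vecI)

lemma scalar_mat_mult_vec:
  "v \<in> carrier_vec n \<Longrightarrow> (c \<cdot>\<^sub>m 1\<^sub>m n) *\<^sub>v v = (c :: 'a :: field) \<cdot>\<^sub>v v"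
  by (intro eq_vecI) (auto simp: mult_mat_vec_index[of _ n n] if_distrib[of "\<lambda>x. _ * x"]
    if_distrib[of "\<lambda>x. x * _"] sum.delta cong: if_cong)

text \<open>Kernel and image of \<open>T\<close> are invariant, so \<open>T\<close> is injective and
  surjective, and the two dimension bounds give \<open>n = m\<close>. As \<open>A\<close> is a bare
  index set, the result serves group representations and commuting families of matrices
  alike.\<close>

lemma schur:
  fixes \<rho> \<sigma> :: "'a \<Rightarrow> complex mat"
  assumes \<rho>: "irreducible_rep A n \<rho>" "\<And>a. a \<in> A \<Longrightarrow> \<rho> a \<in> carrier_mat n n"
    and \<sigma>: "irreducible_rep A m \<sigma>" "\<And>a. a \<in> A \<Longrightarrow> \<sigma> a \<in> carrier_mat m m"
    and T: "T \<in> carrier_mat m n" "\<And>a. a \<in> A \<Longrightarrow> T * \<rho> a = \<sigma> a * T" "T \<noteq> 0\<^sub>m m n"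
  shows "n = m \<and> inj_mat T"
proof -
  have comm: "T *\<^sub>v (\<rho> a *\<^sub>v v) = \<sigma> a *\<^sub>v (T *\<^sub>v v)" if "a \<in> A" "v \<in> carrier_vec n" for a v
    using assoc_mult_mat_vec[OF T(1) \<rho>(2)[OF that(1)] that(2)]
      assoc_mult_mat_vec[OF \<sigma>(2)[OF that(1)] T(1) that(2)] T(2)[OF that(1)] by simp
  obtain v0 where v0: "v0 \<in> carrier_vec n" "T *\<^sub>v v0 \<noteq> 0\<^sub>v m"
  proof (rule ccontr)
    assume neg: "\<not> thesis"
    have z: "(0\<^sub>m m n :: complex mat) *\<^sub>v v = 0\<^sub>v m" if "v \<in> carrier_vec n" for v
      using that by (auto intro!: eq_vecI simp: scalar_prod_def)
    have "T *\<^sub>v v = 0\<^sub>m m n *\<^sub>v v" if "v \<in> carrier_vec n" for v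
      using neg \<open>\<And>v0. v0 \<in> carrier_vec n \<Longrightarrow> T *\<^sub>v v0 \<noteq> 0\<^sub>v m \<Longrightarrow> thesis\<close> that z by metis
    from mat_eq_if_mult_vec_eq[OF T(1) _ this] have "T = 0\<^sub>m m n" by simp
    then show False using T(3) by simp
  qed
  let ?K = "{v \<in> carrier_vec n. T *\<^sub>v v = 0\<^sub>v m}"
  have sK: "vsubspace n ?K" unfolding vsubspace_def using T(1) mult_mat_vec[OF T(1)]
    by (auto simp: mult_add_distrib_mat_vec[OF T(1)])
  have invK: "\<forall>g\<in>A. \<forall>x\<in>?K. \<rho> g *\<^sub>v x \<in> ?K"
    using comm mult_mat_vec_carrier[OF \<rho>(2)] mat_mult_zero_vec[OF \<sigma>(2)] by auto
  have "?K = {0\<^sub>v n} \<or> ?K = carrier_vec n"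
    using \<rho>(1) sK invK unfolding irreducible_rep_iff by meson
  then have K: "?K = {0\<^sub>v n}" using v0 by auto
  then have inj: "inj_mat T" unfolding inj_mat_def using T(1) by auto
  let ?I = "(\<lambda>v. T *\<^sub>v v) ` carrier_vec n"
  have sI: "vsubspace m ?I" unfolding vsubspace_def
  proof (intro conjI ballI allI)
    show "?I \<subseteq> carrier_vec m" using T(1) by auto
    have "0\<^sub>v m = T *\<^sub>v 0\<^sub>v n" using T(1) by auto
    then show "0\<^sub>v m \<in> ?I" by (rule image_eqI) simp
    fix x assume "x \<in> ?I"
    then obtain u where u: "u \<in> carrier_vec n" "x = T *\<^sub>v u" by auto
    show "c \<cdot>\<^sub>v x \<in> ?I" for c using mult_mat_vec[OF T(1) u(1), of c] u by (metis image_eqI smult_carrier_vec)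
    fix y assume "y \<in> ?I"
    then obtain w where w: "w \<in> carrier_vec n" "y = T *\<^sub>v w" by auto
    then show "x + y \<in> ?I"
      using mult_add_distrib_mat_vec[OF T(1) u(1) w(1)] u by (metis add_carrier_vec image_eqI)
  qed
  have invI: "\<forall>g\<in>A. \<forall>x\<in>?I. \<sigma> g *\<^sub>v x \<in> ?I"
  proof (intro ballI)
    fix g x assume g: "g \<in> A" and "x \<in> ?I"
    then obtain u where u: "u \<in> carrier_vec n" "x = T *\<^sub>v u" by auto
    show "\<sigma> g *\<^sub>v x \<in> ?I"
      unfolding u(2) comm[OF g u(1), symmetric]
      by (rule imageI) (rule mult_mat_vec_carrier[OF \<rho>(2)[OF g] u(1)])
  qed
  have "?I = {0\<^sub>v m} \<or> ?I = carrier_vec m"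
    using \<sigma>(1) sI invI unfolding irreducible_rep_iff by meson
  moreover have "?I \<noteq> {0\<^sub>v m}" using v0 by blast
  ultimately have "?I = carrier_vec m" by meson
  then have "\<And>x. x \<in> carrier_vec m \<Longrightarrow> \<exists>v\<in>carrier_vec n. x = T *\<^sub>v v" by blast
  from surj_mat_le[OF T(1) this] inj_mat_le[OF T(1) inj] inj show ?thesis by simp
qed

text \<open>Over the complex numbers \<open>T\<close> has an eigenvalue \<open>c\<close>; then
  \<open>T - c\<close> is an intertwiner with nonzero kernel, hence zero.\<close>

lemma schur_scalar:
  assumes \<rho>: "irreducible_rep A n \<rho>" "\<And>a. a \<in> A \<Longrightarrow> \<rho> a \<in> carrier_mat n n"
    and T: "T \<in> carrier_mat n n" "\<And>a. a \<in> A \<Longrightarrow> T * \<rho> a = \<rho> a * T"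
  shows "\<exists>c. T = c \<cdot>\<^sub>m 1\<^sub>m n"
proof -
  have n: "n > 0" using \<rho>(1) unfolding irreducible_rep_def by simp
  obtain c where "eigenvalue T c" using spectrum_non_empty[OF T(1) n] unfolding spectrum_def by auto
  then obtain v where v: "v \<in> carrier_vec n" "v \<noteq> 0\<^sub>v n" "T *\<^sub>v v = c \<cdot>\<^sub>v v"
    using T(1) unfolding eigenvalue_def eigenvector_def by auto
  define S where "S = T - c \<cdot>\<^sub>m 1\<^sub>m n"
  have S: "S \<in> carrier_mat n n" unfolding S_def by (rule minus_carrier_mat) simp
  have "S * \<rho> a = \<rho> a * S" if "a \<in> A" for a
    using \<rho>(2)[OF that] T(1) T(2)[OF that] unfolding S_def
    by (simp add: mult_smult_assoc_mat[of "1\<^sub>m n" n n "\<rho> a" n c] mult_smult_distrib[of "\<rho> a" n n "1\<^sub>m n" n c] minus_mult_distrib_mat[of _ n n] mult_minus_distrib_mat[of _ n n])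
  moreover have "S *\<^sub>v v = 0\<^sub>v n"
    unfolding S_def using v T(1) by (simp add: scalar_mat_mult_vec minus_mult_distrib_mat_vec[of _ n n])
  then have "\<not> inj_mat S" using v S unfolding inj_mat_def by auto
  ultimately have "S = 0\<^sub>m n n" using schur[OF \<rho> \<rho> S] by blast
  have "T = c \<cdot>\<^sub>m 1\<^sub>m n"
  proof (rule eq_matI)
    fix i j assume "i < dim_row (c \<cdot>\<^sub>m 1\<^sub>m n)" "j < dim_col (c \<cdot>\<^sub>m 1\<^sub>m n)"
    then show "T $$ (i, j) = (c \<cdot>\<^sub>m 1\<^sub>m n) $$ (i, j)"
      using arg_cong[OF \<open>S = 0\<^sub>m n n\<close>, of "\<lambda>M. M $$ (i,j)"] T(1) unfolding S_def by simp
  qed (use T in auto)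
  then show ?thesis ..
qed

text \<open>On an irreducible subspace of the family each member commutes with all others, so it is
  a scalar by Schur; any nonzero vector there will do.\<close>

lemma common_eigenvector:
  fixes R :: "'a \<Rightarrow> complex mat"
  assumes R: "\<And>a. a \<in> A \<Longrightarrow> R a \<in> carrier_mat n n" and n: "n \<ge> 1"
    and comm: "\<And>a b. a \<in> A \<Longrightarrow> b \<in> A \<Longrightarrow> R a * R b = R b * R a"
  obtains w \<phi> where "w \<in> carrier_vec n" "w \<noteq> 0\<^sub>v n" "\<And>a. a \<in> A \<Longrightarrow> R a *\<^sub>v w = \<phi> a \<cdot>\<^sub>v w"
proof -
  have e0: "unit_vec n 0 \<noteq> (0\<^sub>v n :: complex vec)" using n by (simp add: unit_vec_nonzero)
  have h1: "vsubspace n (carrier_vec n :: complex vec set)" by (auto simp: vsubspace_def)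
  have h2: "carrier_vec n \<noteq> {0\<^sub>v n :: complex vec}"
  proof
    assume "carrier_vec n = {0\<^sub>v n :: complex vec}"
    then have "unit_vec n 0 \<in> {0\<^sub>v n :: complex vec}" by (rule subst) simp
    then show False using e0 by simp
  qed
  have h3: "\<forall>a\<in>A. \<forall>x\<in>carrier_vec n. R a *\<^sub>v x \<in> carrier_vec n"
    by (intro ballI mult_mat_vec_carrier[OF R])
  have h0: "\<forall>a\<in>A. R a \<in> carrier_mat n n" using R by blast
  from irreducible_subrep[OF h0 h1 h2 h3] obtain d B \<rho> where d: "d \<ge> 1" "B \<in> carrier_mat n d" "inj_mat B"
    and \<rho>0: "\<forall>a\<in>A. \<rho> a \<in> carrier_mat d d \<and> R a * B = B * \<rho> a" and irr: "irreducible_rep A d \<rho>"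
    by (elim exE conjE)
  have \<rho>: "a \<in> A \<Longrightarrow> \<rho> a \<in> carrier_mat d d" "a \<in> A \<Longrightarrow> R a * B = B * \<rho> a" for a using \<rho>0 by auto
  have prod: "R a * R b * B = B * (\<rho> a * \<rho> b)" if "a \<in> A" "b \<in> A" for a b
  proof -
    have "R a * R b * B = R a * (R b * B)" using R that d by (intro assoc_mult_mat) auto
    also have "\<dots> = R a * B * \<rho> b" unfolding \<rho>(2)[OF that(2)]
      by (rule assoc_mult_mat[symmetric, of _ n n _ d _ d]) (use R \<rho> that d in auto)
    also have "\<dots> = B * (\<rho> a * \<rho> b)" unfolding \<rho>(2)[OF that(1)]
      by (rule assoc_mult_mat) (use R \<rho> that d in auto)
    finally show ?thesis .
  qed
  have "\<exists>c. \<rho> a = c \<cdot>\<^sub>m 1\<^sub>m d" if a: "a \<in> A" for a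
  proof (rule schur_scalar[OF irr \<rho>(1)])
    fix b assume b: "b \<in> A"
    show "\<rho> a * \<rho> b = \<rho> b * \<rho> a"
      using prod[OF a b] prod[OF b a] comm[OF a b] \<rho>(1)[OF a] \<rho>(1)[OF b]
      by (rule_tac inj_mat_cancel[OF d(3,2), of _ d]) auto
  qed (use \<rho>(1)[OF a] in auto)
  then obtain \<phi> where \<phi>: "\<And>a. a \<in> A \<Longrightarrow> \<rho> a = \<phi> a \<cdot>\<^sub>m 1\<^sub>m d" by metis
  let ?u = "unit_vec d 0 :: complex vec"
  let ?w = "B *\<^sub>v ?u"
  have "R a *\<^sub>v ?w = \<phi> a \<cdot>\<^sub>v ?w" if a: "a \<in> A" for a
  proof -
    have "R a *\<^sub>v ?w = (R a * B) *\<^sub>v ?u" using R[OF a] d by simp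
    also have "\<dots> = B *\<^sub>v (\<rho> a *\<^sub>v ?u)" unfolding \<rho>(2)[OF a] using \<rho>(1)[OF a] d by simp
    also have "\<rho> a *\<^sub>v ?u = \<phi> a \<cdot>\<^sub>v ?u"
      unfolding \<phi>[OF a] by (rule scalar_mat_mult_vec) simp
    also have "B *\<^sub>v (\<phi> a \<cdot>\<^sub>v ?u) = \<phi> a \<cdot>\<^sub>v ?w" by (rule mult_mat_vec[OF d(2)]) simp
    finally show ?thesis .
  qed
  moreover have "?w \<noteq> 0\<^sub>v n"
  proof
    assume "?w = 0\<^sub>v n"
    then have "?u = 0\<^sub>v d" using inj_matD[OF d(3,2), of ?u] by simp
    then show False using d(1) by (simp add: unit_vec_nonzero)
  qed
  moreover have "?w \<in> carrier_vec n" using d by auto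
  ultimately show ?thesis using that by blast
qed

text \<open>Applying \<open>R a - \<phi> i0 a\<close> to a linear relation removes the term
  \<open>i0\<close> and multiplies the others by differences of weights; the induction hypothesis
  and \<open>dist\<close> then make the coefficients vanish.\<close>

lemma distinct_weights_independent:
  fixes R :: "'a \<Rightarrow> complex mat"
  assumes "finite I" and R: "\<And>a. a \<in> A \<Longrightarrow> R a \<in> carrier_mat n n"
    and w: "\<And>i. i \<in> I \<Longrightarrow> w i \<in> carrier_vec n" "\<And>i. i \<in> I \<Longrightarrow> w i \<noteq> 0\<^sub>v n"
    and ev: "\<And>i a. i \<in> I \<Longrightarrow> a \<in> A \<Longrightarrow> R a *\<^sub>v w i = \<phi> i a \<cdot>\<^sub>v w i"
    and dist: "\<And>i j. i \<in> I \<Longrightarrow> j \<in> I \<Longrightarrow> i \<noteq> j \<Longrightarrow> \<exists>a\<in>A. \<phi> i a \<noteq> \<phi> j a"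
    and zero: "\<forall>k<n. (\<Sum>i\<in>I. c i * w i $ k) = 0"
  shows "\<forall>i\<in>I. c i = 0"
  using assms(1) w ev dist zero
proof (induction I arbitrary: c rule: finite_induct)
  case (insert i0 I)
  have key: "c i * (\<phi> i a - \<phi> i0 a) = 0" if a: "a \<in> A" and i: "i \<in> I" for a i
  proof -
    have "\<forall>k<n. (\<Sum>i\<in>I. c i * (\<phi> i a - \<phi> i0 a) * w i $ k) = 0"
    proof (intro allI impI)
      fix k assume k: "k < n"
      have e: "\<phi> i a * w i $ k = (\<Sum>l<n. R a $$ (k,l) * w i $ l)" if "i \<in> insert i0 I" for i
        using arg_cong[OF insert.prems(3)[OF that a], of "\<lambda>u. u $ k"] insert.prems(1)[OF that] k
          mult_mat_vec_index[OF R[OF a] insert.prems(1)[OF that] k] by simp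
      have "(\<Sum>i\<in>insert i0 I. c i * (\<phi> i a * w i $ k)) = (\<Sum>i\<in>insert i0 I. \<Sum>l<n. R a $$ (k,l) * (c i * w i $ l))"
        by (intro sum.cong refl) (simp add: e sum_distrib_left mult_ac)
      also have "\<dots> = (\<Sum>l<n. R a $$ (k,l) * (\<Sum>i\<in>insert i0 I. c i * w i $ l))"
        by (subst sum.swap) (simp add: sum_distrib_left)
      also have "\<dots> = 0" using insert.prems(5) by (intro sum.neutral) auto
      finally have 1: "(\<Sum>i\<in>insert i0 I. c i * (\<phi> i a * w i $ k)) = 0" .
      have 2: "\<phi> i0 a * (\<Sum>i\<in>insert i0 I. c i * w i $ k) = 0" using insert.prems(5) k by simp
      have "(\<Sum>i\<in>insert i0 I. c i * (\<phi> i a - \<phi> i0 a) * w i $ k) =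
        (\<Sum>i\<in>insert i0 I. c i * (\<phi> i a * w i $ k)) - \<phi> i0 a * (\<Sum>i\<in>insert i0 I. c i * w i $ k)"
        by (simp only: sum_distrib_left flip: sum_subtractf) (simp add: algebra_simps)
      then have "(\<Sum>i\<in>insert i0 I. c i * (\<phi> i a - \<phi> i0 a) * w i $ k) = 0" using 1 2 by simp
      then show "(\<Sum>i\<in>I. c i * (\<phi> i a - \<phi> i0 a) * w i $ k) = 0" using insert.hyps by simp
    qed
    from insert.IH[OF _ _ _ _ this] show ?thesis using insert.prems i by auto
  qed
  have cI: "\<forall>i\<in>I. c i = 0"
  proof
    fix i assume i: "i \<in> I"
    then obtain a where "a \<in> A" "\<phi> i a \<noteq> \<phi> i0 a" using insert.prems(4)[of i i0] insert.hyps by auto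
    then show "c i = 0" using key[OF _ i] by force
  qed
  obtain k where k: "k < n" "w i0 $ k \<noteq> 0"
  proof (rule ccontr)
    assume neg: "\<not> thesis"
    have "w i0 = 0\<^sub>v n" using neg that insert.prems(1)[of i0] by (intro eq_vecI) auto
    then show False using insert.prems(2) by simp
  qed
  have "(\<Sum>i\<in>I. c i * w i $ k) = 0" using cI by simp
  then have "c i0 * w i0 $ k = 0" using insert.prems(5) k insert.hyps by force
  then show ?case using k cI by auto
qed auto

text \<open>The tool that turns pairwise distinct conjugates of one character into a lower bound for
  the dimension of a representation.\<close>

lemma card_distinct_weights_le:
  fixes R :: "'a \<Rightarrow> complex mat"
  assumes "finite I" "\<And>a. a \<in> A \<Longrightarrow> R a \<in> carrier_mat n n"
    and "\<And>i. i \<in> I \<Longrightarrow> w i \<in> carrier_vec n" "\<And>i. i \<in> I \<Longrightarrow> w i \<noteq> 0\<^sub>v n"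
    and "\<And>i a. i \<in> I \<Longrightarrow> a \<in> A \<Longrightarrow> R a *\<^sub>v w i = \<phi> i a \<cdot>\<^sub>v w i"
    and "\<And>i j. i \<in> I \<Longrightarrow> j \<in> I \<Longrightarrow> i \<noteq> j \<Longrightarrow> \<exists>a\<in>A. \<phi> i a \<noteq> \<phi> j a"
  shows "card I \<le> n"
proof (rule ccontr)
  assume "\<not> card I \<le> n"
  then have "card {..<n} < card I" by simp
  from homogeneous_system[OF _ assms(1) this, of "\<lambda>i k. w i $ k"] obtain c where
    "\<exists>i\<in>I. c i \<noteq> 0" "\<forall>k<n. (\<Sum>i\<in>I. c i * w i $ k) = 0" by auto
  with distinct_weights_independent[OF assms this(2)] show False by blast
qed

section \<open>Representations of finite groups\<close>

definition group_rep :: "('a, 'm) monoid_scheme \<Rightarrow> nat \<Rightarrow> ('a \<Rightarrow> complex mat) \<Rightarrow> bool" where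
  "group_rep G n \<rho> \<longleftrightarrow> (\<forall>g\<in>carrier G. \<rho> g \<in> carrier_mat n n) \<and> \<rho> \<one>\<^bsub>G\<^esub> = 1\<^sub>m n \<and>
     (\<forall>g\<in>carrier G. \<forall>h\<in>carrier G. \<rho> (g \<otimes>\<^bsub>G\<^esub> h) = \<rho> g * \<rho> h)"

text \<open>The dimensions are arguments here, whereas \<open>rep_iso\<close> reads them off the
  value at 1. Keeping them explicit suits families whose members have different dimensions.\<close>

definition rep_equiv :: "'a set \<Rightarrow> nat \<Rightarrow> ('a \<Rightarrow> complex mat) \<Rightarrow> nat \<Rightarrow> ('a \<Rightarrow> complex mat) \<Rightarrow> bool" where
  "rep_equiv S n \<rho> m \<sigma> \<longleftrightarrow> n = m \<and>
     (\<exists>P\<in>carrier_mat n n. invertible_mat P \<and> (\<forall>g\<in>S. P * \<rho> g = \<sigma> g * P))"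

lemma invertible_matI:
  "A \<in> carrier_mat n n \<Longrightarrow> C \<in> carrier_mat n n \<Longrightarrow> C * A = 1\<^sub>m n \<Longrightarrow> A * C = 1\<^sub>m n \<Longrightarrow> invertible_mat A"
  unfolding invertible_mat_def inverts_mat_def by auto

lemma invertible_matE:
  assumes "invertible_mat A" "A \<in> carrier_mat n n"
  obtains C where "C \<in> carrier_mat n n" "C * A = 1\<^sub>m n" "A * C = 1\<^sub>m n"
proof -
  from assms obtain C where C: "A * C = 1\<^sub>m n" "C * A = 1\<^sub>m (dim_row C)"
    unfolding invertible_mat_def inverts_mat_def by auto
  then have "dim_col C = n" "dim_row C = n" using assms(2) 
    by (metis index_mult_mat(3) index_one_mat(3), metis carrier_matD(2) index_mult_mat(3) index_one_mat(3))
  then show ?thesis using that[of C] C by auto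
qed

lemma schur_zero:
  assumes "irreducible_rep A n \<rho>" "\<And>a. a \<in> A \<Longrightarrow> \<rho> a \<in> carrier_mat n n"
    and "irreducible_rep A m \<sigma>" "\<And>a. a \<in> A \<Longrightarrow> \<sigma> a \<in> carrier_mat m m"
    and "T \<in> carrier_mat m n" "\<And>a. a \<in> A \<Longrightarrow> T * \<rho> a = \<sigma> a * T" "\<not> rep_equiv A n \<rho> m \<sigma>"
  shows "T = 0\<^sub>m m n"
proof (rule ccontr)
  assume "T \<noteq> 0\<^sub>m m n"
  from schur[OF assms(1-6) this] have nm: "n = m" "inj_mat T" by auto
  then have "T \<in> carrier_mat n n" using assms(5) by simp
  from inj_mat_square_invertible[OF this nm(2)] invertible_matI[OF this]
  have "invertible_mat T" by metis
  then show False using assms(5-7) nm unfolding rep_equiv_def by auto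
qed

lemma rep_equiv_refl:
  assumes "\<And>g. g \<in> S \<Longrightarrow> \<rho> g \<in> carrier_mat n n"
  shows "rep_equiv S n \<rho> n \<rho>"
  using assms unfolding rep_equiv_def
  by (auto intro!: bexI[of _ "1\<^sub>m n"] invertible_matI[of _ n "1\<^sub>m n"]
      simp: left_mult_one_mat[of _ n n] right_mult_one_mat[of _ n n])

lemma sum_norm_square_zero:
  fixes z :: "nat \<Rightarrow> complex"
  assumes "(\<Sum>i<n. z i * cnj (z i)) = 0" "i < n"
  shows "z i = 0"
proof -
  have "complex_of_real (\<Sum>i<n. (cmod (z i))\<^sup>2) = 0"
    using assms(1) by (simp only: of_real_sum complex_norm_square)
  then have "(\<Sum>i<n. (cmod (z i))\<^sup>2) = 0" by (simp only: of_real_eq_0_iff)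
  then show ?thesis using assms(2) by (subst (asm) sum_nonneg_eq_0_iff) auto
qed

lemma adjoint_sum:
  fixes A B :: "complex mat"
  assumes "A \<in> carrier_mat n n" "B \<in> carrier_mat n n" "u \<in> carrier_vec n" "y \<in> carrier_vec n"
    and "\<And>i j. i < n \<Longrightarrow> j < n \<Longrightarrow> B $$ (i,j) = cnj (A $$ (j,i))"
  shows "(\<Sum>i<n. (A *\<^sub>v u) $ i * cnj (y $ i)) = (\<Sum>j<n. u $ j * cnj ((B *\<^sub>v y) $ j))"
proof -
  have "(\<Sum>i<n. (A *\<^sub>v u) $ i * cnj (y $ i)) = (\<Sum>i<n. \<Sum>j<n. A $$ (i,j) * u $ j * cnj (y $ i))"
    by (intro sum.cong refl) (subst mult_mat_vec_index[OF assms(1,3)], auto simp: sum_distrib_right)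
  also have "\<dots> = (\<Sum>j<n. \<Sum>i<n. A $$ (i,j) * u $ j * cnj (y $ i))" by (rule sum.swap)
  also have "\<dots> = (\<Sum>j<n. u $ j * cnj ((B *\<^sub>v y) $ j))"
    by (intro sum.cong refl) (subst mult_mat_vec_index[OF assms(2,4)], auto simp: sum_distrib_left assms(5) mult_ac)
  finally show ?thesis .
qed

text \<open>A normal matrix has no nilpotent part. With \<open>B\<close> the adjoint of
  \<open>A\<close>, commuting gives \<open>A (B A u) = B (A A u) = 0\<close>, so first
  \<open>B A u\<close> and then \<open>A u\<close> has length zero.\<close>

lemma normal_mat_square_zero:
  fixes A B :: "complex mat"
  assumes A: "A \<in> carrier_mat n n" and B: "B \<in> carrier_mat n n" and u: "u \<in> carrier_vec n"
    and adj: "\<And>i j. i < n \<Longrightarrow> j < n \<Longrightarrow> B $$ (i,j) = cnj (A $$ (j,i))"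
    and comm: "A * B = B * A" and z: "A *\<^sub>v (A *\<^sub>v u) = 0\<^sub>v n"
  shows "A *\<^sub>v u = 0\<^sub>v n"
proof -
  let ?v = "A *\<^sub>v u"
  let ?w = "B *\<^sub>v ?v"
  have v: "?v \<in> carrier_vec n" and w: "?w \<in> carrier_vec n" using A B u by auto
  have adj': "A $$ (i,j) = cnj (B $$ (j,i))" if "i < n" "j < n" for i j using adj[OF that(2,1)] by simp
  have "A *\<^sub>v ?w = B *\<^sub>v (A *\<^sub>v ?v)"
    using assoc_mult_mat_vec[OF A B v] assoc_mult_mat_vec[OF B A v] comm by simp
  then have Aw: "A *\<^sub>v ?w = 0\<^sub>v n" unfolding z mat_mult_zero_vec[OF B] .
  have "(\<Sum>i<n. ?w $ i * cnj (?w $ i)) = (\<Sum>j<n. ?v $ j * cnj ((A *\<^sub>v ?w) $ j))"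
    by (rule adjoint_sum[OF B A v w adj'])
  also have "\<dots> = 0" unfolding Aw by simp
  finally have w0: "?w $ i = 0" if "i < n" for i using sum_norm_square_zero[of "\<lambda>i. ?w $ i" n i] that by simp
  have "(\<Sum>i<n. ?v $ i * cnj (?v $ i)) = (\<Sum>j<n. u $ j * cnj (?w $ j))"
    by (rule adjoint_sum[OF A B u v adj])
  also have "\<dots> = 0" using w0 by simp
  finally have "?v $ i = 0" if "i < n" for i using sum_norm_square_zero[of "\<lambda>i. ?v $ i" n i] that by simp
  then show ?thesis using v A by (intro eq_vecI) auto
qed

lemma sum_mult_mat_diag_comm:
  assumes "A \<in> carrier_mat n n" "B \<in> carrier_mat n n"
  shows "(\<Sum>i<n. (A * B) $$ (i,i)) = (\<Sum>i<n. (B * A) $$ (i,i :: nat) :: 'a :: comm_semiring_0)"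
proof -
  have "(\<Sum>i<n. (A * B) $$ (i,i)) = (\<Sum>i<n. \<Sum>j<n. A $$ (i,j) * B $$ (j,i))"
    by (intro sum.cong refl mult_mat_index[OF assms]) auto
  also have "\<dots> = (\<Sum>j<n. \<Sum>i<n. B $$ (j,i) * A $$ (i,j))" by (subst sum.swap) (simp add: mult.commute)
  also have "\<dots> = (\<Sum>i<n. (B * A) $$ (i,i))"
    by (intro sum.cong refl mult_mat_index[OF assms(2,1), symmetric]) auto
  finally show ?thesis .
qed

lemma rep_equiv_trace:
  assumes "rep_equiv S n \<rho> m \<sigma>" "g \<in> S" "\<rho> g \<in> carrier_mat n n" "\<sigma> g \<in> carrier_mat m m"
  shows "(\<Sum>i<n. \<rho> g $$ (i,i)) = (\<Sum>i<m. \<sigma> g $$ (i,i))"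
proof -
  obtain P where P: "P \<in> carrier_mat n n" "invertible_mat P" "P * \<rho> g = \<sigma> g * P" and nm: "n = m"
    using assms(1,2) unfolding rep_equiv_def by auto
  obtain Q where Q: "Q \<in> carrier_mat n n" "Q * P = 1\<^sub>m n" "P * Q = 1\<^sub>m n"
    using invertible_matE[OF P(2,1)] .
  have "Q * (P * \<rho> g) = Q * P * \<rho> g" by (rule assoc_mult_mat[OF Q(1) P(1) assms(3), symmetric])
  then have r: "\<rho> g = Q * (\<sigma> g * P)" using Q P assms(3) by simp
  have "\<sigma> g * P * Q = \<sigma> g * (P * Q)" using assoc_mult_mat[of "\<sigma> g" n n P n Q n] assms(4) P Q nm by blast
  then have s: "\<sigma> g * P * Q = \<sigma> g" using Q assms(4) nm by simp
  show ?thesis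
    using sum_mult_mat_diag_comm[of Q n "\<sigma> g * P"] Q P assms(4) nm unfolding r s by (simp add: s)
qed

lemma rep_equiv_sym:
  assumes "rep_equiv S n \<rho> m \<sigma>" "\<And>g. g \<in> S \<Longrightarrow> \<rho> g \<in> carrier_mat n n" "\<And>g. g \<in> S \<Longrightarrow> \<sigma> g \<in> carrier_mat m m"
  shows "rep_equiv S m \<sigma> n \<rho>"
proof -
  obtain P where P: "P \<in> carrier_mat n n" "invertible_mat P" "\<And>g. g \<in> S \<Longrightarrow> P * \<rho> g = \<sigma> g * P" and nm: "n = m"
    using assms(1) unfolding rep_equiv_def by auto
  obtain Q where Q: "Q \<in> carrier_mat n n" "Q * P = 1\<^sub>m n" "P * Q = 1\<^sub>m n"
    using invertible_matE[OF P(2,1)] .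
  have "Q * \<sigma> g = \<rho> g * Q" if g: "g \<in> S" for g
  proof -
    note r = assms(2)[OF g] and s = assms(3)[OF g, folded nm]
    have "Q * \<sigma> g = Q * (\<sigma> g * (P * Q))" using Q s by simp
    also have "\<dots> = Q * ((\<sigma> g * P) * Q)" using assoc_mult_mat[OF s P(1) Q(1)] by simp
    also have "\<dots> = Q * (P * (\<rho> g * Q))" unfolding P(3)[OF g, symmetric] using assoc_mult_mat[OF P(1) r Q(1)] by simp
    also have "\<dots> = (Q * P) * (\<rho> g * Q)" using assoc_mult_mat[OF Q(1) P(1), of "\<rho> g * Q" n] r Q(1) by simp
    also have "\<dots> = \<rho> g * Q" using Q r by simp
    finally show ?thesis .
  qed
  moreover have "invertible_mat Q" using invertible_matI[OF Q(1) P(1) Q(3,2)] .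
  ultimately show ?thesis using nm Q(1) unfolding rep_equiv_def by auto
qed

section \<open>Averaging over a finite group and orthogonality relations\<close>

locale finite_group = group G for G (structure) +
  assumes fin: "finite (carrier G)"
begin

lemma sum_left_mult:
  fixes f :: "'a \<Rightarrow> 'c::comm_monoid_add"
  assumes "h \<in> carrier G"
  shows "(\<Sum>g\<in>carrier G. f (h \<otimes> g)) = (\<Sum>g\<in>carrier G. f g)"
  by (rule sum.reindex_bij_witness[of _ "\<lambda>g. inv h \<otimes> g" "\<lambda>g. h \<otimes> g"])
    (use assms in \<open>auto simp flip: m_assoc\<close>)

lemma sum_right_mult:
  fixes f :: "'a \<Rightarrow> 'c::comm_monoid_add"
  assumes "h \<in> carrier G"
  shows "(\<Sum>g\<in>carrier G. f (g \<otimes> h)) = (\<Sum>g\<in>carrier G. f g)"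
  by (rule sum.reindex_bij_witness[of _ "\<lambda>g. g \<otimes> inv h" "\<lambda>g. g \<otimes> h"])
    (use assms in \<open>auto simp: m_assoc\<close>)

lemma sum_inv:
  fixes f :: "'a \<Rightarrow> 'c::comm_monoid_add"
  shows "(\<Sum>g\<in>carrier G. f (inv g)) = (\<Sum>g\<in>carrier G. f g)"
  by (rule sum.reindex_bij_witness[of _ "\<lambda>g. inv g" "\<lambda>g. inv g"]) auto

lemma group_repD:
  assumes "group_rep G n \<rho>"
  shows "g \<in> carrier G \<Longrightarrow> \<rho> g \<in> carrier_mat n n" "\<rho> \<one> = 1\<^sub>m n"
    "g \<in> carrier G \<Longrightarrow> h \<in> carrier G \<Longrightarrow> \<rho> (g \<otimes> h) = \<rho> g * \<rho> h"
  using assms unfolding group_rep_def by auto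

lemma rep_mult_entry:
  assumes "group_rep G n \<rho>" "g \<in> carrier G" "h \<in> carrier G" "i < n" "j < n"
  shows "(\<Sum>p<n. \<rho> g $$ (i,p) * \<rho> h $$ (p,j)) = \<rho> (g \<otimes> h) $$ (i,j)"
  using group_repD[OF assms(1)] assms mult_mat_index[of "\<rho> g" n n "\<rho> h" n i j] by simp

text \<open>\<open>T\<close> is the sum over \<open>g\<close> of
  \<open>\<sigma> g * E * \<rho> (inv g)\<close>, where \<open>E\<close> is the matrix unit with its
  1 in row \<open>l\<close> and column \<open>k\<close>; replacing \<open>g\<close> by
  \<open>h \<otimes> g\<close> gives the intertwining property.\<close>

lemma averaged_intertwiner:
  assumes \<rho>: "group_rep G n \<rho>" and \<sigma>: "group_rep G m \<sigma>" and l: "l < m" and k: "k < n"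
    and T: "T = mat m n (\<lambda>(i,j). \<Sum>g\<in>carrier G. \<sigma> g $$ (i,l) * \<rho> (inv g) $$ (k,j))"
    and h: "h \<in> carrier G"
  shows "T * \<rho> h = \<sigma> h * T"
proof (rule eq_matI)
  have Tc: "T \<in> carrier_mat m n" by (simp add: T)
  note \<rho>h = group_repD(1)[OF \<rho> h] and \<sigma>h = group_repD(1)[OF \<sigma> h]
  fix i j assume "i < dim_row (\<sigma> h * T)" "j < dim_col (\<sigma> h * T)"
  then have ij: "i < m" "j < n" using Tc \<sigma>h by auto
  have "(T * \<rho> h) $$ (i,j) = (\<Sum>p<n. (\<Sum>g\<in>carrier G. \<sigma> g $$ (i,l) * \<rho> (inv g) $$ (k,p)) * \<rho> h $$ (p,j))"
    using ij by (subst mult_mat_index[OF Tc \<rho>h]) (auto simp: T)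
  also have "\<dots> = (\<Sum>g\<in>carrier G. \<sigma> g $$ (i,l) * (\<Sum>p<n. \<rho> (inv g) $$ (k,p) * \<rho> h $$ (p,j)))"
    by (simp add: sum_distrib_right sum_distrib_left mult.assoc) (rule sum.swap)
  also have "\<dots> = (\<Sum>g\<in>carrier G. \<sigma> g $$ (i,l) * \<rho> (inv g \<otimes> h) $$ (k,j))"
    by (intro sum.cong refl arg_cong2[of _ _ _ _ "(*)"] rep_mult_entry[OF \<rho>]) (use h k ij in auto)
  also have "\<dots> = (\<Sum>g\<in>carrier G. \<sigma> (h \<otimes> g) $$ (i,l) * \<rho> (inv (h \<otimes> g) \<otimes> h) $$ (k,j))"
    by (rule sum_left_mult[OF h, symmetric])
  also have "\<dots> = (\<Sum>g\<in>carrier G. (\<Sum>p<m. \<sigma> h $$ (i,p) * \<sigma> g $$ (p,l)) * \<rho> (inv g) $$ (k,j))"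
    by (intro sum.cong refl arg_cong2[of _ _ _ _ "(*)"])
      (use h l ij in \<open>auto simp: rep_mult_entry[OF \<sigma>] inv_mult_group m_assoc\<close>)
  also have "\<dots> = (\<Sum>p<m. \<sigma> h $$ (i,p) * (\<Sum>g\<in>carrier G. \<sigma> g $$ (p,l) * \<rho> (inv g) $$ (k,j)))"
    by (simp add: sum_distrib_right sum_distrib_left mult.assoc) (rule sum.swap)
  also have "\<dots> = (\<sigma> h * T) $$ (i,j)"
    using ij by (subst mult_mat_index[OF \<sigma>h Tc]) (auto simp: T)
  finally show "(T * \<rho> h) $$ (i,j) = (\<sigma> h * T) $$ (i,j)" .
qed (use group_repD(1)[OF \<rho> h] group_repD(1)[OF \<sigma> h] in \<open>auto simp: T\<close>)

lemma schur_orthogonality_inequivalent: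
  assumes \<rho>: "group_rep G n \<rho>" "irreducible_rep (carrier G) n \<rho>"
    and \<sigma>: "group_rep G m \<sigma>" "irreducible_rep (carrier G) m \<sigma>"
    and ne: "\<not> rep_equiv (carrier G) n \<rho> m \<sigma>"
    and ind: "i < m" "l < m" "k < n" "j < n"
  shows "(\<Sum>g\<in>carrier G. \<sigma> g $$ (i,l) * \<rho> (inv g) $$ (k,j)) = 0"
proof -
  define T where "T = mat m n (\<lambda>(i,j). \<Sum>g\<in>carrier G. \<sigma> g $$ (i,l) * \<rho> (inv g) $$ (k,j))"
  have Tc: "T \<in> carrier_mat m n" by (simp add: T_def)
  have "T = 0\<^sub>m m n"
    by (rule schur_zero[OF \<rho>(2) group_repD(1)[OF \<rho>(1)] \<sigma>(2) group_repD(1)[OF \<sigma>(1)] Tc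
          averaged_intertwiner[OF \<rho>(1) \<sigma>(1) ind(2,3) T_def] ne])
  then have "T $$ (i,j) = 0" using ind by simp
  then show ?thesis using ind by (simp add: T_def)
qed

text \<open>By Schur the averaged matrix is a scalar \<open>c\<close>. Its trace is found by cycling
  the product to \<open>\<rho> (inv g \<otimes> g)\<close>, so \<open>n * c\<close> is the order of
  the group or 0.\<close>

lemma schur_orthogonality_same:
  assumes \<rho>: "group_rep G n \<rho>" "irreducible_rep (carrier G) n \<rho>"
    and ind: "i < n" "l < n" "k < n" "j < n"
  shows "(\<Sum>g\<in>carrier G. \<rho> g $$ (i,l) * \<rho> (inv g) $$ (k,j)) =
     (if i = j \<and> l = k then of_nat (card (carrier G)) / of_nat n else 0)"
proof -
  define T where "T = mat n n (\<lambda>(i,j). \<Sum>g\<in>carrier G. \<rho> g $$ (i,l) * \<rho> (inv g) $$ (k,j))"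
  have Tc: "T \<in> carrier_mat n n" by (simp add: T_def)
  from schur_scalar[OF \<rho>(2) group_repD(1)[OF \<rho>(1)] Tc averaged_intertwiner[OF \<rho>(1) \<rho>(1) ind(2,3) T_def]]
  obtain c where c: "T = c \<cdot>\<^sub>m 1\<^sub>m n" by blast
  have "(\<Sum>p<n. T $$ (p,p)) = (\<Sum>g\<in>carrier G. \<Sum>p<n. \<rho> (inv g) $$ (k,p) * \<rho> g $$ (p,l))"
    by (simp add: T_def mult.commute) (rule sum.swap)
  also have "\<dots> = (\<Sum>g\<in>carrier G. \<rho> (inv g \<otimes> g) $$ (k,l))"
    by (intro sum.cong refl rep_mult_entry[OF \<rho>(1)]) (use ind in auto)
  also have "\<dots> = (\<Sum>g\<in>carrier G. if k = l then 1 else 0)"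
    by (intro sum.cong refl) (use ind group_repD(2)[OF \<rho>(1)] in auto)
  finally have "of_nat n * c = (if k = l then of_nat (card (carrier G)) else 0)" by (simp add: c)
  moreover have "T $$ (i,j) = (if i = j then c else 0)" using ind by (simp add: c)
  moreover have "n > 0" using ind by simp
  ultimately show ?thesis using ind by (auto simp: T_def field_simps)
qed

text \<open>Matrix coefficients of inequivalent irreducible representations are linearly independent
  functions on the group: more of them than group elements would satisfy a relation, and pairing it
  with \<open>\<rho> f0 (inv g) $$ (b,a)\<close> isolates one coefficient.\<close>

lemma sum_dim_squares_le:
  fixes \<rho> :: "'f \<Rightarrow> 'a \<Rightarrow> complex mat"
  assumes F: "finite F"
    and rep: "\<And>f. f \<in> F \<Longrightarrow> group_rep G (n f) (\<rho> f)"
    and irr: "\<And>f. f \<in> F \<Longrightarrow> irreducible_rep (carrier G) (n f) (\<rho> f)"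
    and ne: "\<And>f f'. f \<in> F \<Longrightarrow> f' \<in> F \<Longrightarrow> f \<noteq> f' \<Longrightarrow> \<not> rep_equiv (carrier G) (n f) (\<rho> f) (n f') (\<rho> f')"
  shows "(\<Sum>f\<in>F. (n f)\<^sup>2) \<le> card (carrier G)"
proof (rule ccontr)
  assume neg: "\<not> ?thesis"
  define I where "I = (SIGMA f:F. {..<n f} \<times> {..<n f})"
  have finI: "finite I" using F by (auto simp: I_def)
  have "card I = (\<Sum>f\<in>F. (n f)\<^sup>2)" unfolding I_def by (subst card_SigmaI) (auto simp: F power2_eq_square)
  then have "card (carrier G) < card I" using neg by simp
  from homogeneous_system[OF fin finI this, of "\<lambda>x g. case x of (f,i,j) \<Rightarrow> \<rho> f g $$ (i,j)"]
  obtain c where c: "\<exists>x\<in>I. c x \<noteq> 0" "\<forall>g\<in>carrier G. (\<Sum>x\<in>I. c x * (case x of (f,i,j) \<Rightarrow> \<rho> f g $$ (i,j))) = 0"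
    by blast
  then obtain f0 a b where x: "(f0,a,b) \<in> I" "c (f0,a,b) \<noteq> 0" by auto
  then have f0: "f0 \<in> F" "a < n f0" "b < n f0" by (auto simp: I_def)
  have "0 = (\<Sum>g\<in>carrier G. \<rho> f0 (inv g) $$ (b,a) * (\<Sum>x\<in>I. c x * (case x of (f,i,j) \<Rightarrow> \<rho> f g $$ (i,j))))"
    using c(2) by simp
  also have "\<dots> = (\<Sum>x\<in>I. c x * (\<Sum>g\<in>carrier G. (case x of (f,i,j) \<Rightarrow> \<rho> f g $$ (i,j)) * \<rho> f0 (inv g) $$ (b,a)))"
    by (simp add: sum_distrib_left mult_ac) (subst sum.swap, simp add: mult_ac)
  also have "\<dots> = (\<Sum>x\<in>I. if x = (f0,a,b) then c x * (of_nat (card (carrier G)) / of_nat (n f0)) else 0)"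
  proof (intro sum.cong refl)
    fix x assume "x \<in> I"
    then obtain f i j where x: "x = (f,i,j)" "f \<in> F" "i < n f" "j < n f" by (auto simp: I_def)
    show "c x * (\<Sum>g\<in>carrier G. (case x of (f,i,j) \<Rightarrow> \<rho> f g $$ (i,j)) * \<rho> f0 (inv g) $$ (b,a)) =
      (if x = (f0,a,b) then c x * (of_nat (card (carrier G)) / of_nat (n f0)) else 0)"
    proof (cases "f = f0")
      case True
      then show ?thesis using schur_orthogonality_same[OF rep[OF f0(1)] irr[OF f0(1)], of i j b a] x f0 by simp
    next
      case False
      then show ?thesis
        using schur_orthogonality_inequivalent[OF rep[OF f0(1)] irr[OF f0(1)] rep[OF x(2)] irr[OF x(2)]
            ne[OF f0(1) x(2) False[symmetric]] x(3,4) f0(3,2)] x(1) by simp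
    qed
  qed
  also have "\<dots> = c (f0,a,b) * (of_nat (card (carrier G)) / of_nat (n f0))" using finI x by simp
  finally have "card (carrier G) = 0" using x f0 by simp
  then show False using fin one_closed by auto
qed

definition conjugate_in :: "'a \<Rightarrow> 'a \<Rightarrow> bool" where
  "conjugate_in x y \<longleftrightarrow> (\<exists>h\<in>carrier G. y = h \<otimes> x \<otimes> inv h)"

lemma class_function_commute:
  assumes f: "\<And>g h. g \<in> carrier G \<Longrightarrow> h \<in> carrier G \<Longrightarrow> f (h \<otimes> g \<otimes> inv h) = f g"
    and "a \<in> carrier G" "b \<in> carrier G"
  shows "f (a \<otimes> b) = f (b \<otimes> a)"
  using f[of "a \<otimes> b" b] assms by (simp add: m_assoc)

text \<open>The sum of \<open>f g\<close> times \<open>\<rho> g\<close> commutes with the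
  representation because \<open>f\<close> is constant on conjugacy classes, so Schur makes it a
  scalar, and \<open>tr\<close> says that its trace is zero.\<close>

lemma class_function_scalar:
  assumes f: "\<And>g h. g \<in> carrier G \<Longrightarrow> h \<in> carrier G \<Longrightarrow> f (h \<otimes> g \<otimes> inv h) = f g"
    and \<rho>: "group_rep G n \<rho>" "irreducible_rep (carrier G) n \<rho>"
    and tr: "(\<Sum>g\<in>carrier G. f g * (\<Sum>i<n. \<rho> g $$ (i,i))) = 0"
    and ij: "i < n" "j < n"
  shows "(\<Sum>g\<in>carrier G. f g * \<rho> g $$ (i,j)) = 0"
proof -
  define S where "S = mat n n (\<lambda>(i,j). \<Sum>g\<in>carrier G. f g * \<rho> g $$ (i,j))"
  have Sc: "S \<in> carrier_mat n n" by (simp add: S_def)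
  have "S * \<rho> h = \<rho> h * S" if h: "h \<in> carrier G" for h
  proof (rule eq_matI)
    note \<rho>h = group_repD(1)[OF \<rho>(1) h]
    fix i j assume "i < dim_row (\<rho> h * S)" "j < dim_col (\<rho> h * S)"
    then have ij: "i < n" "j < n" using Sc \<rho>h by auto
    have "(S * \<rho> h) $$ (i,j) = (\<Sum>p<n. (\<Sum>g\<in>carrier G. f g * \<rho> g $$ (i,p)) * \<rho> h $$ (p,j))"
      using ij by (subst mult_mat_index[OF Sc \<rho>h]) (auto simp: S_def)
    also have "\<dots> = (\<Sum>g\<in>carrier G. f g * (\<Sum>p<n. \<rho> g $$ (i,p) * \<rho> h $$ (p,j)))"
      by (simp add: sum_distrib_right sum_distrib_left mult.assoc) (rule sum.swap)
    also have "\<dots> = (\<Sum>g\<in>carrier G. f g * \<rho> (g \<otimes> h) $$ (i,j))"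
      by (intro sum.cong refl arg_cong2[of _ _ _ _ "(*)"] rep_mult_entry[OF \<rho>(1)]) (use h ij in auto)
    also have "\<dots> = (\<Sum>g\<in>carrier G. f (h \<otimes> g) * \<rho> (h \<otimes> g \<otimes> h) $$ (i,j))"
      by (rule sum_left_mult[OF h, symmetric])
    also have "\<dots> = (\<Sum>g\<in>carrier G. f (h \<otimes> (g \<otimes> inv h)) * \<rho> (h \<otimes> (g \<otimes> inv h) \<otimes> h) $$ (i,j))"
      using h by (intro sum_right_mult[symmetric]) auto
    also have "\<dots> = (\<Sum>g\<in>carrier G. f g * (\<Sum>p<n. \<rho> h $$ (i,p) * \<rho> g $$ (p,j)))"
    proof (intro sum.cong refl)
      fix g assume g: "g \<in> carrier G"
      have "f (h \<otimes> (g \<otimes> inv h)) = f g" using f[OF g h] g h by (simp add: m_assoc)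
      moreover have "h \<otimes> (g \<otimes> inv h) \<otimes> h = h \<otimes> g" using g h by (simp add: m_assoc)
      ultimately show "f (h \<otimes> (g \<otimes> inv h)) * \<rho> (h \<otimes> (g \<otimes> inv h) \<otimes> h) $$ (i,j) =
          f g * (\<Sum>p<n. \<rho> h $$ (i,p) * \<rho> g $$ (p,j))"
        using rep_mult_entry[OF \<rho>(1) h g ij] by simp
    qed
    also have "\<dots> = (\<Sum>p<n. \<rho> h $$ (i,p) * (\<Sum>g\<in>carrier G. f g * \<rho> g $$ (p,j)))"
      by (simp add: sum_distrib_left mult_ac) (rule sum.swap)
    also have "\<dots> = (\<rho> h * S) $$ (i,j)"
      using ij by (subst mult_mat_index[OF \<rho>h Sc]) (auto simp: S_def)
    finally show "(S * \<rho> h) $$ (i,j) = (\<rho> h * S) $$ (i,j)" .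
  qed (use group_repD(1)[OF \<rho>(1) h] Sc in auto)
  from schur_scalar[OF \<rho>(2) group_repD(1)[OF \<rho>(1)] Sc this] obtain c where c: "S = c \<cdot>\<^sub>m 1\<^sub>m n" by blast
  have "of_nat n * c = (\<Sum>p<n. S $$ (p,p))" by (simp add: c)
  also have "\<dots> = (\<Sum>g\<in>carrier G. f g * (\<Sum>i<n. \<rho> g $$ (i,i)))"
    by (simp add: S_def sum_distrib_left) (rule sum.swap)
  finally have "c = 0" using tr ij by simp
  then have "S $$ (i,j) = 0" using c ij by simp
  then show ?thesis using ij by (simp add: S_def)
qed


text \<open>\<open>F\<close> acts on the regular representation by a normal operator commuting with the group. On an
  irreducible subrepresentation of its image it is a scalar of trace zero, which contradicts normality.\<close>
lemma class_function_zero: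
  fixes F :: "'a \<Rightarrow> complex"
  assumes F: "\<And>g h. g \<in> carrier G \<Longrightarrow> h \<in> carrier G \<Longrightarrow> F (h \<otimes> g \<otimes> inv h) = F g"
    and tr: "\<And>n \<rho>. group_rep G n \<rho> \<Longrightarrow> irreducible_rep (carrier G) n \<rho> \<Longrightarrow>
        (\<Sum>g\<in>carrier G. F g * (\<Sum>i<n. \<rho> g $$ (i,i))) = 0"
    and x: "x \<in> carrier G"
  shows "F x = 0"
proof (rule ccontr)
  assume Fx: "F x \<noteq> 0"
  define N where "N = card (carrier G)"
  obtain e where e: "bij_betw e {..<N} (carrier G)"
    using ex_bij_betw_nat_finite[OF fin] by (auto simp: N_def atLeast0LessThan)
  define idx where "idx = inv_into {..<N} e"
  have ec: "e i \<in> carrier G" if "i < N" for i using e that by (auto simp: bij_betw_def)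
  have idx_e: "idx (e i) = i" if "i < N" for i
    unfolding idx_def using e that by (auto simp: bij_betw_def inv_into_f_f)
  have e_idx: "e (idx g) = g" and idx_l: "idx g < N" if "g \<in> carrier G" for g
    unfolding idx_def using e that by (auto simp: bij_betw_def f_inv_into_f intro: inv_into_into[of g e "{..<N}", simplified])
  have sum_e: "(\<Sum>k<N. \<phi> (e k)) = (\<Sum>g\<in>carrier G. \<phi> g)" for \<phi> :: "'a \<Rightarrow> complex"
    by (rule sum.reindex_bij_betw[OF e])
  \<comment> \<open>The left regular representation: \<open>R h\<close> sends the
    \<open>j\<close>-th basis vector to the one belonging to \<open>h \<otimes> e j\<close>.
    \<open>RF\<close> is the sum of \<open>F g\<close> times \<open>R g\<close>, and
    \<open>RS\<close> is its adjoint.\<close>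
  define R where "R h = mat N N (\<lambda>(i,j). if j = idx (inv h \<otimes> e i) then 1 else (0::complex))" for h
  define RF where "RF = mat N N (\<lambda>(i,j). F (e i \<otimes> inv (e j)))"
  define RS where "RS = mat N N (\<lambda>(i,j). cnj (F (e j \<otimes> inv (e i))))"
  have Rc: "R h \<in> carrier_mat N N" for h by (simp add: R_def)
  have RFc: "RF \<in> carrier_mat N N" and RSc: "RS \<in> carrier_mat N N" by (auto simp: RF_def RS_def)
  have R_left: "(R h * M) $$ (i,j) = M $$ (idx (inv h \<otimes> e i), j)"
    if "h \<in> carrier G" "M \<in> carrier_mat N k" "i < N" "j < k" for h M k i j
  proof -
    have "idx (inv h \<otimes> e i) < N" using that ec by (intro idx_l) auto
    then show ?thesis using that
      by (subst mult_mat_index[OF Rc that(2)]) (auto simp: R_def if_distrib[of "\<lambda>x. x * _"] sum.delta cong: if_cong)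
  qed
  have swap: "j = idx (inv h \<otimes> e k) \<longleftrightarrow> k = idx (h \<otimes> e j)" if "h \<in> carrier G" "j < N" "k < N" for h j k
  proof
    assume "j = idx (inv h \<otimes> e k)"
    then have "e j = inv h \<otimes> e k" using that ec e_idx by simp
    then have "h \<otimes> e j = e k" using that ec by (simp flip: m_assoc)
    then show "k = idx (h \<otimes> e j)" using that idx_e by simp
  next
    assume "k = idx (h \<otimes> e j)"
    then have "e k = h \<otimes> e j" using that ec e_idx by simp
    then have "inv h \<otimes> e k = e j" using that ec by (simp flip: m_assoc)
    then show "j = idx (inv h \<otimes> e k)" using that idx_e by simp
  qed
  have R_right: "(M * R h) $$ (i,j) = M $$ (i, idx (h \<otimes> e j))"
    if "h \<in> carrier G" "M \<in> carrier_mat N N" "i < N" "j < N" for h M i j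
  proof -
    have l: "idx (h \<otimes> e j) < N" using that ec by (intro idx_l) auto
    have "(M * R h) $$ (i,j) = (\<Sum>k<N. M $$ (i,k) * (if k = idx (h \<otimes> e j) then 1 else 0))"
      using that by (subst mult_mat_index[OF that(2) Rc]) (auto simp: R_def swap intro!: sum.cong)
    then show ?thesis using l by (simp add: if_distrib[of "\<lambda>x. _ * x"] sum.delta cong: if_cong)
  qed
  have R_mult: "R (g \<otimes> h) = R g * R h" if "g \<in> carrier G" "h \<in> carrier G" for g h
  proof (rule eq_matI)
    fix i j assume "i < dim_row (R g * R h)" "j < dim_col (R g * R h)"
    then have ij: "i < N" "j < N" using Rc[of g] Rc[of h] by auto
    have l: "idx (inv g \<otimes> e i) < N" using that ij ec by (intro idx_l) auto
    show "R (g \<otimes> h) $$ (i,j) = (R g * R h) $$ (i,j)"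
      unfolding R_left[OF that(1) Rc ij] using ij l that ec e_idx
      by (simp add: R_def inv_mult_group m_assoc)
  qed (use Rc[of g] Rc[of h] Rc[of "g \<otimes> h"] in auto)
  have R_one: "R \<one> = 1\<^sub>m N"
    by (rule eq_matI) (auto simp: R_def ec idx_e)
  have RF_comm: "R h * RF = RF * R h" if h: "h \<in> carrier G" for h
  proof (rule eq_matI)
    fix i j assume "i < dim_row (RF * R h)" "j < dim_col (RF * R h)"
    then have ij: "i < N" "j < N" using Rc[of h] RFc by auto
    have l: "idx (inv h \<otimes> e i) < N" "idx (h \<otimes> e j) < N" using h ij ec by (auto intro!: idx_l)
    have "F (inv h \<otimes> e i \<otimes> inv (e j)) = F (inv h \<otimes> (e i \<otimes> inv (e j)))" using h ij ec by (simp add: m_assoc)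
    also have "\<dots> = F (e i \<otimes> inv (e j) \<otimes> inv h)" using h ij ec by (intro class_function_commute[of F, OF F]) auto
    also have "\<dots> = F (e i \<otimes> inv (h \<otimes> e j))" using h ij ec by (simp add: m_assoc inv_mult_group)
    finally show "(R h * RF) $$ (i,j) = (RF * R h) $$ (i,j)"
      unfolding R_left[OF h RFc ij] R_right[OF h RFc ij] using ij l h ec e_idx by (simp add: RF_def)
  qed (use Rc[of h] RFc in auto)
  \<comment> \<open>Replacing \<open>g\<close> by \<open>g \<otimes> e j\<close> and translating
    back matches the two sums, since \<open>F\<close> is constant on conjugacy classes.\<close>
  have normal: "RF * RS = RS * RF"
  proof (rule eq_matI)
    fix i j assume "i < dim_row (RS * RF)" "j < dim_col (RS * RF)"
    then have ij: "i < N" "j < N" using RFc RSc by auto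
    have "(RF * RS) $$ (i,j) = (\<Sum>k<N. F (e i \<otimes> inv (e k)) * cnj (F (e j \<otimes> inv (e k))))"
      using ij by (subst mult_mat_index[OF RFc RSc]) (auto simp: RF_def RS_def)
    also have "\<dots> = (\<Sum>g\<in>carrier G. F (e i \<otimes> inv g) * cnj (F (e j \<otimes> inv g)))" by (rule sum_e)
    also have "\<dots> = (\<Sum>g\<in>carrier G. F (e i \<otimes> g) * cnj (F (e j \<otimes> g)))" by (rule sum_inv)
    also have "\<dots> = (\<Sum>g\<in>carrier G. cnj (F (e i \<otimes> (g \<otimes> e j) \<otimes> inv (e i))) * F (e i \<otimes> (g \<otimes> e j) \<otimes> inv (e j)))"
    proof (intro sum.cong refl)
      fix g assume g: "g \<in> carrier G"
      have "F (e i \<otimes> (g \<otimes> e j) \<otimes> inv (e i)) = F (e j \<otimes> g)"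
        using F[of "g \<otimes> e j" "e i"] g ij ec class_function_commute[of F g "e j", OF F] by simp
      moreover have "e i \<otimes> (g \<otimes> e j) \<otimes> inv (e j) = e i \<otimes> g" using g ij ec by (simp add: m_assoc)
      ultimately show "F (e i \<otimes> g) * cnj (F (e j \<otimes> g)) =
        cnj (F (e i \<otimes> (g \<otimes> e j) \<otimes> inv (e i))) * F (e i \<otimes> (g \<otimes> e j) \<otimes> inv (e j))" by (simp add: mult.commute)
    qed
    also have "\<dots> = (\<Sum>g\<in>carrier G. cnj (F (e i \<otimes> g \<otimes> inv (e i))) * F (e i \<otimes> g \<otimes> inv (e j)))"
      using ij ec by (intro sum_right_mult[of "e j" "\<lambda>g. cnj (F (e i \<otimes> g \<otimes> inv (e i))) * F (e i \<otimes> g \<otimes> inv (e j))"]) auto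
    also have "\<dots> = (\<Sum>g\<in>carrier G. cnj (F (g \<otimes> inv (e i))) * F (g \<otimes> inv (e j)))"
      using ij ec by (intro sum_left_mult[of "e i" "\<lambda>g. cnj (F (g \<otimes> inv (e i))) * F (g \<otimes> inv (e j))"]) auto
    also have "\<dots> = (\<Sum>k<N. cnj (F (e k \<otimes> inv (e i))) * F (e k \<otimes> inv (e j)))" by (rule sum_e[symmetric])
    also have "\<dots> = (RS * RF) $$ (i,j)"
      using ij by (subst mult_mat_index[OF RSc RFc]) (auto simp: RF_def RS_def)
    finally show "(RF * RS) $$ (i,j) = (RS * RF) $$ (i,j)" .
  qed (use RFc RSc in auto)
  define X where "X = (\<lambda>u. RF *\<^sub>v u) ` carrier_vec N"
  have X1: "vsubspace N X" unfolding vsubspace_def X_def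
  proof (intro conjI ballI allI)
    show "(*\<^sub>v) RF ` carrier_vec N \<subseteq> carrier_vec N" using RFc by auto
    show "0\<^sub>v N \<in> (*\<^sub>v) RF ` carrier_vec N" using mat_mult_zero_vec[OF RFc] by (intro image_eqI[of _ _ "0\<^sub>v N"]) auto
    fix y assume "y \<in> (*\<^sub>v) RF ` carrier_vec N"
    then obtain u where u: "u \<in> carrier_vec N" "y = RF *\<^sub>v u" by auto
    show "c \<cdot>\<^sub>v y \<in> (*\<^sub>v) RF ` carrier_vec N" for c
      using u mult_mat_vec[OF RFc u(1), of c] by (intro image_eqI[of _ _ "c \<cdot>\<^sub>v u"]) auto
    fix z assume "z \<in> (*\<^sub>v) RF ` carrier_vec N"
    then obtain w where w: "w \<in> carrier_vec N" "z = RF *\<^sub>v w" by auto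
    show "y + z \<in> (*\<^sub>v) RF ` carrier_vec N"
      using u w mult_add_distrib_mat_vec[OF RFc u(1) w(1)] by (intro image_eqI[of _ _ "u + w"]) auto
  qed
  have X2: "X \<noteq> {0\<^sub>v N}"
  proof
    assume "X = {0\<^sub>v N}"
    moreover have "RF *\<^sub>v unit_vec N (idx \<one>) \<in> X" unfolding X_def by (rule imageI) simp
    ultimately have "(RF *\<^sub>v unit_vec N (idx \<one>)) $ idx x = 0" using idx_l[OF x] by simp
    moreover have "(RF *\<^sub>v unit_vec N (idx \<one>)) $ idx x = F x"
      using idx_l[OF x] idx_l[OF one_closed] x
      by (subst mult_mat_vec_index[OF RFc]) (auto simp: RF_def e_idx if_distrib[of "\<lambda>x. _ * x"] sum.delta cong: if_cong)
    ultimately show False using Fx by simp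
  qed
  have X3: "\<forall>h\<in>carrier G. \<forall>y\<in>X. R h *\<^sub>v y \<in> X"
  proof (intro ballI)
    fix h y assume h: "h \<in> carrier G" and "y \<in> X"
    then obtain u where u: "u \<in> carrier_vec N" "y = RF *\<^sub>v u" by (auto simp: X_def)
    have "R h *\<^sub>v y = RF *\<^sub>v (R h *\<^sub>v u)"
      using assoc_mult_mat_vec[OF Rc RFc u(1), of h] assoc_mult_mat_vec[OF RFc Rc u(1), of h] RF_comm[OF h] u by simp
    then show "R h *\<^sub>v y \<in> X" unfolding X_def using mult_mat_vec_carrier[OF Rc u(1), of h] by (intro image_eqI) auto
  qed
  have "\<forall>h\<in>carrier G. R h \<in> carrier_mat N N" using Rc by blast
  from irreducible_subrep[OF this X1 X2 X3] obtain d B \<rho> where d: "d \<ge> 1"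
    and B: "B \<in> carrier_mat N d" "inj_mat B" "\<forall>v\<in>carrier_vec d. B *\<^sub>v v \<in> X"
    and \<rho>0: "\<forall>h\<in>carrier G. \<rho> h \<in> carrier_mat d d \<and> R h * B = B * \<rho> h"
    and irr: "irreducible_rep (carrier G) d \<rho>" by (elim exE conjE)
  have \<rho>: "\<rho> h \<in> carrier_mat d d" "R h * B = B * \<rho> h" if "h \<in> carrier G" for h using \<rho>0 that by auto
  have rep: "group_rep G d \<rho>" unfolding group_rep_def
  proof (intro conjI ballI)
    show "\<rho> \<one> = 1\<^sub>m d"
      using \<rho>[OF one_closed] R_one B by (rule_tac inj_mat_cancel[OF B(2,1), of _ d]) auto
    fix g h assume g: "g \<in> carrier G" and h: "h \<in> carrier G"
    show "\<rho> g \<in> carrier_mat d d" using \<rho>(1)[OF g] .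
    have "B * \<rho> (g \<otimes> h) = R g * R h * B" using \<rho>(2)[of "g \<otimes> h"] R_mult[OF g h] g h by simp
    also have "\<dots> = R g * (R h * B)" by (rule assoc_mult_mat[OF Rc Rc B(1)])
    also have "\<dots> = R g * B * \<rho> h" unfolding \<rho>(2)[OF h] by (rule assoc_mult_mat[OF Rc B(1) \<rho>(1)[OF h], symmetric])
    also have "\<dots> = B * (\<rho> g * \<rho> h)" unfolding \<rho>(2)[OF g] by (rule assoc_mult_mat[OF B(1) \<rho>(1)[OF g] \<rho>(1)[OF h]])
    finally show "\<rho> (g \<otimes> h) = \<rho> g * \<rho> h"
      using \<rho>(1)[OF g] \<rho>(1)[OF h] \<rho>(1)[of "g \<otimes> h"] g h by (rule_tac inj_mat_cancel[OF B(2,1), of _ d]) auto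
  qed
  \<comment> \<open>On the range of \<open>B\<close> the operator \<open>RF\<close> acts as the sum
    of \<open>F g\<close> times \<open>\<rho> g\<close>, which vanishes by
    \<open>class_function_scalar\<close>. So \<open>RF\<close> kills a nonzero vector of its own
    image, which is impossible for a normal matrix.\<close>
  have RFB: "(RF * B) $$ (i,j) = 0" if ij: "i < N" "j < d" for i j
  proof -
    have "(RF * B) $$ (i,j) = (\<Sum>k<N. F (e i \<otimes> inv (e k)) * B $$ (idx (e k), j))"
      using ij by (subst mult_mat_index[OF RFc B(1)]) (auto simp: RF_def idx_e)
    also have "\<dots> = (\<Sum>g\<in>carrier G. F (e i \<otimes> inv g) * B $$ (idx g, j))" by (rule sum_e)
    also have "\<dots> = (\<Sum>g\<in>carrier G. F (e i \<otimes> inv (inv g)) * B $$ (idx (inv g), j))"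
      by (rule sum_inv[symmetric])
    also have "\<dots> = (\<Sum>g\<in>carrier G. F (e i \<otimes> inv (inv (inv (e i) \<otimes> g))) * B $$ (idx (inv (inv (e i) \<otimes> g)), j))"
      using ec[OF ij(1)] by (intro sum_left_mult[symmetric]) auto
    also have "\<dots> = (\<Sum>g\<in>carrier G. F g * (R g * B) $$ (i,j))"
    proof (intro sum.cong refl)
      fix g assume g: "g \<in> carrier G"
      have "e i \<otimes> inv (inv (inv (e i) \<otimes> g)) = g" using g ec[OF ij(1)] by (simp flip: m_assoc)
      moreover have "inv (inv (e i) \<otimes> g) = inv g \<otimes> e i" using g ec[OF ij(1)] by (simp add: inv_mult_group)
      ultimately show "F (e i \<otimes> inv (inv (inv (e i) \<otimes> g))) * B $$ (idx (inv (inv (e i) \<otimes> g)), j) = F g * (R g * B) $$ (i,j)"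
        using R_left[OF g B(1) ij] by simp
    qed
    also have "\<dots> = (\<Sum>g\<in>carrier G. F g * (\<Sum>p<d. B $$ (i,p) * \<rho> g $$ (p,j)))"
      by (intro sum.cong refl) (simp add: \<rho>(2) mult_mat_index[OF B(1) \<rho>(1) ij])
    also have "\<dots> = (\<Sum>p<d. B $$ (i,p) * (\<Sum>g\<in>carrier G. F g * \<rho> g $$ (p,j)))"
      by (simp add: sum_distrib_left mult_ac) (rule sum.swap)
    also have "\<dots> = 0"
      by (intro sum.neutral ballI) (use class_function_scalar[of F, OF F rep irr tr[OF rep irr]] ij in auto)
    finally show ?thesis .
  qed
  let ?b = "B *\<^sub>v unit_vec d 0"
  have "?b \<in> X" using B(3) by simp
  then obtain u where u: "u \<in> carrier_vec N" "?b = RF *\<^sub>v u" by (auto simp: X_def)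
  have "RF * B = 0\<^sub>m N d" by (rule eq_matI) (use RFB RFc B in auto)
  then have "RF *\<^sub>v ?b = 0\<^sub>m N d *\<^sub>v unit_vec d 0" using assoc_mult_mat_vec[OF RFc B(1), of "unit_vec d 0"] by simp
  also have "\<dots> = 0\<^sub>v N" by (auto intro!: eq_vecI simp: scalar_prod_def)
  finally have "RF *\<^sub>v (RF *\<^sub>v u) = 0\<^sub>v N" using u(2) by simp
  moreover have "RS $$ (i,j) = cnj (RF $$ (j,i))" if "i < N" "j < N" for i j
    using that by (simp add: RF_def RS_def)
  ultimately have "RF *\<^sub>v u = 0\<^sub>v N"
    using normal_mat_square_zero[OF RFc RSc u(1) _ normal] by blast
  then have "?b = 0\<^sub>v N" using u(2) by simp
  then have "unit_vec d 0 = (0\<^sub>v d :: complex vec)" using inj_matD[OF B(2,1), of "unit_vec d 0"] by simp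
  then show False using d by simp
qed


text \<open>With fewer irreducible representations than chosen elements, some nonzero combination of
  the indicators of their classes pairs to zero with every character, against
  \<open>class_function_zero\<close>. A sample of pairwise non-conjugate elements suffices; the
  classes are never classified.\<close>

lemma card_irreps_ge:
  fixes x :: "'t \<Rightarrow> 'a" and \<rho> :: "'f \<Rightarrow> 'a \<Rightarrow> complex mat"
  assumes T: "finite T" "\<And>t. t \<in> T \<Longrightarrow> x t \<in> carrier G"
    and nc: "\<And>t t'. t \<in> T \<Longrightarrow> t' \<in> T \<Longrightarrow> conjugate_in (x t) (x t') \<Longrightarrow> t = t'"
    and F: "finite F" "\<And>f. f \<in> F \<Longrightarrow> group_rep G (n f) (\<rho> f)"
    and cover: "\<And>m \<sigma>. group_rep G m \<sigma> \<Longrightarrow> irreducible_rep (carrier G) m \<sigma> \<Longrightarrow>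
        \<exists>f\<in>F. rep_equiv (carrier G) m \<sigma> (n f) (\<rho> f)"
  shows "card T \<le> card F"
proof (rule ccontr)
  assume "\<not> ?thesis"
  then have "card F < card T" by simp
  define ind :: "'t \<Rightarrow> 'a \<Rightarrow> complex" where "ind t g = (if conjugate_in (x t) g then 1 else 0)" for t g
  from homogeneous_system[OF F(1) T(1) \<open>card F < card T\<close>,
      of "\<lambda>t f. \<Sum>g\<in>carrier G. ind t g * (\<Sum>i<n f. \<rho> f g $$ (i,i))"]
  obtain c where c: "\<exists>t\<in>T. c t \<noteq> 0"
    "\<And>f. f \<in> F \<Longrightarrow> (\<Sum>t\<in>T. c t * (\<Sum>g\<in>carrier G. ind t g * (\<Sum>i<n f. \<rho> f g $$ (i,i)))) = 0"
    by blast
  define K where "K g = (\<Sum>t\<in>T. c t * ind t g)" for g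
  have conj_step: "conjugate_in y (h \<otimes> g \<otimes> inv h)" if "conjugate_in y g" "y \<in> carrier G" "h \<in> carrier G" for y g h
  proof -
    from that obtain k where k: "k \<in> carrier G" "g = k \<otimes> y \<otimes> inv k" by (auto simp: conjugate_in_def)
    then have "h \<otimes> g \<otimes> inv h = (h \<otimes> k) \<otimes> y \<otimes> inv (h \<otimes> k)"
      using that by (simp add: m_assoc inv_mult_group)
    then show ?thesis unfolding conjugate_in_def using k that by blast
  qed
  have ind_class: "ind t (h \<otimes> g \<otimes> inv h) = ind t g" if "t \<in> T" "g \<in> carrier G" "h \<in> carrier G" for t g h
  proof -
    have "conjugate_in (x t) g" if "conjugate_in (x t) (h \<otimes> g \<otimes> inv h)"
    proof -
      have "inv h \<otimes> (h \<otimes> g \<otimes> inv h) \<otimes> inv (inv h) = g"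
        using \<open>g \<in> carrier G\<close> \<open>h \<in> carrier G\<close> by (simp add: m_assoc) (simp flip: m_assoc)
      then show ?thesis
        using conj_step[OF that T(2)[OF \<open>t \<in> T\<close>], of "inv h"] \<open>h \<in> carrier G\<close> by simp
    qed
    then show ?thesis using conj_step[OF _ T(2)[OF that(1)] that(3), of g] unfolding ind_def by auto
  qed
  have "K y = 0" if "y \<in> carrier G" for y
  proof (rule class_function_zero[OF _ _ that])
    show "K (h \<otimes> g \<otimes> inv h) = K g" if "g \<in> carrier G" "h \<in> carrier G" for g h
      unfolding K_def using ind_class that by (intro sum.cong) auto
    fix m \<sigma> assume \<sigma>: "group_rep G m \<sigma>" "irreducible_rep (carrier G) m \<sigma>"
    from cover[OF this] obtain f where f: "f \<in> F" "rep_equiv (carrier G) m \<sigma> (n f) (\<rho> f)" by blast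
    have "(\<Sum>g\<in>carrier G. K g * (\<Sum>i<m. \<sigma> g $$ (i,i))) = (\<Sum>g\<in>carrier G. K g * (\<Sum>i<n f. \<rho> f g $$ (i,i)))"
      by (intro sum.cong refl arg_cong2[of _ _ _ _ "(*)"] rep_equiv_trace[OF f(2)])
        (use group_repD(1)[OF \<sigma>(1)] group_repD(1)[OF F(2)[OF f(1)]] in auto)
    also have "\<dots> = (\<Sum>t\<in>T. c t * (\<Sum>g\<in>carrier G. ind t g * (\<Sum>i<n f. \<rho> f g $$ (i,i))))"
      unfolding K_def by (simp only: sum_distrib_right sum_distrib_left[of "c _"] mult.assoc) (rule sum.swap)
    also have "\<dots> = 0" using c(2)[OF f(1)] .
    finally show "(\<Sum>g\<in>carrier G. K g * (\<Sum>i<m. \<sigma> g $$ (i,i))) = 0" .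
  qed
  moreover obtain t where t: "t \<in> T" "c t \<noteq> 0" using c(1) by blast
  have "K (x t) = (\<Sum>s\<in>T. if s = t then c s else 0)" unfolding K_def
  proof (intro sum.cong refl)
    fix s assume s: "s \<in> T"
    have "x t = \<one> \<otimes> x t \<otimes> inv \<one>" using T(2)[OF t(1)] by simp
    then have "conjugate_in (x t) (x t)" unfolding conjugate_in_def by blast
    then show "c s * ind s (x t) = (if s = t then c s else 0)" using nc[OF s t(1)] by (auto simp: ind_def)
  qed
  then have "K (x t) = c t" using T(1) t(1) by simp
  ultimately show False using t T(2) by auto
qed

text \<open>The sum of squares bounds the size of a family of pairwise inequivalent irreducible
  representations, so a largest family exists, and by maximality it meets every equivalence class.
  Members are pairs of dimension and representation.\<close>

lemma many_irreps:
  fixes x :: "'t \<Rightarrow> 'a"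
  assumes T: "finite T" "\<And>t. t \<in> T \<Longrightarrow> x t \<in> carrier G"
    and nc: "\<And>t t'. t \<in> T \<Longrightarrow> t' \<in> T \<Longrightarrow> conjugate_in (x t) (x t') \<Longrightarrow> t = t'"
  shows "\<exists>F. finite F \<and> card T \<le> card F \<and> (\<Sum>f\<in>F. (fst f)\<^sup>2) \<le> card (carrier G) \<and>
    (\<forall>f\<in>F. group_rep G (fst f) (snd f) \<and> irreducible_rep (carrier G) (fst f) (snd f)) \<and>
    (\<forall>f\<in>F. \<forall>f'\<in>F. f \<noteq> f' \<longrightarrow> \<not> rep_equiv (carrier G) (fst f) (snd f) (fst f') (snd f'))"
proof -
  define P where "P F \<longleftrightarrow> finite F \<and>
    (\<forall>f\<in>F. group_rep G (fst f) (snd f) \<and> irreducible_rep (carrier G) (fst f) (snd f)) \<and>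
    (\<forall>f\<in>F. \<forall>f'\<in>F. f \<noteq> f' \<longrightarrow> \<not> rep_equiv (carrier G) (fst f) (snd f) (fst f') (snd f'))"
    for F :: "(nat \<times> ('a \<Rightarrow> complex mat)) set"
  have sq: "(\<Sum>f\<in>F. (fst f)\<^sup>2) \<le> card (carrier G)" if "P F" for F
    by (rule sum_dim_squares_le) (use that in \<open>auto simp: P_def\<close>)
  have bd: "card F \<le> card (carrier G)" if "P F" for F
  proof -
    have "1 \<le> (fst f)\<^sup>2" if "f \<in> F" for f
    proof -
      have "1 \<le> fst f" using \<open>P F\<close> that unfolding P_def irreducible_rep_def by blast
      then show ?thesis by simp
    qed
    then have "(\<Sum>f\<in>F. 1) \<le> (\<Sum>f\<in>F. (fst f)\<^sup>2)" by (intro sum_mono)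
    then show ?thesis using sq[OF that] by simp
  qed
  have "P {}" by (simp add: P_def)
  then have "\<exists>F. P F \<and> (\<forall>F'. P F' \<longrightarrow> card F' \<le> card F)"
    by (rule ex_has_greatest_nat[of P _ card "Suc (card (carrier G))"]) (simp add: bd less_Suc_eq_le)
  then obtain F where F: "P F" "\<And>F'. P F' \<Longrightarrow> card F' \<le> card F" by blast
  have "card T \<le> card F"
  proof (rule card_irreps_ge[where x = x and F = F and n = fst and \<rho> = snd])
    show "finite F" "\<And>f. f \<in> F \<Longrightarrow> group_rep G (fst f) (snd f)" using F(1) by (auto simp: P_def)
    fix m \<sigma> assume \<sigma>: "group_rep G m \<sigma>" "irreducible_rep (carrier G) m \<sigma>"
    show "\<exists>f\<in>F. rep_equiv (carrier G) m \<sigma> (fst f) (snd f)"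
    proof (rule ccontr)
      assume neg: "\<not> ?thesis"
      have neg': "\<not> rep_equiv (carrier G) (fst f) (snd f) m \<sigma>" if "f \<in> F" for f
      proof
        assume e: "rep_equiv (carrier G) (fst f) (snd f) m \<sigma>"
        have "group_rep G (fst f) (snd f)" using F(1) that by (auto simp: P_def)
        from rep_equiv_sym[OF e group_repD(1)[OF this] group_repD(1)[OF \<sigma>(1)]] neg that show False by blast
      qed
      have "P (insert (m,\<sigma>) F)" using F(1) \<sigma> neg neg' unfolding P_def by auto
      moreover have "(m,\<sigma>) \<notin> F"
      proof
        assume "(m,\<sigma>) \<in> F"
        moreover have "rep_equiv (carrier G) m \<sigma> m \<sigma>"
          by (rule rep_equiv_refl) (rule group_repD(1)[OF \<sigma>(1)])
        ultimately show False using neg by force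
      qed
      ultimately show False using F(2)[of "insert (m,\<sigma>) F"] F(1) by (auto simp: P_def)
    qed
  qed (use T nc in auto)
  then show ?thesis using F(1) sq[OF F(1)] unfolding P_def by blast
qed

end

section \<open>Discretely valued fields\<close>

text \<open>The general linear group has no small subgroups; closure under squaring is all that is
  used of a subgroup. The bound is chosen so that the absolute values of the entries of
  \<open>A - 1\<close> sum to at most 1/2, and its summand 1 keeps it positive for
  \<open>n = 0\<close>.\<close>

lemma squares_near_one_imp_one:
  fixes M :: "complex mat set"
  assumes M: "M \<subseteq> carrier_mat n n" and sq: "\<And>A. A \<in> M \<Longrightarrow> A * A \<in> M"
    and near: "\<And>A i j. A \<in> M \<Longrightarrow> i < n \<Longrightarrow> j < n \<Longrightarrow>
      cmod (A $$ (i,j) - 1\<^sub>m n $$ (i,j)) \<le> 1 / (2 * (real n)\<^sup>2 + 1)"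
    and A: "A \<in> M"
  shows "A = 1\<^sub>m n"
proof -
  define D where "D A i j = A $$ (i,j) - (1\<^sub>m n $$ (i,j) :: complex)" for A i j
  define nm where "nm A = (\<Sum>i<n. \<Sum>j<n. cmod (D A i j))" for A
  have start: "nm A \<le> 1/2" if "A \<in> M" for A
  proof -
    have "nm A \<le> (\<Sum>i<n. \<Sum>j<n. 1 / (2 * (real n)\<^sup>2 + 1))"
      unfolding nm_def D_def by (intro sum_mono near[OF that]) auto
    also have "\<dots> = (real n)\<^sup>2 / (2 * (real n)\<^sup>2 + 1)" by (simp add: power2_eq_square)
    also have "\<dots> \<le> 1/2" by (simp add: field_simps add_pos_nonneg)
    finally show ?thesis .
  qed
  have nm_nonneg: "nm A \<ge> 0" for A unfolding nm_def by (intro sum_nonneg) auto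
  text \<open>With \<open>D = A - 1\<close> one has \<open>2 D = (A\<^sup>2 - 1) - D\<^sup>2\<close>, so a uniform bound \<open>s \<le> 1/2\<close> improves to \<open>3/4 s\<close>.\<close>
  have step: "nm A \<le> 3/4 * s" if bd: "\<And>A. A \<in> M \<Longrightarrow> nm A \<le> s" and s: "s \<le> 1/2" and A: "A \<in> M" for s A
  proof -
    have Ac: "A \<in> carrier_mat n n" using A M by auto
    have eq: "2 * D A i j = D (A * A) i j - (\<Sum>k<n. D A i k * D A k j)" if ij: "i < n" "j < n" for i j
    proof -
      have "(A * A) $$ (i,j) = (\<Sum>k<n. (D A i k + 1\<^sub>m n $$ (i,k)) * (D A k j + 1\<^sub>m n $$ (k,j)))"
        by (subst mult_mat_index[OF Ac Ac ij]) (simp add: D_def)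
      also have "\<dots> = (\<Sum>k<n. D A i k * D A k j + D A i k * (if k = j then 1 else 0)
          + (if i = k then 1 else 0) * D A k j + (if i = k then 1 else 0) * (if k = j then 1 else 0))"
        using ij by (intro sum.cong refl) (auto simp: algebra_simps)
      also have "\<dots> = (\<Sum>k<n. D A i k * D A k j) + 2 * D A i j + 1\<^sub>m n $$ (i,j)"
        using ij by (simp add: sum.distrib if_distrib[of "\<lambda>x. x * _"] if_distrib[of "\<lambda>x. _ * x"] cong: if_cong)
      finally show ?thesis by (simp add: D_def)
    qed
    have "2 * nm A = (\<Sum>i<n. \<Sum>j<n. cmod (2 * D A i j))"
      unfolding nm_def by (simp add: norm_mult sum_distrib_left)
    also have "\<dots> \<le> (\<Sum>i<n. \<Sum>j<n. cmod (D (A * A) i j) + (\<Sum>k<n. cmod (D A i k) * cmod (D A k j)))"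
    proof (intro sum_mono)
      fix i j assume "i \<in> {..<n}" "j \<in> {..<n}"
      then have "cmod (2 * D A i j) \<le> cmod (D (A * A) i j) + cmod (\<Sum>k<n. D A i k * D A k j)"
        using eq by (simp add: norm_triangle_ineq4)
      also have "cmod (\<Sum>k<n. D A i k * D A k j) \<le> (\<Sum>k<n. cmod (D A i k) * cmod (D A k j))"
        by (rule order_trans[OF norm_sum]) (simp add: norm_mult)
      finally show "cmod (2 * D A i j) \<le> cmod (D (A * A) i j) + (\<Sum>k<n. cmod (D A i k) * cmod (D A k j))" by simp
    qed
    also have "\<dots> = nm (A * A) + (\<Sum>i<n. \<Sum>j<n. \<Sum>k<n. cmod (D A i k) * cmod (D A k j))"
      by (simp add: nm_def sum.distrib)
    also have "(\<Sum>i<n. \<Sum>j<n. \<Sum>k<n. cmod (D A i k) * cmod (D A k j)) =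
        (\<Sum>i<n. \<Sum>k<n. cmod (D A i k) * (\<Sum>j<n. cmod (D A k j)))"
      by (rule sum.cong[OF refl]) (subst sum.swap, simp add: sum_distrib_left)
    also have "\<dots> \<le> (\<Sum>i<n. \<Sum>k<n. cmod (D A i k) * nm A)"
      unfolding nm_def[of A]
      by (intro sum_mono mult_left_mono member_le_sum[of _ "{..<n}" "\<lambda>k. \<Sum>j<n. cmod (D A k j)"])
        (auto intro!: sum_nonneg)
    also have "\<dots> = nm A * nm A" by (simp add: nm_def sum_distrib_right)
    also have "\<dots> \<le> s * (1/2)" using bd[OF A] s nm_nonneg[of A] by (intro mult_mono) auto
    finally show ?thesis using bd[OF sq[OF A]] by simp
  qed
  have "\<forall>A\<in>M. nm A \<le> (3/4)^k * (1/2)" for k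
  proof (induction k)
    case (Suc k)
    have "(3/4)^k * (1/2) \<le> (1/2::real)" by (simp add: power_le_one)
    then show ?case using step[of "(3/4)^k * (1/2)"] Suc by auto
  qed (use start in auto)
  then have bound: "\<exists>N. \<forall>k\<ge>N. nm A \<le> (3/4)^k * (1/2)" using A by blast
  have lim: "(\<lambda>k. (3/4)^k * (1/2::real)) \<longlonglongrightarrow> 0" by (intro tendsto_mult_left_zero LIMSEQ_power_zero) auto
  have "nm A \<le> 0" by (rule LIMSEQ_le_const[OF lim bound])
  then have "nm A = 0" using nm_nonneg[of A] by simp
  then have "D A i j = 0" if "i < n" "j < n" for i j
    using that unfolding nm_def by (auto simp: sum_nonneg_eq_0_iff sum_nonneg)
  then show ?thesis using A M by (intro eq_matI) (auto simp: D_def)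
qed

section \<open>Uniformizer, valuation and residue systems\<close>

locale discrete_valued_field =
  fixes v :: "'k::field \<Rightarrow> real" and \<pi> :: 'k
  assumes nonarch: "nonarch_abs v"
    and pi_pos: "0 < v \<pi>" and pi_less: "v \<pi> < 1"
    and discrete: "\<And>x. x \<noteq> 0 \<Longrightarrow> \<exists>k::int. v x = v \<pi> powi k"
    and finite_residue: "finite ({x. v x \<le> 1} // {(x, y). v x \<le> 1 \<and> v y \<le> 1 \<and> v (x - y) < 1})"
begin

lemma v_nonneg [simp]: "v x \<ge> 0" and v_zero_iff [simp]: "v x = 0 \<longleftrightarrow> x = 0"
  and v_mult: "v (x * y) = v x * v y" and v_add: "v (x + y) \<le> max (v x) (v y)"
  using nonarch unfolding nonarch_abs_def by auto

lemma v_zero [simp]: "v 0 = 0" by simp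

lemma v_one [simp]: "v 1 = 1"
proof -
  have "v 1 * v 1 = v 1" using v_mult[of 1 1] by simp
  then show ?thesis by simp
qed

lemma v_minus [simp]: "v (- x) = v x"
proof -
  have "v (-1) * v (-1) = 1" using v_mult[of "-1" "-1"] by simp
  then have "(v (-1) - 1) * (v (-1) + 1) = 0" by (simp add: algebra_simps)
  then have "v (-1) = 1" using v_nonneg[of "-1"] by (simp add: add_nonneg_eq_0_iff)
  then show ?thesis using v_mult[of "-1" x] by simp
qed

lemma v_diff: "v (x - y) \<le> max (v x) (v y)"
  using v_add[of x "- y"] by simp

lemma v_minus_commute: "v (x - y) = v (y - x)"
  using v_minus[of "x - y"] by simp

lemma v_pos_iff: "0 < v x \<longleftrightarrow> x \<noteq> 0"
  using v_nonneg[of x] v_zero_iff[of x] by linarith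

lemma v_inverse: "v (inverse x) = inverse (v x)"
proof (cases "x = 0")
  case False
  then have "v x * v (inverse x) = 1" using v_mult[of x "inverse x"] by simp
  then show ?thesis using inverse_unique[of "v x" "v (inverse x)"] by simp
qed simp

lemma v_divide: "v (x / y) = v x / v y"
  by (simp add: divide_inverse v_mult v_inverse)

lemma v_power: "v (x ^ n) = v x ^ n"
  by (induction n) (auto simp: v_mult)

lemma v_of_nat_le: "v (of_nat n) \<le> 1"
proof (induction n)
  case (Suc n)
  then show ?case using v_add[of 1 "of_nat n"] by simp
qed simp

lemma v_numeral_le: "v (numeral n) \<le> 1"
  using v_of_nat_le[of "numeral n"] by simp

lemma pi_nonzero [simp]: "\<pi> \<noteq> 0" using pi_pos by auto

text \<open>The isosceles triangle principle of ultrametrics.\<close>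

lemma v_eq_of_less: "v (x - y) < v y \<Longrightarrow> v x = v y"
  using v_add[of "x - y" y] v_diff[of x "x - y"] by (auto simp: max_def split: if_splits)

text \<open>Values are integral powers of \<open>v \<pi>\<close>, so a strict inequality gains a
  full power.\<close>

lemma v_less_power: "v x < v \<pi> ^ k \<Longrightarrow> v x \<le> v \<pi> ^ Suc k"
proof (cases "x = 0")
  case False
  assume less: "v x < v \<pi> ^ k"
  from discrete[OF False] obtain m :: int where m: "v x = v \<pi> powi m" by blast
  have "m > int k"
  proof (rule ccontr)
    assume "\<not> m > int k"
    then have "v \<pi> powi (int k) \<le> v \<pi> powi m" using pi_pos pi_less by (intro power_int_decreasing) auto
    then show False using less m by simp
  qed
  then have "v \<pi> powi m \<le> v \<pi> powi (int (Suc k))" using pi_pos pi_less by (intro power_int_decreasing) auto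
  then show ?thesis using m by (simp only: power_int_of_nat)
qed (use pi_pos in simp)

lemma ex_power_le: "C > 0 \<Longrightarrow> \<exists>n. v \<pi> ^ n \<le> C"
  using real_arch_pow_inv[of C "v \<pi>"] pi_less by (auto intro: less_imp_le)

lemma residue_representatives:
  obtains R where "finite R" "card R \<ge> 2" "\<And>r. r \<in> R \<Longrightarrow> v r \<le> 1"
    "\<And>x. v x \<le> 1 \<Longrightarrow> \<exists>r\<in>R. v (x - r) < 1"
    "\<And>r s. r \<in> R \<Longrightarrow> s \<in> R \<Longrightarrow> v (r - s) < 1 \<Longrightarrow> r = s"
proof -
  define E where "E = {(x, y). v x \<le> 1 \<and> v y \<le> 1 \<and> v (x - y) < 1}"
  define Q where "Q = {x. v x \<le> 1} // E"
  have finQ: "finite Q" using finite_residue unfolding Q_def E_def .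
  have eqE: "equiv {x. v x \<le> 1} E"
  proof (rule equivI)
    show "sym E" unfolding E_def by (auto intro!: symI simp: v_minus_commute)
    show "trans E"
    proof (rule transI)
      fix x y z assume "(x, y) \<in> E" "(y, z) \<in> E"
      then show "(x, z) \<in> E" using v_add[of "x - y" "y - z"] by (auto simp: E_def)
    qed
  qed (auto simp: refl_on_def E_def)
  define R where "R = (\<lambda>c. SOME x. x \<in> c) ` Q"
  have some: "(SOME x. x \<in> c) \<in> c" if "c \<in> Q" for c
    using in_quotient_imp_non_empty[OF eqE that[unfolded Q_def]] by (auto intro: someI)
  have sub: "c \<subseteq> {x. v x \<le> 1}" if "c \<in> Q" for c
    using in_quotient_imp_subset[OF eqE that[unfolded Q_def]] .
  have Rin: "v r \<le> 1" if "r \<in> R" for r using that some sub by (auto simp: R_def)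
  have Rex: "\<exists>r\<in>R. v (x - r) < 1" if x: "v x \<le> 1" for x
  proof -
    have c: "E `` {x} \<in> Q" using x unfolding Q_def by (intro quotientI) auto
    then have "(SOME y. y \<in> E `` {x}) \<in> E `` {x}" by (rule some)
    then have "v (x - (SOME y. y \<in> E `` {x})) < 1" by (auto simp: E_def)
    then show ?thesis using c unfolding R_def by blast
  qed
  have Rinj: "r = s" if rs: "r \<in> R" "s \<in> R" "v (r - s) < 1" for r s
  proof -
    from rs obtain c d where c: "c \<in> Q" "r = (SOME x. x \<in> c)" and d: "d \<in> Q" "s = (SOME x. x \<in> d)"
      by (auto simp: R_def)
    have "r \<in> c" "s \<in> d" using c d some by auto
    moreover have "(r, s) \<in> E" using rs Rin by (auto simp: E_def)
    ultimately have "c = d"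
      using quotient_eqI[OF eqE c(1)[unfolded Q_def] d(1)[unfolded Q_def]] by blast
    then show ?thesis using c d by simp
  qed
  have finR: "finite R" using finQ by (simp add: R_def)
  \<comment> \<open>0 and 1 are incongruent, so there are at least two residue classes.\<close>
  obtain r0 r1 where r: "r0 \<in> R" "v (0 - r0) < 1" "r1 \<in> R" "v (1 - r1) < 1" using Rex[of 0] Rex[of 1] by auto
  have "r0 \<noteq> r1"
  proof
    assume "r0 = r1"
    then have "v ((1 - r0) + r0) < 1" using r v_add[of "1 - r0" r0] by (auto simp: max_def split: if_splits)
    then show False by simp
  qed
  then have "card {r0, r1} = 2" by simp
  then have "card R \<ge> 2" using card_mono[OF finR, of "{r0, r1}"] r by auto
  then show ?thesis using that[of R] finR Rin Rex Rinj by blast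
qed

text \<open>The number of elements of the residue field: the case \<open>m = 1\<close> determines
  it. The specification hides the representatives and retains the counts at all levels at
  once.\<close>

definition q :: nat where
  "q = (SOME n. n \<ge> 2 \<and> (\<forall>m. \<exists>S. finite S \<and> card S = n ^ m \<and> (\<forall>s\<in>S. v s \<le> 1) \<and>
     (\<forall>x. v x \<le> 1 \<longrightarrow> (\<exists>s\<in>S. v (x - s) \<le> v \<pi> ^ m)) \<and>
     (\<forall>s\<in>S. \<forall>t\<in>S. v (s - t) \<le> v \<pi> ^ m \<longrightarrow> s = t)))"

lemma q_ge: "q \<ge> 2"
  and residue_system: "\<exists>S. finite S \<and> card S = q ^ m \<and> (\<forall>s\<in>S. v s \<le> 1) \<and>
     (\<forall>x. v x \<le> 1 \<longrightarrow> (\<exists>s\<in>S. v (x - s) \<le> v \<pi> ^ m)) \<and>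
     (\<forall>s\<in>S. \<forall>t\<in>S. v (s - t) \<le> v \<pi> ^ m \<longrightarrow> s = t)"
proof -
  obtain R where R: "finite R" "card R \<ge> 2" "\<And>r. r \<in> R \<Longrightarrow> v r \<le> 1"
    "\<And>x. v x \<le> 1 \<Longrightarrow> \<exists>r\<in>R. v (x - r) < 1"
    "\<And>r s. r \<in> R \<Longrightarrow> s \<in> R \<Longrightarrow> v (r - s) < 1 \<Longrightarrow> r = s" by (rule residue_representatives) (rule that)
  have "\<exists>S. finite S \<and> card S = card R ^ m \<and> (\<forall>s\<in>S. v s \<le> 1) \<and>
     (\<forall>x. v x \<le> 1 \<longrightarrow> (\<exists>s\<in>S. v (x - s) \<le> v \<pi> ^ m)) \<and>
     (\<forall>s\<in>S. \<forall>t\<in>S. v (s - t) \<le> v \<pi> ^ m \<longrightarrow> s = t)" for m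
  proof (induction m)
    case 0
    show ?case by (intro exI[of _ "{0}"]) auto
  next
    case (Suc m)
    then obtain S where S: "finite S" "card S = card R ^ m" "\<And>s. s \<in> S \<Longrightarrow> v s \<le> 1"
      "\<And>x. v x \<le> 1 \<Longrightarrow> \<exists>s\<in>S. v (x - s) \<le> v \<pi> ^ m"
      "\<And>s t. s \<in> S \<Longrightarrow> t \<in> S \<Longrightarrow> v (s - t) \<le> v \<pi> ^ m \<Longrightarrow> s = t" by blast
    \<comment> \<open>Appends one digit: a representative modulo \<open>\<pi> ^ m\<close> plus
      \<open>\<pi> ^ m\<close> times a representative of the residue field.\<close>
    define f where "f = (\<lambda>(s,r). s + \<pi> ^ m * r)"
    have pm: "v \<pi> ^ m \<le> 1" "v \<pi> ^ Suc m \<le> v \<pi> ^ m" "0 < v \<pi> ^ m"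
      using pi_pos pi_less by (auto intro: power_le_one mult_left_le_one_le)
    have le: "v (\<pi> ^ m * x) \<le> v \<pi> ^ m" if "v x \<le> 1" for x
      using that pm by (simp add: v_mult v_power mult_left_le)
    have sep: "a = b" if ab: "a \<in> S \<times> R" "b \<in> S \<times> R" "v (f a - f b) \<le> v \<pi> ^ Suc m" for a b
    proof -
      obtain s r t u where [simp]: "a = (s,r)" "b = (t,u)" by (cases a, cases b)
      have in': "s \<in> S" "t \<in> S" "r \<in> R" "u \<in> R" using ab by auto
      have d: "v ((s - t) + \<pi>^m * (r - u)) \<le> v \<pi> ^ Suc m" using ab(3) by (simp add: f_def algebra_simps)
      have "v (r - u) \<le> 1" using v_diff[of r u] R(3) in' by (meson max.boundedI order_trans)
      then have "v (\<pi>^m * (r - u)) \<le> v \<pi> ^ m" by (rule le)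
      then have "v (s - t) \<le> v \<pi> ^ m"
        using v_diff[of "(s - t) + \<pi>^m * (r - u)" "\<pi>^m * (r - u)"] d pm(2) by simp
      then have st: "s = t" using S(5) in' by blast
      then have "v \<pi> ^ m * v (r - u) \<le> v \<pi> ^ m * v \<pi>" using d by (simp add: v_mult v_power mult.commute)
      then have "v (r - u) \<le> v \<pi>" using pm(3) mult_le_cancel_left_pos by blast
      then have "r = u" using R(5) in' pi_less by fastforce
      then show ?thesis using st by simp
    qed
    have "inj_on f (S \<times> R)"
    proof (rule inj_onI)
      fix a b assume "a \<in> S \<times> R" "b \<in> S \<times> R" "f a = f b"
      then show "a = b" using sep[of a b] pi_pos by simp
    qed
    then have c: "card (f ` (S \<times> R)) = card R ^ Suc m" by (simp add: card_image card_cartesian_product S(2))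
    have b: "v y \<le> 1" if y: "y \<in> f ` (S \<times> R)" for y
    proof -
      from y obtain s r where sr: "s \<in> S" "r \<in> R" "y = s + \<pi>^m * r" by (auto simp: f_def)
      have "v (\<pi>^m * r) \<le> 1" using le[OF R(3)[OF sr(2)]] pm(1) by linarith
      then show ?thesis using sr v_add[of s "\<pi>^m * r"] S(3)[OF sr(1)] by simp
    qed
    have cov: "\<exists>y\<in>f ` (S \<times> R). v (x - y) \<le> v \<pi> ^ Suc m" if x: "v x \<le> 1" for x
    proof -
      obtain s where s: "s \<in> S" "v (x - s) \<le> v \<pi> ^ m" using S(4)[OF x] by blast
      have "v ((x - s) / \<pi>^m) \<le> 1" using s pm by (simp add: v_divide v_power)
      then obtain r where r: "r \<in> R" "v ((x - s) / \<pi>^m - r) < 1" using R(4) by blast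
      have "v ((x - s) / \<pi>^m - r) \<le> v \<pi>" using v_less_power[of "(x - s) / \<pi>^m - r" 0] r by simp
      then have "v (\<pi>^m * ((x - s) / \<pi>^m - r)) \<le> v \<pi> ^ m * v \<pi>"
        using pm(3) by (simp add: v_mult v_power)
      moreover have "\<pi>^m * ((x - s) / \<pi>^m - r) = x - f (s,r)" by (simp add: f_def field_simps)
      ultimately show ?thesis using s r by (intro bexI[of _ "f (s,r)"]) (auto simp: mult.commute)
    qed
    show ?case
      using c b cov sep S(1) R(1) by (intro exI[of _ "f ` (S \<times> R)"]) blast
  qed
  then have "\<exists>n\<ge>2. \<forall>m. \<exists>S. finite S \<and> card S = n ^ m \<and> (\<forall>s\<in>S. v s \<le> 1) \<and>
     (\<forall>x. v x \<le> 1 \<longrightarrow> (\<exists>s\<in>S. v (x - s) \<le> v \<pi> ^ m)) \<and>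
     (\<forall>s\<in>S. \<forall>t\<in>S. v (s - t) \<le> v \<pi> ^ m \<longrightarrow> s = t)" using R(2) by blast
  from someI_ex[OF this] show "q \<ge> 2" "\<exists>S. finite S \<and> card S = q ^ m \<and> (\<forall>s\<in>S. v s \<le> 1) \<and>
     (\<forall>x. v x \<le> 1 \<longrightarrow> (\<exists>s\<in>S. v (x - s) \<le> v \<pi> ^ m)) \<and>
     (\<forall>s\<in>S. \<forall>t\<in>S. v (s - t) \<le> v \<pi> ^ m \<longrightarrow> s = t)" unfolding q_def[symmetric] by blast+
qed

end

section \<open>Quaternion bases of central simple algebras of degree two\<close>

lemma ex1_unique: "\<exists>!x. P x \<Longrightarrow> P x \<Longrightarrow> P y \<Longrightarrow> x = y"
  by blast

locale quartic_algebra =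
  fixes emb :: "'k::field \<Rightarrow> 'd::ring_1"
  assumes alg: "K_algebra emb" and ex_basis: "\<exists>e. K_basis4 emb e"
begin

lemma emb_add: "emb (a + b) = emb a + emb b" and emb_mult: "emb (a * b) = emb a * emb b"
  and emb_one [simp]: "emb 1 = 1" and emb_comm: "x * emb a = emb a * x" and inj_emb: "inj emb"
  using alg unfolding K_algebra_def by (blast, blast, blast, metis, blast)

lemma emb_zero [simp]: "emb 0 = 0"
  using emb_add[of 0 0] by simp

lemma emb_minus: "emb (- a) = - emb a"
  using emb_add[of a "-a"] by (simp add: eq_neg_iff_add_eq_0 add.commute)

lemma emb_diff: "emb (a - b) = emb a - emb b"
  using emb_add[of a "-b"] by (simp add: emb_minus)

lemma emb_sum: "emb (\<Sum>i\<in>I. f i) = (\<Sum>i\<in>I. emb (f i))"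
  by (induction I rule: infinite_finite_induct) (auto simp: emb_add)

lemma emb_eq_iff [simp]: "emb a = emb b \<longleftrightarrow> a = b"
  using inj_emb by (auto simp: inj_def)

lemma emb_eq_0_iff [simp]: "emb a = 0 \<longleftrightarrow> a = 0"
  using emb_eq_iff[of a 0] by simp

lemma emb_comm_left: "x * (emb a * y) = emb a * (x * y)"
  by (metis emb_comm mult.assoc)

lemma emb_cancel:
  assumes "c \<noteq> 0" "emb c * x = 0" shows "x = 0"
proof -
  have "emb (inverse c) * (emb c * x) = x" using assms(1) by (simp flip: mult.assoc emb_mult)
  then show ?thesis using assms(2) by simp
qed

lemma basis_exists:
  obtains e where "K_basis4 emb e"
    "\<And>x. \<exists>c. x = (\<Sum>l<4. emb (c l) * e l)"
    "\<And>c. (\<Sum>l<4. emb (c l) * e l) = 0 \<Longrightarrow> \<forall>l<4. c l = 0"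
proof -
  obtain e where e: "K_basis4 emb e" using ex_basis by blast
  have 1: "\<exists>c. x = (\<Sum>l<4. emb (c l) * e l)" for x
    using e unfolding K_basis4_def by blast
  have 2: "\<forall>l<4. c l = 0" if "(\<Sum>l<4. emb (c l) * e l) = 0" for c
  proof -
    have u: "\<exists>!c. (\<forall>i\<ge>4. c i = 0) \<and> 0 = (\<Sum>i<4. emb (c i) * e i)"
      using e unfolding K_basis4_def by blast
    define c' where "c' i = (if i < 4 then c i else 0)" for i
    have s: "(\<Sum>i<4. emb (c' i) * e i) = (\<Sum>i<4. emb (c i) * e i)"
      by (intro sum.cong) (auto simp: c'_def)
    have "(\<forall>i\<ge>4. c' i = 0) \<and> 0 = (\<Sum>i<4. emb (c' i) * e i)" using s that by (simp add: c'_def)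
    then have "c' = (\<lambda>_. 0)" by (rule ex1_unique[OF u]) simp
    then show ?thesis unfolding c'_def by meson
  qed
  show ?thesis using that[OF e 1 2] .
qed

lemma five_dependent:
  assumes I: "finite I" "card I > 4"
  shows "\<exists>c. (\<exists>i\<in>I. c i \<noteq> 0) \<and> (\<Sum>i\<in>I. emb (c i) * z i) = 0"
proof -
  obtain e :: "nat \<Rightarrow> 'd" where e: "\<And>x. \<exists>c. x = (\<Sum>l<4. emb (c l) * e l)" using basis_exists by metis
  then have "\<forall>i. \<exists>c. z i = (\<Sum>l<4. emb (c l) * e l)" by blast
  from choice[OF this] obtain a where a: "\<And>i. z i = (\<Sum>l<4. emb (a i l) * e l)" by blast
  have "card {..<4::nat} < card I" using I by simp
  from homogeneous_system[OF _ I(1) this, of a] obtain c where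
    c: "\<exists>i\<in>I. c i \<noteq> 0" "\<And>l. l < 4 \<Longrightarrow> (\<Sum>i\<in>I. c i * a i l) = 0" by auto
  have "(\<Sum>i\<in>I. emb (c i) * z i) = (\<Sum>i\<in>I. \<Sum>l<4. emb (c i * a i l) * e l)"
    by (simp only: a sum_distrib_left emb_mult mult.assoc)
  also have "\<dots> = (\<Sum>l<4. emb (\<Sum>i\<in>I. c i * a i l) * e l)"
    by (subst sum.swap) (simp add: emb_sum sum_distrib_right)
  also have "\<dots> = 0" using c(2) by (intro sum.neutral) auto
  finally show ?thesis using c(1) by blast
qed

lemma five_dependent':
  obtains c0 c1 c2 c3 c4 where
    "emb c0 * z0 + emb c1 * z1 + emb c2 * z2 + emb c3 * z3 + emb c4 * z4 = 0"
    "c0 \<noteq> 0 \<or> c1 \<noteq> 0 \<or> c2 \<noteq> 0 \<or> c3 \<noteq> 0 \<or> c4 \<noteq> 0"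
proof -
  have s: "{..<5::nat} = {0,1,2,3,4}" by auto
  from five_dependent[of "{..<5::nat}" "\<lambda>i. [z0,z1,z2,z3,z4] ! i"] obtain c where
    "\<exists>i<5. c i \<noteq> 0" "(\<Sum>i<5. emb (c i) * [z0,z1,z2,z3,z4] ! i) = 0" by auto
  then obtain i where i: "i \<in> {0,1,2,3,4}" "c i \<noteq> 0"
    and sum: "(\<Sum>i\<in>{0,1,2,3,4}. emb (c i) * [z0,z1,z2,z3,z4] ! i) = 0" unfolding s[symmetric] by blast
  have "emb (c 0) * z0 + emb (c 1) * z1 + emb (c 2) * z2 + emb (c 3) * z3 + emb (c 4) * z4 = 0"
    using sum by (simp add: add.assoc)
  moreover have "c 0 \<noteq> 0 \<or> c 1 \<noteq> 0 \<or> c 2 \<noteq> 0 \<or> c 3 \<noteq> 0 \<or> c 4 \<noteq> 0"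
    using i by auto
  ultimately show ?thesis using that by blast
qed

lemma ex_not_scalar: "\<exists>x. x \<notin> range emb"
proof (rule ccontr)
  assume "\<not> ?thesis"
  then have all: "\<exists>c. x = emb c" for x by blast
  obtain e :: "nat \<Rightarrow> 'd" where e: "\<And>c. (\<Sum>l<4. emb (c l) * e l) = 0 \<Longrightarrow> \<forall>l<4. c l = 0" using basis_exists by metis
  obtain k0 k1 where k: "e 0 = emb k0" "e 1 = emb k1" using all by metis
  have s: "{..<4::nat} = {0,1,2,3}" by auto
  have "(\<Sum>l<4. emb ([k1,-k0,0,0] ! l) * e l) = 0"
    unfolding s by (simp add: k k(2)[unfolded One_nat_def] emb_minus mult.commute flip: emb_mult)
  from e[OF this] have "k0 = 0" by (auto dest!: spec[of _ "1::nat"])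
  then have "(\<Sum>l<4. emb ([1,0,0,0] ! l) * e l) = 0" unfolding s by (simp add: k)
  from e[OF this] show False by (auto dest!: spec[of _ "0::nat"])
qed

text \<open>The elements \<open>x * e l\<close> and 1 are five in a space of dimension four, and
  injectivity of left multiplication forces the coefficient of 1 in a relation to be nonzero. The
  right inverse is also a left inverse because \<open>x\<close> can be cancelled.\<close>

lemma right_inverse:
  fixes x :: 'd
  assumes x: "\<And>y. x * y = 0 \<Longrightarrow> y = 0"
  shows "\<exists>u. x * u = 1 \<and> u * x = 1"
proof -
  obtain e :: "nat \<Rightarrow> 'd" where e: "\<And>c. (\<Sum>l<4. emb (c l) * e l) = 0 \<Longrightarrow> \<forall>l<4. c l = 0" using basis_exists by metis
  obtain c0 c1 c2 c3 c4 where
    c: "emb c0 * (x * e 0) + emb c1 * (x * e 1) + emb c2 * (x * e 2) + emb c3 * (x * e 3) + emb c4 * 1 = 0"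
    "c0 \<noteq> 0 \<or> c1 \<noteq> 0 \<or> c2 \<noteq> 0 \<or> c3 \<noteq> 0 \<or> c4 \<noteq> 0" by (rule five_dependent')
  define z where "z = emb c0 * e 0 + emb c1 * e 1 + emb c2 * e 2 + emb c3 * e 3"
  have xz: "x * z + emb c4 = 0" using c(1) by (simp add: z_def distrib_left emb_comm_left[of x])
  have s: "{..<4::nat} = {0,1,2,3}" by auto
  have c4: "c4 \<noteq> 0"
  proof
    assume "c4 = 0"
    then have "z = 0" using x xz by simp
    then have "(\<Sum>l<4. emb ([c0,c1,c2,c3] ! l) * e l) = 0" unfolding s by (simp add: z_def add.assoc)
    from e[OF this] have "\<forall>l<4. [c0,c1,c2,c3] ! l = 0" .
    then have "c0 = 0 \<and> c1 = 0 \<and> c2 = 0 \<and> c3 = 0"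
      by (auto dest: spec[of _ "0::nat"] spec[of _ "1::nat"] spec[of _ "2::nat"] spec[of _ "3::nat"])
    then show False using c(2) \<open>c4 = 0\<close> by simp
  qed
  define u where "u = emb (- inverse c4) * z"
  have "x * u = emb (- inverse c4) * (x * z)" by (simp add: u_def emb_comm_left[of x])
  also have "x * z = emb (- c4)" using xz by (simp add: emb_minus eq_neg_iff_add_eq_0)
  finally have xu: "x * u = 1" using c4 by (simp flip: emb_mult)
  have "x * (u * x - 1) = 0" using xu by (simp add: right_diff_distrib flip: mult.assoc)
  then have "u * x = 1" using x by fastforce
  then show ?thesis using xu by blast
qed

end

locale central_simple_quartic =
  fixes emb :: "'k::field \<Rightarrow> 'd::ring_1"
  assumes cs: "central_simple_deg2 emb" and two: "(2::'k) \<noteq> 0"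
begin

sublocale quartic_algebra emb
  using cs unfolding central_simple_deg2_def by unfold_locales auto

lemma centerD: "(\<And>x. z * x = x * z) \<Longrightarrow> z \<in> range emb"
  using cs unfolding central_simple_deg2_def by blast

lemma simpleD: "two_sided_ideal (I :: 'd set) \<Longrightarrow> I = {0} \<or> I = UNIV"
  using cs unfolding central_simple_deg2_def by blast

text \<open>If \<open>x\<close> and \<open>y\<close> do not commute, a linear relation between \<open>1, x, x\<^sup>2, y, x y\<close> cannot involve \<open>y\<close>,
  so \<open>x\<close> is quadratic over the center.\<close>
lemma quaternion_generators_division:
  assumes nzd: "\<And>x y::'d. x * y = 0 \<Longrightarrow> x = 0 \<or> y = 0"
  shows "\<exists>i j a b. a \<noteq> 0 \<and> b \<noteq> 0 \<and> i * i = emb a \<and> j * j = emb b \<and> i * j = - (j * i)"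
proof -
  have noncentral: "\<exists>y. x * y \<noteq> y * x" if "x \<notin> range emb" for x using centerD that by blast
  have quadratic: "\<exists>t n. x * x = emb t * x + emb n" if x: "x \<notin> range emb" for x
  proof -
    obtain y where y: "x * y \<noteq> y * x" using noncentral[OF x] by blast
    obtain c0 c1 c2 c3 c4 where
      c: "emb c0 * 1 + emb c1 * x + emb c2 * (x * x) + emb c3 * y + emb c4 * (x * y) = 0"
      "c0 \<noteq> 0 \<or> c1 \<noteq> 0 \<or> c2 \<noteq> 0 \<or> c3 \<noteq> 0 \<or> c4 \<noteq> 0" by (rule five_dependent')
    have lin: "d1 = 0" if "emb d0 + emb d1 * x = 0" for d0 d1
    proof (rule ccontr)
      assume "d1 \<noteq> 0"
      have "emb (- inverse d1) * (emb d0 + emb d1 * x) = emb (- d0 / d1) - x"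
        using \<open>d1 \<noteq> 0\<close> by (simp add: distrib_left emb_minus divide_inverse mult.commute flip: mult.assoc emb_mult)
      then have "x = emb (- d0 / d1)" using that by simp
      then show False using x by blast
    qed
    \<comment> \<open>The relation reads \<open>r * y = - p\<close> with \<open>r\<close> and
      \<open>p\<close> polynomials in \<open>x\<close>; an invertible \<open>r\<close> would make
      \<open>y\<close> commute with \<open>x\<close>.\<close>
    define r where "r = emb c3 + emb c4 * x"
    define p where "p = emb c0 + emb c1 * x + emb c2 * (x * x)"
    have rel: "p + r * y = 0" using c(1) by (simp add: p_def r_def distrib_right mult.assoc add.assoc)
    have px: "p * x = x * p" and rx: "r * x = x * r"
      by (simp_all add: p_def r_def distrib_left distrib_right emb_comm[of x] emb_comm_left[of x] mult.assoc)
    have "r = 0"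
    proof (rule ccontr)
      assume "r \<noteq> 0"
      then obtain u where u: "r * u = 1" "u * r = 1" using right_inverse[of r] nzd by blast
      have ux: "u * x = x * u" by (metis mult.assoc mult_1 mult.right_neutral u rx)
      have "y = - (u * p)"
      proof -
        have "u * (p + r * y) = u * p + y" by (simp add: distrib_left u(2) flip: mult.assoc)
        then show ?thesis using rel by (simp add: eq_neg_iff_add_eq_0 add.commute)
      qed
      then have "x * y = y * x" by (metis mult.assoc mult_minus_left mult_minus_right px ux)
      then show False using y by simp
    qed
    then have "c4 = 0" "c3 = 0" using lin[of c3 c4] by (auto simp: r_def)
    moreover have p0: "p = 0" using rel \<open>r = 0\<close> by simp
    moreover have "c2 \<noteq> 0"
    proof
      assume "c2 = 0"
      then have "c1 = 0" using lin[of c0 c1] p0 by (simp add: p_def)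
      then show False using p0 c(2) \<open>c2 = 0\<close> \<open>c4 = 0\<close> \<open>c3 = 0\<close> by (simp add: p_def)
    qed
    have "x * x = emb (- c1 / c2) * x + emb (- c0 / c2)"
    proof -
      have "emb (inverse c2) * p = emb (c0 / c2) + emb (c1 / c2) * x + x * x"
        using \<open>c2 \<noteq> 0\<close> by (simp add: p_def distrib_left divide_inverse mult.commute flip: mult.assoc emb_mult)
      then have "emb (c0 / c2) + emb (c1 / c2) * x + x * x = 0" using p0 by simp
      then show ?thesis by (simp add: emb_minus algebra_simps eq_neg_iff_add_eq_0)
    qed
    then show ?thesis by blast
  qed
  obtain x where x: "x \<notin> range emb" using ex_not_scalar by blast
  obtain t n where tn: "x * x = emb t * x + emb n" using quadratic[OF x] by blast
  \<comment> \<open>Completing the square, which divides by 2, removes the linear term.\<close>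
  define i where "i = x - emb (t / 2)"
  define a where "a = n + t * t / 4"
  have ii: "i * i = emb a"
  proof -
    define h where "h = emb (t / 2)"
    have xh: "x * h = h * x" unfolding h_def by (rule emb_comm)
    have hh: "h + h = emb t" "h * h = emb (t/2 * (t/2))"
      using two by (simp_all add: h_def field_simps flip: emb_add emb_mult)
    have "i * i = x * x - (h * x + h * x) + h * h"
      unfolding i_def h_def[symmetric] by (simp add: left_diff_distrib right_diff_distrib xh)
    also have "\<dots> = x * x - emb t * x + emb (t/2 * (t/2))" by (simp only: hh distrib_right[symmetric])
    also have "x * x - emb t * x + emb (t/2 * (t/2)) = emb (n + t/2 * (t/2))" by (simp add: tn emb_add)
    also have "n + t/2 * (t/2) = a"
    proof -
      have "(4::'k) = 2 * 2" by simp
      then show ?thesis using two unfolding a_def by (simp add: field_simps)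
    qed
    finally show ?thesis .
  qed
  have i: "i \<notin> range emb"
  proof
    assume "i \<in> range emb"
    then obtain c where "i = emb c" by blast
    then have "x = emb (c + t/2)" by (simp add: i_def emb_add algebra_simps)
    then show False using x by blast
  qed
  have a: "a \<noteq> 0"
  proof
    assume "a = 0"
    then have "i = 0" using ii nzd[of i i] by auto
    then show False using i emb_zero by (metis rangeI)
  qed
  obtain y where y: "i * y \<noteq> y * i" using noncentral[OF i] by blast
  \<comment> \<open>A commutator with \<open>i\<close> anticommutes with \<open>i\<close>, because
    \<open>i * i\<close> is central.\<close>
  define j where "j = i * y - y * i"
  have j0: "j \<noteq> 0" using y by (simp add: j_def)
  have ij: "i * j = - (j * i)"
  proof -
    have "i * j = emb a * y - i * y * i" by (simp add: j_def right_diff_distrib ii flip: mult.assoc)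
    moreover have "j * i = i * y * i - emb a * y" by (simp add: j_def left_diff_distrib mult.assoc ii emb_comm[of y])
    ultimately show ?thesis by simp
  qed
  have two': "z = 0" if "z + z = 0" for z :: 'd
  proof -
    have "emb 2 * z = z + z" using emb_add[of 1 1] by (simp add: mult_2)
    then show ?thesis using emb_cancel[OF two] that by simp
  qed
  have i0: "i \<noteq> 0" using ii a by auto
  have "j \<notin> range emb"
  proof
    assume "j \<in> range emb"
    then have "i * j = j * i" using emb_comm by auto
    then have "j * i + j * i = 0" using ij right_minus[of "j * i"] by simp
    then show False using two' nzd j0 i0 by blast
  qed
  from quadratic[OF this] obtain s b where sb: "j * j = emb s * j + emb b" by blast
  \<comment> \<open>Since \<open>i\<close> commutes with \<open>j * j\<close> but anticommutes with
    \<open>j\<close>, the linear term in the quadratic equation of \<open>j\<close> must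
    vanish.\<close>
  have "i * (j * j) = (j * j) * i"
  proof -
    have "i * (j * j) = (i * j) * j" by (simp add: mult.assoc)
    also have "\<dots> = j * j * i" unfolding ij by (simp add: mult.assoc ij)
    finally show ?thesis .
  qed
  then have "emb s * (i * j) + emb b * i = emb s * (j * i) + emb b * i"
    unfolding sb by (simp add: distrib_left distrib_right emb_comm[of i] emb_comm_left[of i] mult.assoc)
  then have "emb s * (j * i) + emb s * (j * i) = 0"
    using ij right_minus[of "emb s * (j * i)"] by simp
  then have "emb s * (j * i) = 0" by (rule two')
  then have "s = 0" using nzd[of j i] j0 i0 emb_cancel[of s "j * i"] by blast
  then have jj: "j * j = emb b" using sb by simp
  then have "b \<noteq> 0" using nzd[of j j] j0 by auto
  then show ?thesis using a ii jj ij by blast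
qed

text \<open>The algebra acts faithfully on the left ideal \<open>{z. z * y0 = 0}\<close>, which therefore has dimension
  exactly two, and every endomorphism of it is realised.\<close>
lemma quaternion_generators_split:
  fixes x0 y0 :: 'd
  assumes zd: "x0 * y0 = 0" "x0 \<noteq> 0" "y0 \<noteq> 0"
  shows "\<exists>i j a b. a \<noteq> 0 \<and> b \<noteq> 0 \<and> i * i = emb a \<and> j * j = emb b \<and> i * j = - (j * i)"
proof -
  obtain e :: "nat \<Rightarrow> 'd" where e: "\<And>x. \<exists>c. x = (\<Sum>l<4. emb (c l) * e l)"
    "\<And>c. (\<Sum>l<4. emb (c l) * e l) = 0 \<Longrightarrow> \<forall>l<4. c l = 0" using basis_exists by metis
  \<comment> \<open>The annihilator of a left ideal is a two-sided ideal, so simplicity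
    applies.\<close>
  have faithful: "x = 0"
    if I: "\<And>a z. z \<in> I \<Longrightarrow> a * z \<in> I" "z0 \<in> I" "z0 \<noteq> 0" and x: "\<And>z. z \<in> I \<Longrightarrow> x * z = 0" for I :: "'d set" and z0 x
  proof -
    have "two_sided_ideal {x. \<forall>z\<in>I. x * z = 0}"
      unfolding two_sided_ideal_def by (auto simp: distrib_right mult.assoc I(1))
    from simpleD[OF this] show ?thesis
    proof
      assume "{x. \<forall>z\<in>I. x * z = 0} = UNIV"
      then have "1 * z0 = 0" using I(2) by blast
      then show ?thesis using I(3) by simp
    qed (use x in blast)
  qed
  \<comment> \<open>On a one-dimensional left ideal the basis elements would act by scalars
    \<open>k l\<close>, and some nonzero combination of them would act as zero.\<close>
  have not_one_dim: False
    if I: "\<And>a z. z \<in> I \<Longrightarrow> a * z \<in> I" "u \<in> I" "u \<noteq> 0" and sp: "\<And>z. z \<in> I \<Longrightarrow> \<exists>c. z = emb c * u" for I :: "'d set" and u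
  proof -
    have "\<forall>l. \<exists>c. e l * u = emb c * u" using I sp by blast
    then obtain k where k: "\<And>l. e l * u = emb (k l) * u" by metis
    have "card {0::nat} < card {..<4::nat}" by simp
    from homogeneous_system[OF _ _ this, of "\<lambda>l _. k l"] obtain c where
      c: "\<exists>l<4. c l \<noteq> 0" "(\<Sum>l<4. c l * k l) = 0" by auto
    define x where "x = (\<Sum>l<4. emb (c l) * e l)"
    have "x * u = (\<Sum>l<4. emb (c l * k l) * u)"
      by (simp add: x_def sum_distrib_right mult.assoc k emb_mult)
    also have "\<dots> = emb (\<Sum>l<4. c l * k l) * u" by (simp add: emb_sum sum_distrib_right)
    finally have "x * u = 0" using c(2) by simp
    then have "x * z = 0" if "z \<in> I" for z using sp[OF that] by (auto simp: emb_comm_left[of x])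
    then have "x = 0" using faithful[of I u x, OF I] by blast
    then have "\<forall>l<4. c l = 0" using e(2)[of c] unfolding x_def by blast
    then show False using c(1) by blast
  qed
  define I where "I = {z. z * y0 = 0}"
  have I_left: "a * z \<in> I" if "z \<in> I" for a z using that by (simp add: I_def mult.assoc)
  define u1 where "u1 = x0"
  have u1: "u1 \<in> I" "u1 \<noteq> 0" using zd by (auto simp: I_def u1_def)
  obtain u2 where u2: "u2 \<in> I" "\<And>c. u2 \<noteq> emb c * u1" using not_one_dim[of I u1, OF I_left u1] by blast
  have indep: "c1 = 0 \<and> c2 = 0" if r: "emb c1 * u1 + emb c2 * u2 = 0" for c1 c2
  proof -
    have c2: "c2 = 0"
    proof (rule ccontr)
      assume "c2 \<noteq> 0"
      have "emb (inverse c2) * (emb c1 * u1 + emb c2 * u2) = emb (c1 / c2) * u1 + u2"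
        using \<open>c2 \<noteq> 0\<close> by (simp add: distrib_left divide_inverse mult.commute flip: mult.assoc emb_mult)
      then have "emb (c1 / c2) * u1 + u2 = 0" using r by simp
      then have "u2 = emb (- (c1 / c2)) * u1" by (simp add: emb_minus eq_neg_iff_add_eq_0 add.commute)
      then show False using u2(2) by blast
    qed
    then show ?thesis using r emb_cancel[of c1 u1] u1(2) by auto
  qed
  \<comment> \<open>A third independent element \<open>z\<close> of \<open>I\<close> would leave at
    most one dimension for the left ideal of all \<open>w * y0\<close>.\<close>
  have span: "\<exists>p q. z = emb p * u1 + emb q * u2" if z: "z \<in> I" for z
  proof (rule ccontr)
    assume neg: "\<not> ?thesis"
    have "\<exists>c. w * y0 = emb c * y0" for w
    proof -
      obtain c0 c1 c2 c3 c4 where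
        c: "emb c0 * u1 + emb c1 * u2 + emb c2 * z + emb c3 * 1 + emb c4 * w = 0"
        "c0 \<noteq> 0 \<or> c1 \<noteq> 0 \<or> c2 \<noteq> 0 \<or> c3 \<noteq> 0 \<or> c4 \<noteq> 0" by (rule five_dependent')
      have "(emb c0 * u1 + emb c1 * u2 + emb c2 * z + emb c3 * 1 + emb c4 * w) * y0 = emb c3 * y0 + emb c4 * (w * y0)"
        using u1(1) u2(1) z by (simp add: I_def distrib_right mult.assoc)
      then have r: "emb c3 * y0 + emb c4 * (w * y0) = 0" using c(1) by simp
      have "c4 \<noteq> 0"
      proof
        assume c4: "c4 = 0"
        then have c3: "c3 = 0" using r emb_cancel[of c3 y0] zd by auto
        have r2: "emb c0 * u1 + emb c1 * u2 + emb c2 * z = 0" using c(1) c3 c4 by simp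
        have "c2 \<noteq> 0" using indep[of c0 c1] r2 c(2) c3 c4 by auto
        have "emb (inverse c2) * (emb c0 * u1 + emb c1 * u2 + emb c2 * z) = emb (c0 / c2) * u1 + emb (c1 / c2) * u2 + z"
          using \<open>c2 \<noteq> 0\<close> by (simp add: distrib_left divide_inverse mult.commute flip: mult.assoc emb_mult)
        then have "emb (c0 / c2) * u1 + emb (c1 / c2) * u2 + z = 0" using r2 by simp
        then have "z = emb (- (c0 / c2)) * u1 + emb (- (c1 / c2)) * u2"
          by (simp add: emb_minus) (metis add.commute add_eq_0_iff minus_add_distrib uminus_add_conv_diff)
        then show False using neg by blast
      qed
      have "emb (inverse c4) * (emb c3 * y0 + emb c4 * (w * y0)) = emb (c3 / c4) * y0 + w * y0"
        using \<open>c4 \<noteq> 0\<close> by (simp add: distrib_left divide_inverse mult.commute flip: mult.assoc emb_mult)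
      then have "w * y0 = emb (- (c3 / c4)) * y0" using r by (simp add: emb_minus eq_neg_iff_add_eq_0 add.commute)
      then show ?thesis by blast
    qed
    then have sp: "\<exists>c. z = emb c * y0" if "z \<in> range (\<lambda>w. w * y0)" for z using that by blast
    have "a * z \<in> range (\<lambda>w. w * y0)" if "z \<in> range (\<lambda>w. w * y0)" for a z
      using that by (auto simp flip: mult.assoc)
    moreover have "y0 \<in> range (\<lambda>w. w * y0)" by (rule range_eqI[of _ _ 1]) simp
    ultimately show False using not_one_dim[OF _ _ zd(3) sp] by blast
  qed
  have kill: "x = 0" if "x * u1 = 0" "x * u2 = 0" for x
  proof (rule faithful[of I u1 x, OF I_left u1])
    fix z assume "z \<in> I"
    then show "x * z = 0" using span[of z] that by (auto simp: distrib_left emb_comm_left[of x])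
  qed
  \<comment> \<open>The pairs \<open>(e l * u1, e l * u2)\<close> and the target, stored under index
    4, are five vectors in a space of dimension four; by \<open>kill\<close> the target has a
    nonzero coefficient in a relation.\<close>
  have act: "\<exists>x. x * u1 = w1 \<and> x * u2 = w2" if w: "w1 \<in> I" "w2 \<in> I" for w1 w2
  proof -
    have "\<forall>l. \<exists>p q. (if l = 4 then w1 else e l * u1) = emb p * u1 + emb q * u2" using span I_left u1 w by auto
    then obtain p q where pq: "\<And>l. (if l = 4 then w1 else e l * u1) = emb (p l) * u1 + emb (q l) * u2" by metis
    have "\<forall>l. \<exists>p q. (if l = 4 then w2 else e l * u2) = emb p * u1 + emb q * u2" using span I_left u2 w by auto
    then obtain p' q' where pq': "\<And>l. (if l = 4 then w2 else e l * u2) = emb (p' l) * u1 + emb (q' l) * u2" by metis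
    have "card {..<4::nat} < card {..<5::nat}" by simp
    from homogeneous_system[OF _ _ this, of "\<lambda>l s. [p l, q l, p' l, q' l] ! s"] obtain c where
      c: "\<exists>l<5. c l \<noteq> 0" "\<And>s. s < 4 \<Longrightarrow> (\<Sum>l<5. c l * [p l, q l, p' l, q' l] ! s) = 0" by auto
    have c': "(\<Sum>l<5. c l * p l) = 0" "(\<Sum>l<5. c l * q l) = 0" "(\<Sum>l<5. c l * p' l) = 0" "(\<Sum>l<5. c l * q' l) = 0"
      using c(2)[of 0] c(2)[of 1] c(2)[of 2] c(2)[of 3] by (simp_all add: numeral_2_eq_2 numeral_3_eq_3)
    have comb: "(\<Sum>l<5. emb (c l) * (emb (f l) * u1 + emb (g l) * u2)) = emb (\<Sum>l<5. c l * f l) * u1 + emb (\<Sum>l<5. c l * g l) * u2"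
      for f g by (simp only: emb_sum sum_distrib_right distrib_left sum.distrib emb_mult mult.assoc)
    have 1: "(\<Sum>l<5. emb (c l) * (if l = 4 then w1 else e l * u1)) = 0"
      unfolding pq comb c' by simp
    have 2: "(\<Sum>l<5. emb (c l) * (if l = 4 then w2 else e l * u2)) = 0"
      unfolding pq' comb c' by simp
    define x where "x = (\<Sum>l<4. emb (c l) * e l)"
    have five: "{..<5::nat} = insert 4 {..<4}" by auto
    have x1: "emb (c 4) * w1 + x * u1 = 0"
      using 1 unfolding five by (simp add: x_def sum_distrib_right mult.assoc)
    have x2: "emb (c 4) * w2 + x * u2 = 0"
      using 2 unfolding five by (simp add: x_def sum_distrib_right mult.assoc)
    have "c 4 \<noteq> 0"
    proof
      assume c4: "c 4 = 0"
      then have "x = 0" using kill x1 x2 by simp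
      then have "\<forall>l<4. c l = 0" using e(2)[of c] unfolding x_def by blast
      moreover obtain l where "l < 5" "c l \<noteq> 0" using c(1) by blast
      moreover have "l < 4 \<or> l = 4" using \<open>l < 5\<close> by linarith
      ultimately show False using c4 by blast
    qed
    then have inv: "emb (inverse (c 4)) * emb (c 4) = 1" by (simp flip: emb_mult)
    have "emb (- inverse (c 4)) * x * u1 = w1"
    proof -
      have "x * u1 = - (emb (c 4) * w1)" using x1 by (simp add: eq_neg_iff_add_eq_0 add.commute)
      then show ?thesis using inv by (simp add: emb_minus mult.assoc) (simp flip: mult.assoc)
    qed
    moreover have "emb (- inverse (c 4)) * x * u2 = w2"
    proof -
      have "x * u2 = - (emb (c 4) * w2)" using x2 by (simp add: eq_neg_iff_add_eq_0 add.commute)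
      then show ?thesis using inv by (simp add: emb_minus mult.assoc) (simp flip: mult.assoc)
    qed
    ultimately show ?thesis by blast
  qed
  have mu2: "- u2 \<in> I" using u2(1) by (simp add: I_def)
  \<comment> \<open>In the basis \<open>u1\<close>, \<open>u2\<close> the two elements are the
    diagonal matrix with entries 1 and -1 and the transposition; they anticommute and both square to
    1.\<close>
  obtain i where i: "i * u1 = u1" "i * u2 = - u2" using act[OF u1(1) mu2] by blast
  obtain j where j: "j * u1 = u2" "j * u2 = u1" using act[OF u2(1) u1(1)] by blast
  have "i * i - 1 = 0" by (rule kill) (simp_all add: left_diff_distrib mult.assoc i)
  moreover have "j * j - 1 = 0" by (rule kill) (simp_all add: left_diff_distrib mult.assoc j)
  moreover have "i * j + j * i = 0" by (rule kill) (simp_all add: distrib_right mult.assoc i j)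
  ultimately show ?thesis by (intro exI[of _ i] exI[of _ j] exI[of _ 1]) (auto simp: eq_neg_iff_add_eq_0)
qed

lemma quaternion_generators:
  "\<exists>i j a b. a \<noteq> 0 \<and> b \<noteq> 0 \<and> i * i = emb a \<and> j * j = emb b \<and> i * j = - (j * i)"
  using quaternion_generators_division quaternion_generators_split by blast

end

section \<open>Coordinates and matrices of left multiplication\<close>

context quartic_algebra
begin

lemma the_basis: "K_basis4 emb (the_basis emb)"
  unfolding the_basis_def using ex_basis by (rule someI_ex)

lemma coord_spec: "(\<forall>l\<ge>4. coord emb x l = 0) \<and> x = (\<Sum>l<4. emb (coord emb x l) * the_basis emb l)"
proof -
  have "\<exists>!c. (\<forall>l\<ge>4. c l = 0) \<and> x = (\<Sum>l<4. emb (c l) * the_basis emb l)"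
    using the_basis unfolding K_basis4_def by blast
  from theI'[OF this] show ?thesis unfolding coord_def .
qed

lemma coord_unique:
  assumes "\<And>l. l \<ge> 4 \<Longrightarrow> c l = 0" "x = (\<Sum>l<4. emb (c l) * the_basis emb l)"
  shows "coord emb x = c"
proof -
  have "\<exists>!c. (\<forall>l\<ge>4. c l = 0) \<and> x = (\<Sum>l<4. emb (c l) * the_basis emb l)"
    using the_basis unfolding K_basis4_def by blast
  from ex1_unique[OF this, OF coord_spec[of x], of c] assms show ?thesis by blast
qed

lemma coord_expand: "(\<Sum>l<4. emb (coord emb x l) * the_basis emb l) = x"
  using coord_spec[of x] by simp

lemma coord_add: "coord emb (x + y) l = coord emb x l + coord emb y l"
proof -
  have "coord emb (x + y) = (\<lambda>l. coord emb x l + coord emb y l)"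
    by (rule coord_unique) (use coord_spec[of x] coord_spec[of y] in
      \<open>simp_all add: emb_add distrib_right sum.distrib coord_expand\<close>)
  then show ?thesis by simp
qed

lemma coord_smult: "coord emb (emb c * x) l = c * coord emb x l"
proof -
  have "coord emb (emb c * x) = (\<lambda>l. c * coord emb x l)"
    by (rule coord_unique) (use coord_spec[of x] in
      \<open>simp_all add: emb_mult mult.assoc coord_expand flip: sum_distrib_left\<close>)
  then show ?thesis by simp
qed

lemma coord_zero [simp]: "coord emb 0 l = 0"
  using coord_smult[of 0 0 l] by simp

lemma coord_sum: "coord emb (\<Sum>s\<in>S. f s) l = (\<Sum>s\<in>S. coord emb (f s) l)"
  by (induction S rule: infinite_finite_induct) (auto simp: coord_add)

lemma coord_basis: "s < 4 \<Longrightarrow> coord emb (the_basis emb s) l = (if l = s then 1 else 0)"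
proof -
  assume s: "s < 4"
  have "coord emb (the_basis emb s) = (\<lambda>l. if l = s then 1 else 0)"
    by (rule coord_unique) (use s in \<open>auto simp: if_distrib[of emb] if_distrib[of "\<lambda>x. x * _"] cong: if_cong\<close>)
  then show ?thesis by simp
qed

lemma left_mult_mat_carrier: "left_mult_mat emb x \<in> carrier_mat 4 4"
  by (simp add: left_mult_mat_def)

lemma left_mult_mat_index:
  "i < 4 \<Longrightarrow> j < 4 \<Longrightarrow> left_mult_mat emb x $$ (i,j) = coord emb (x * the_basis emb j) i"
  by (simp add: left_mult_mat_def)

lemma coord_left_mult:
  "coord emb (x * y) l = (\<Sum>k<4. coord emb (x * the_basis emb k) l * coord emb y k)"
proof -
  have "x * y = (\<Sum>k<4. emb (coord emb y k) * (x * the_basis emb k))"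
    by (subst coord_expand[of y, symmetric]) (simp add: sum_distrib_left emb_comm_left[of x])
  then have "coord emb (x * y) l = (\<Sum>k<4. coord emb (emb (coord emb y k) * (x * the_basis emb k)) l)"
    by (simp only: coord_sum)
  then show ?thesis by (simp add: coord_smult mult.commute)
qed

lemma left_mult_mat_mult_index:
  assumes "i < 4" "j < 4"
  shows "(\<Sum>k<4. left_mult_mat emb x $$ (i,k) * left_mult_mat emb y $$ (k,j)) = left_mult_mat emb (x * y) $$ (i,j)"
  using assms by (simp add: left_mult_mat_index coord_left_mult[of x "y * _", symmetric] mult.assoc)

lemma left_mult_mat_scalar:
  assumes "i < 4" "j < 4"
  shows "left_mult_mat emb (emb c) $$ (i,j) = (if i = j then c else 0)"
  using assms by (simp add: left_mult_mat_index coord_smult coord_basis)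

end

lemma sum_const_poly: "(\<Sum>k\<in>S. [:f k:]) = [:\<Sum>k\<in>S. f k:]"
  by (induction S rule: infinite_finite_induct) auto

lemma sum_delta_product:
  fixes X :: "'r::comm_ring_1"
  assumes "k < n" "l < (n::nat)"
  shows "(\<Sum>s<n. (X * (if k = s then 1 else 0) - f s) * (X * (if s = l then 1 else 0) - g s)) =
    X * (X * (if k = l then 1 else 0)) - X * g k - X * f l + (\<Sum>s<n. f s * g s)"
proof -
  have "(\<Sum>s<n. (X * (if k = s then 1 else 0) - f s) * (X * (if s = l then 1 else 0) - g s)) =
    (\<Sum>s<n. (if k = s then X * (X * (if s = l then 1 else 0)) else 0) - (if k = s then X * g s else 0)
       - (if s = l then X * f s else 0) + f s * g s)"
    by (intro sum.cong refl) (auto simp: algebra_simps)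
  then show ?thesis using assms by (simp add: sum.distrib sum_subtractf)
qed

section \<open>Quaternion coordinates and the reduced norm\<close>

locale quaternion_basis = central_simple_quartic emb
  for emb :: "'k::field \<Rightarrow> 'd::ring_1" +
  fixes i j :: 'd and a b :: 'k
  assumes a0: "a \<noteq> 0" and b0: "b \<noteq> 0"
    and ii: "i * i = emb a" and jj: "j * j = emb b" and ij: "i * j = - (j * i)"
begin

definition mk :: "'k \<Rightarrow> 'k \<Rightarrow> 'k \<Rightarrow> 'k \<Rightarrow> 'd" where
  "mk x0 x1 x2 x3 = emb x0 + emb x1 * i + emb x2 * j + emb x3 * (i * j)"

lemma emb_smult_mult: "emb x * u * (emb y * w) = emb (x * y) * (u * w)"
  by (simp add: emb_comm_left[of u] emb_mult mult.assoc)

lemma mk_mult: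
  "mk x0 x1 x2 x3 * mk y0 y1 y2 y3 =
   mk (x0*y0 + a*x1*y1 + b*x2*y2 - a*b*x3*y3) (x0*y1 + x1*y0 - b*x2*y3 + b*x3*y2)
      (x0*y2 + x2*y0 + a*x1*y3 - a*x3*y1) (x0*y3 + x3*y0 + x1*y2 - x2*y1)"
proof -
  define k where "k = i * j"
  have ji: "j * i = - k" using ij by (simp add: k_def)
  have ik: "i * k = emb a * j" by (simp add: k_def ii flip: mult.assoc)
  have kj: "k * j = emb b * i" by (simp add: k_def mult.assoc jj emb_comm[of i])
  have ki: "k * i = - (emb a * j)" 
  proof -
    have "k * i = i * (j * i)" by (simp add: k_def mult.assoc)
    then show ?thesis by (simp add: ji ik)
  qed
  have jk: "j * k = - (emb b * i)"
  proof -
    have "j * k = - (k * j)" by (simp add: k_def ji flip: mult.assoc)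
    then show ?thesis by (simp add: kj)
  qed
  have kk: "k * k = - emb (a * b)"
  proof -
    have "k * k = i * (j * k)" by (simp add: k_def mult.assoc)
    also have "\<dots> = - (emb b * (i * i))" by (simp add: jk emb_comm_left[of i])
    finally show ?thesis by (simp add: ii mult.commute flip: emb_mult)
  qed
  have M: "mk x0 x1 x2 x3 = emb x0 + emb x1 * i + emb x2 * j + emb x3 * k" for x0 x1 x2 x3
    by (simp add: mk_def k_def)
  have s1: "emb x * u * emb y = emb (x * y) * u" for x y u by (simp add: emb_mult emb_comm[of u] mult.assoc)
  have s2: "emb x * (emb y * u) = emb (x * y) * u" for x y u by (simp add: emb_mult mult.assoc)
  have "mk x0 x1 x2 x3 * mk y0 y1 y2 y3 =
     emb (x0*y0) + emb (x0*y1) * i + emb (x0*y2) * j + emb (x0*y3) * k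
   + (emb (x1*y0) * i + emb (x1*y1) * emb a + emb (x1*y2) * k + emb (x1*y3) * (emb a * j))
   + (emb (x2*y0) * j + emb (x2*y1) * (- k) + emb (x2*y2) * emb b + emb (x2*y3) * (- (emb b * i)))
   + (emb (x3*y0) * k + emb (x3*y1) * (- (emb a * j)) + emb (x3*y2) * (emb b * i) + emb (x3*y3) * (- emb (a*b)))"
    unfolding M distrib_right distrib_left emb_smult_mult s1 ii jj ji ik kj ki jk kk k_def[symmetric]
    by (simp only: s2 emb_mult[symmetric] add.assoc add.left_commute add.commute)
  also have "\<dots> = mk (x0*y0 + a*x1*y1 + b*x2*y2 - a*b*x3*y3) (x0*y1 + x1*y0 - b*x2*y3 + b*x3*y2)
      (x0*y2 + x2*y0 + a*x1*y3 - a*x3*y1) (x0*y3 + x3*y0 + x1*y2 - x2*y1)"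
    unfolding M
    by (simp only: mult_minus_right mult.assoc[symmetric] emb_mult[symmetric])
      (simp add: emb_add emb_diff algebra_simps)
  finally show ?thesis .
qed

lemma mk_add: "mk x0 x1 x2 x3 + mk y0 y1 y2 y3 = mk (x0+y0) (x1+y1) (x2+y2) (x3+y3)"
  by (simp add: mk_def emb_add algebra_simps)

lemma emb_mk: "emb c = mk c 0 0 0"
  by (simp add: mk_def)

lemma mk_eq_0: "mk x0 x1 x2 x3 = 0 \<Longrightarrow> x0 = 0 \<and> x1 = 0 \<and> x2 = 0 \<and> x3 = 0"
proof -
  assume z: "mk x0 x1 x2 x3 = 0"
  have dbl: "mk 0 y1 y2 y3 = 0 \<and> y0 = 0" if "mk y0 y1 y2 y3 = 0" "mk y0 (-y1) (-y2) (-y3) = 0" for y0 y1 y2 y3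
  proof -
    have "mk y0 y1 y2 y3 + mk y0 (-y1) (-y2) (-y3) = emb (2 * y0)" by (simp add: mk_add emb_mk)
    then have "emb (2 * y0) = 0" using that by simp
    then have "y0 = 0" using two by simp
    then show ?thesis using that by simp
  qed
  text \<open>Sandwiching with \<open>i\<close>, \<open>j\<close> and \<open>i j\<close> flips the signs of two coordinates at a time.\<close>
  have si: "mk 0 (1/a) 0 0 * (mk y0 y1 y2 y3 * mk 0 1 0 0) = mk y0 y1 (-y2) (-y3)" for y0 y1 y2 y3
    using a0 by (simp add: mk_mult)
  have sj: "mk 0 0 (1/b) 0 * (mk y0 y1 y2 y3 * mk 0 0 1 0) = mk y0 (-y1) y2 (-y3)" for y0 y1 y2 y3
    using b0 by (simp add: mk_mult)
  have z1: "mk x0 x1 (-x2) (-x3) = 0" using si[of x0 x1 x2 x3] z by simp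
  have z2: "mk x0 (-x1) x2 (-x3) = 0" using sj[of x0 x1 x2 x3] z by simp
  have z3: "mk x0 (-x1) (-x2) x3 = 0" using sj[of x0 x1 "-x2" "-x3"] z1 by simp
  have half: "y + y = 0 \<Longrightarrow> y = 0" for y :: 'k using two by (simp flip: mult_2)
  have "mk (x0+x0) (x1+x1) 0 0 = 0" using mk_add[of x0 x1 x2 x3 x0 x1 "-x2" "-x3"] z z1 by simp
  moreover have "mk (x0+x0) (-x1-x1) 0 0 = 0" using mk_add[of x0 "-x1" x2 "-x3" x0 "-x1" "-x2" "x3"] z2 z3 by simp
  ultimately have "mk (x0+x0+(x0+x0)) 0 0 0 = 0" using mk_add[of "x0+x0" "x1+x1" 0 0 "x0+x0" "-x1-x1" 0 0] by simp
  then have "x0 + x0 + (x0 + x0) = 0" by (simp flip: emb_mk)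
  then have x0: "x0 = 0" using half by blast
  have shift: "y0 = 0" if "mk y0 0 0 0 = 0" for y0 using that by (simp flip: emb_mk)
  have d1: "mk 0 (x1+x1) 0 0 = 0" using \<open>mk (x0+x0) (x1+x1) 0 0 = 0\<close> x0 by simp
  have "mk 0 (x1+x1) 0 0 * mk 0 1 0 0 = mk (a * (x1+x1)) 0 0 0" by (simp add: mk_mult)
  then have "a * (x1 + x1) = 0" unfolding d1 by (intro shift) simp
  then have x1: "x1 = 0" using a0 two by simp
  have d2: "mk 0 0 (x2+x2) 0 = 0" using mk_add[of x0 x1 x2 x3 x0 "-x1" x2 "-x3"] z z2 x0 by simp
  have "mk 0 0 (x2+x2) 0 * mk 0 0 1 0 = mk (b * (x2+x2)) 0 0 0" by (simp add: mk_mult)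
  then have "b * (x2 + x2) = 0" unfolding d2 by (intro shift) simp
  then have x2: "x2 = 0" using b0 two by simp
  have "mk 0 0 0 x3 * mk 0 0 0 1 = mk (- (a * b * x3)) 0 0 0" by (simp add: mk_mult)
  then have "a * b * x3 = 0" using z x0 x1 x2 shift[of "- (a * b * x3)"] by simp
  then show ?thesis using x0 x1 x2 a0 b0 by simp
qed

lemma mk_minus: "- mk x0 x1 x2 x3 = mk (-x0) (-x1) (-x2) (-x3)"
  by (simp add: mk_def emb_minus)

lemma mk_inject: "mk x0 x1 x2 x3 = mk y0 y1 y2 y3 \<longleftrightarrow> x0 = y0 \<and> x1 = y1 \<and> x2 = y2 \<and> x3 = y3"
proof
  assume "mk x0 x1 x2 x3 = mk y0 y1 y2 y3"
  then have "mk (x0-y0) (x1-y1) (x2-y2) (x3-y3) = 0"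
    using mk_add[of x0 x1 x2 x3 "-y0" "-y1" "-y2" "-y3"] mk_minus[of y0 y1 y2 y3, symmetric] by simp
  from mk_eq_0[OF this] show "x0 = y0 \<and> x1 = y1 \<and> x2 = y2 \<and> x3 = y3" by simp
qed simp

lemma mk_surj: "\<exists>x0 x1 x2 x3. x = mk x0 x1 x2 x3"
proof -
  obtain c0 c1 c2 c3 c4 where
    c: "emb c0 * 1 + emb c1 * i + emb c2 * j + emb c3 * (i * j) + emb c4 * x = 0"
    "c0 \<noteq> 0 \<or> c1 \<noteq> 0 \<or> c2 \<noteq> 0 \<or> c3 \<noteq> 0 \<or> c4 \<noteq> 0" by (rule five_dependent')
  have r: "mk c0 c1 c2 c3 + emb c4 * x = 0" using c(1) by (simp add: mk_def)
  have "c4 \<noteq> 0" using r mk_eq_0[of c0 c1 c2 c3] c(2) by auto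
  then have "x = emb (inverse c4) * (emb c4 * x)" by (simp flip: mult.assoc emb_mult)
  also have "emb c4 * x = - mk c0 c1 c2 c3" using r by (simp add: eq_neg_iff_add_eq_0 add.commute)
  finally have "x = emb (inverse c4) * - mk c0 c1 c2 c3" .
  then show ?thesis unfolding mk_minus emb_mk[of "inverse c4"] mk_mult by blast
qed

text \<open>Coordinates with respect to \<open>1, i, j, i * j\<close>. They are kept apart from
  \<open>coord\<close>, which refers to the arbitrary basis behind the topology and
  \<open>left_mult_mat\<close>.\<close>

definition qs :: "'d \<Rightarrow> 'k \<times> 'k \<times> 'k \<times> 'k" where
  "qs x = (SOME t. x = (case t of (x0,x1,x2,x3) \<Rightarrow> mk x0 x1 x2 x3))"

definition q0 :: "'d \<Rightarrow> 'k" where "q0 x = fst (qs x)"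
definition q1 :: "'d \<Rightarrow> 'k" where "q1 x = fst (snd (qs x))"
definition q2 :: "'d \<Rightarrow> 'k" where "q2 x = fst (snd (snd (qs x)))"
definition q3 :: "'d \<Rightarrow> 'k" where "q3 x = snd (snd (snd (qs x)))"

lemma mk_q: "mk (q0 x) (q1 x) (q2 x) (q3 x) = x"
proof -
  have "\<exists>t. x = (case t of (x0,x1,x2,x3) \<Rightarrow> mk x0 x1 x2 x3)" using mk_surj[of x] by auto
  from someI_ex[OF this] show ?thesis
    unfolding q0_def q1_def q2_def q3_def qs_def[symmetric] by (simp split: prod.splits)
qed

lemma q_mk [simp]: "q0 (mk x0 x1 x2 x3) = x0" "q1 (mk x0 x1 x2 x3) = x1"
  "q2 (mk x0 x1 x2 x3) = x2" "q3 (mk x0 x1 x2 x3) = x3"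
  using mk_q[of "mk x0 x1 x2 x3"] by (auto simp: mk_inject)

lemma q_eqI: "q0 x = q0 y \<Longrightarrow> q1 x = q1 y \<Longrightarrow> q2 x = q2 y \<Longrightarrow> q3 x = q3 y \<Longrightarrow> x = y"
  by (metis mk_q)

lemma q_emb [simp]: "q0 (emb c) = c" "q1 (emb c) = 0" "q2 (emb c) = 0" "q3 (emb c) = 0"
  by (simp_all add: emb_mk)

lemma q_zero [simp]: "q0 0 = 0" "q1 0 = 0" "q2 0 = 0" "q3 0 = 0"
  using q_emb[of 0] by simp_all

lemma q_one [simp]: "q0 1 = 1" "q1 1 = 0" "q2 1 = 0" "q3 1 = 0"
  using q_emb[of 1] by simp_all

lemma q_add [simp]: "q0 (x + y) = q0 x + q0 y" "q1 (x + y) = q1 x + q1 y"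
  "q2 (x + y) = q2 x + q2 y" "q3 (x + y) = q3 x + q3 y"
  using mk_add[of "q0 x" "q1 x" "q2 x" "q3 x" "q0 y" "q1 y" "q2 y" "q3 y"] unfolding mk_q by simp_all

lemma q_minus [simp]: "q0 (- x) = - q0 x" "q1 (- x) = - q1 x" "q2 (- x) = - q2 x" "q3 (- x) = - q3 x"
  using mk_minus[of "q0 x" "q1 x" "q2 x" "q3 x"] unfolding mk_q by simp_all

lemma q_diff [simp]: "q0 (x - y) = q0 x - q0 y" "q1 (x - y) = q1 x - q1 y"
  "q2 (x - y) = q2 x - q2 y" "q3 (x - y) = q3 x - q3 y"
  using q_add[of x "- y"] by simp_all

lemma q_mult:
  "q0 (x * y) = q0 x * q0 y + a * q1 x * q1 y + b * q2 x * q2 y - a * b * q3 x * q3 y"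
  "q1 (x * y) = q0 x * q1 y + q1 x * q0 y - b * q2 x * q3 y + b * q3 x * q2 y"
  "q2 (x * y) = q0 x * q2 y + q2 x * q0 y + a * q1 x * q3 y - a * q3 x * q1 y"
  "q3 (x * y) = q0 x * q3 y + q3 x * q0 y + q1 x * q2 y - q2 x * q1 y"
  using mk_mult[of "q0 x" "q1 x" "q2 x" "q3 x" "q0 y" "q1 y" "q2 y" "q3 y"] unfolding mk_q by simp_all

lemma q_smult [simp]: "q0 (emb c * x) = c * q0 x" "q1 (emb c * x) = c * q1 x"
  "q2 (emb c * x) = c * q2 x" "q3 (emb c * x) = c * q3 x"
  by (simp_all add: q_mult)

lemma q_sum: "q0 (\<Sum>s\<in>S. f s) = (\<Sum>s\<in>S. q0 (f s))" "q1 (\<Sum>s\<in>S. f s) = (\<Sum>s\<in>S. q1 (f s))"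
  "q2 (\<Sum>s\<in>S. f s) = (\<Sum>s\<in>S. q2 (f s))" "q3 (\<Sum>s\<in>S. f s) = (\<Sum>s\<in>S. q3 (f s))"
  by (induction S rule: infinite_finite_induct) auto

definition qconj :: "'d \<Rightarrow> 'd" where
  "qconj x = mk (q0 x) (- q1 x) (- q2 x) (- q3 x)"

definition nrm :: "'d \<Rightarrow> 'k" where
  "nrm x = (q0 x)\<^sup>2 - a * (q1 x)\<^sup>2 - b * (q2 x)\<^sup>2 + a * b * (q3 x)\<^sup>2"

lemma q_qconj [simp]: "q0 (qconj x) = q0 x" "q1 (qconj x) = - q1 x" "q2 (qconj x) = - q2 x" "q3 (qconj x) = - q3 x"
  by (simp_all add: qconj_def)

lemma mult_qconj: "x * qconj x = emb (nrm x)" "qconj x * x = emb (nrm x)"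
  by (rule q_eqI; simp add: q_mult nrm_def power2_eq_square algebra_simps)+

lemma add_qconj: "x + qconj x = emb (2 * q0 x)"
  by (rule q_eqI) simp_all

lemma qconj_mult: "qconj (x * y) = qconj y * qconj x"
  by (rule q_eqI) (simp_all add: q_mult algebra_simps)

lemma nrm_mult: "nrm (x * y) = nrm x * nrm y"
  by (simp add: nrm_def q_mult power2_eq_square algebra_simps)

lemma nrm_one [simp]: "nrm 1 = 1"
  by (simp add: nrm_def)

text \<open>For the bilinear form \<open>q0 (qconj y * z)\<close> left multiplication by
  \<open>qconj x\<close> is adjoint to left multiplication by \<open>x\<close>. The Gram matrix
  \<open>G\<close> of the form is invertible, so the transpose of one matrix is similar to the
  other.\<close>

lemma char_poly_left_mult_mat_qconj:
  "char_poly (left_mult_mat emb (qconj x)) = char_poly (left_mult_mat emb x)"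
proof -
  define e where "e = the_basis emb"
  define G where "G = mat 4 4 (\<lambda>(k,l). q0 (qconj (e k) * e l))"
  have Gc: "G \<in> carrier_mat 4 4" by (simp add: G_def)
  let ?L = "left_mult_mat emb x" and ?L' = "left_mult_mat emb (qconj x)"
  note Lc = left_mult_mat_carrier[of x] and Lc' = left_mult_mat_carrier[of "qconj x"]
  have lin2: "(\<Sum>k<4. q0 (z * e k) * coord emb y k) = q0 (z * y)" for y z
  proof -
    have "z * y = (\<Sum>k<4. emb (coord emb y k) * (z * e k))"
      by (subst coord_expand[of y, symmetric]) (simp add: sum_distrib_left emb_comm_left[of z] e_def)
    then show ?thesis by (simp add: q_sum mult.commute)
  qed
  have sym: "q0 (qconj y * z) = q0 (qconj z * y)" for y z by (simp add: q_mult algebra_simps)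
  have GL: "?L\<^sup>T * G = G * ?L'"
  proof (rule eq_matI)
    fix k l assume "k < dim_row (G * ?L')" "l < dim_col (G * ?L')"
    then have kl: "k < 4" "l < 4" using Gc Lc' by auto
    have "(?L\<^sup>T * G) $$ (k,l) = (\<Sum>s<4. coord emb (x * e k) s * q0 (qconj (e s) * e l))"
      using kl Lc Gc mult_mat_index[of "?L\<^sup>T" 4 4 G 4 k l] by (simp add: left_mult_mat_index G_def e_def)
    also have "\<dots> = (\<Sum>s<4. q0 (qconj (e l) * e s) * coord emb (x * e k) s)"
      by (intro sum.cong refl) (subst sym[of "e l"], rule mult.commute)
    also have "\<dots> = q0 (qconj (e l) * (x * e k))" by (rule lin2)
    also have "\<dots> = q0 (qconj (x * e k) * e l)" by (rule sym)
    also have "\<dots> = q0 (qconj (e k) * (qconj x * e l))" by (simp add: qconj_mult mult.assoc)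
    also have "\<dots> = (G * ?L') $$ (k,l)"
      using kl Lc' Gc mult_mat_index[of G 4 4 ?L' 4 k l] by (simp add: left_mult_mat_index G_def lin2 flip: e_def)
    finally show "(?L\<^sup>T * G) $$ (k,l) = (G * ?L') $$ (k,l)" .
  qed (use Gc Lc Lc' in auto)
  have "inj_mat G" unfolding inj_mat_def
  proof (intro ballI impI)
    fix w assume "w \<in> carrier_vec (dim_col G)" "G *\<^sub>v w = 0\<^sub>v (dim_row G)"
    then have w: "w \<in> carrier_vec 4" "G *\<^sub>v w = 0\<^sub>v 4" using Gc by auto
    define y where "y = (\<Sum>l<4. emb (w $ l) * e l)"
    have cy: "coord emb y = (\<lambda>l. if l < 4 then w $ l else 0)"
      by (rule coord_unique) (simp_all add: y_def e_def)
    have "q0 (qconj (e k) * y) = 0" if k: "k < 4" for k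
    proof -
      have "(\<Sum>l<4. q0 (qconj (e k) * e l) * coord emb y l) = (G *\<^sub>v w) $ k"
        using mult_mat_vec_index[OF Gc w(1) k] k by (simp add: G_def cy)
      then show ?thesis unfolding lin2 using w(2) k by simp
    qed
    then have z: "q0 (qconj y * z) = 0" for z
      unfolding lin2[of "qconj y" z, symmetric] by (intro sum.neutral) (simp add: sym[of y])
    have "y = 0"
      using z[of "mk 1 0 0 0"] z[of "mk 0 1 0 0"] z[of "mk 0 0 1 0"] z[of "mk 0 0 0 1"] a0 b0
      by (intro q_eqI) (simp_all add: q_mult)
    then have "w $ l = 0" if "l < 4" for l using fun_cong[OF cy, of l] that by simp
    then show "w = 0\<^sub>v (dim_col G)" using w(1) Gc by (intro eq_vecI) auto
  qed
  from inj_mat_square_invertible[OF Gc this] obtain H where H: "H \<in> carrier_mat 4 4" "H * G = 1\<^sub>m 4" "G * H = 1\<^sub>m 4" .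
  have "?L\<^sup>T = ?L\<^sup>T * (G * H)" using H Lc by simp
  also have "\<dots> = ?L\<^sup>T * G * H" using assoc_mult_mat[of "?L\<^sup>T" 4 4 G 4 H 4] Lc Gc H by simp
  finally have "?L\<^sup>T = G * ?L' * H" unfolding GL .
  then have "similar_mat (?L\<^sup>T) ?L'"
    unfolding similar_mat_def using similar_mat_witI[OF H(3,2), of "?L\<^sup>T" ?L'] Lc Lc' Gc H(1) by fastforce
  from char_poly_similar[OF this] show ?thesis using char_poly_transpose_mat[OF Lc] by simp
qed

text \<open>With \<open>L x\<close> the matrix of left multiplication,
  \<open>(X - L x) * (X - L (qconj x))\<close> is the scalar
  \<open>X^2 - 2 * q0 x * X + nrm x\<close>. Determinants give the square of the characteristic
  polynomial, and its leading coefficient settles the sign.\<close>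

lemma char_poly_left_mult_mat:
  "char_poly (left_mult_mat emb x) = [:nrm x, - (2 * q0 x), 1:] ^ 2"
proof -
  let ?L = "left_mult_mat emb x" and ?L' = "left_mult_mat emb (qconj x)"
  note Lc = left_mult_mat_carrier[of x] and Lc' = left_mult_mat_carrier[of "qconj x"]
  define qq where "qq = [:nrm x, - (2 * q0 x), 1:]"
  define P where "P A = char_poly_matrix A" for A :: "'k mat"
  have Pc: "P A \<in> carrier_mat 4 4" and Pi: "k < 4 \<Longrightarrow> l < 4 \<Longrightarrow> P A $$ (k,l) = [:0,1:] * (if k = l then 1 else 0) - [:A $$ (k,l):]"
    if "A \<in> carrier_mat 4 4" for A k l
    using that unfolding P_def char_poly_matrix_def by auto
  have "P ?L * P ?L' = qq \<cdot>\<^sub>m 1\<^sub>m 4"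
  proof (rule eq_matI)
    fix k l assume "k < dim_row (qq \<cdot>\<^sub>m 1\<^sub>m 4)" "l < dim_col (qq \<cdot>\<^sub>m 1\<^sub>m 4)"
    then have kl: "k < 4" "l < 4" by auto
    let ?X = "[:0,1:] :: 'k poly" and ?d = "\<lambda>k l::nat. if k = l then 1 else (0::'k poly)"
    have "(P ?L * P ?L') $$ (k,l) = (\<Sum>s<4. (?X * ?d k s - [:?L $$ (k,s):]) * (?X * ?d s l - [:?L' $$ (s,l):]))"
      using kl by (subst mult_mat_index[OF Pc[OF Lc] Pc[OF Lc']]) (auto simp: Pi[OF Lc] Pi[OF Lc'])
    also have "\<dots> = ?X * (?X * ?d k l) - ?X * [:?L' $$ (k,l):] - ?X * [:?L $$ (k,l):]
        + [:\<Sum>s<4. ?L $$ (k,s) * ?L' $$ (s,l):]"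
      unfolding sum_delta_product[OF kl] by (simp add: sum_const_poly mult.commute)
    also have "(\<Sum>s<4. ?L $$ (k,s) * ?L' $$ (s,l)) = (if k = l then nrm x else 0)"
      unfolding left_mult_mat_mult_index[OF kl] mult_qconj by (rule left_mult_mat_scalar[OF kl])
    also have "?X * (?X * ?d k l) - ?X * [:?L' $$ (k,l):] - ?X * [:?L $$ (k,l):] + [:if k = l then nrm x else 0:] =
        ?X * (?X * ?d k l) - ?X * [:?L $$ (k,l) + ?L' $$ (k,l):] + [:if k = l then nrm x else 0:]"
      by (simp add: algebra_simps)
    also have "?L $$ (k,l) + ?L' $$ (k,l) = left_mult_mat emb (x + qconj x) $$ (k,l)"
      using kl by (simp add: left_mult_mat_index coord_add distrib_right)
    also have "\<dots> = (if k = l then 2 * q0 x else 0)"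
      unfolding add_qconj by (rule left_mult_mat_scalar[OF kl])
    finally show "(P ?L * P ?L') $$ (k,l) = (qq \<cdot>\<^sub>m 1\<^sub>m 4) $$ (k,l)"
      using kl by (simp add: qq_def)
  qed (use Pc[OF Lc] Pc[OF Lc'] in auto)
  then have "det (P ?L) * det (P ?L') = qq ^ 4"
    using det_mult[OF Pc[OF Lc] Pc[OF Lc']] by simp
  then have "char_poly ?L * char_poly ?L = (qq ^ 2) * (qq ^ 2)"
    using char_poly_left_mult_mat_qconj[of x] unfolding char_poly_def P_def by (simp flip: power_add)
  then have "char_poly ?L ^ 2 = (qq ^ 2) ^ 2" by (simp add: power2_eq_square)
  then have "char_poly ?L = qq ^ 2 \<or> char_poly ?L = - (qq ^ 2)" by (rule power2_eq_iff[THEN iffD1])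
  moreover have "char_poly ?L \<noteq> - (qq ^ 2)"
  proof
    assume e: "char_poly ?L = - (qq ^ 2)"
    have "lead_coeff (char_poly ?L) = 1" using degree_monic_char_poly[OF Lc] by auto
    moreover have "lead_coeff (- (qq ^ 2)) = - 1" by (simp add: lead_coeff_minus lead_coeff_power qq_def)
    ultimately have "(1::'k) = -1" unfolding e by simp
    then show False using two by (metis add.right_inverse one_add_one)
  qed
  ultimately show ?thesis by (simp add: qq_def)
qed

text \<open>A square determines the quadratic up to sign and monicity fixes the sign, so the
  description in \<open>Nrd\<close> has a unique solution.\<close>

lemma Nrd_eq_nrm: "Nrd emb x = nrm x"
  unfolding Nrd_def char_poly_left_mult_mat
proof (rule the_equality)
  fix n assume "\<exists>t. [:nrm x, - (2 * q0 x), 1:] ^ 2 = [:n, - t, 1:] ^ 2"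
  then obtain t where "[:nrm x, - (2 * q0 x), 1:] = [:n, - t, 1:] \<or> [:nrm x, - (2 * q0 x), 1:] = - [:n, - t, 1:]"
    using power2_eq_iff by blast
  moreover have "(1::'k) \<noteq> - 1" using two by (metis add.right_inverse one_add_one)
  ultimately show "n = nrm x" by auto
qed auto

end

section \<open>The Cayley transform\<close>

text \<open>All constants of the argument are absorbed into powers of \<open>\<pi>\<^sup>\<kappa>\<close>.\<close>
locale quaternion_lattice = quaternion_basis emb i j a b + discrete_valued_field v \<pi>
  for emb :: "'k::field \<Rightarrow> 'd::ring_1" and i j a b and v :: "'k \<Rightarrow> real" and \<pi> +
  fixes \<kappa> :: nat
  assumes va: "v a \<le> 1" and vb: "v b \<le> 1"
    and v2_ge: "v \<pi> ^ \<kappa> \<le> v 2" and va_ge: "v \<pi> ^ \<kappa> \<le> v a" and vb_ge: "v \<pi> ^ \<kappa> \<le> v b"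
begin

abbreviation w :: real where "w \<equiv> v \<pi>"

lemma w_pow_pos [simp]: "0 < w ^ n" using pi_pos by simp

lemma w_pow_mono: "m \<le> n \<Longrightarrow> w ^ n \<le> w ^ m"
  using pi_pos pi_less by (intro power_decreasing) auto

lemma w_pow_strict: "m < n \<Longrightarrow> w ^ n < w ^ m"
  using pi_pos pi_less by (intro power_strict_decreasing) auto

definition N :: "'d \<Rightarrow> real" where
  "N x = max (max (v (q0 x)) (v (q1 x))) (max (v (q2 x)) (v (q3 x)))"

lemma N_le_iff: "N x \<le> C \<longleftrightarrow> v (q0 x) \<le> C \<and> v (q1 x) \<le> C \<and> v (q2 x) \<le> C \<and> v (q3 x) \<le> C"
  by (auto simp: N_def)

lemma v_le_N: "v (q0 x) \<le> N x" "v (q1 x) \<le> N x" "v (q2 x) \<le> N x" "v (q3 x) \<le> N x"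
  using N_le_iff[of x "N x"] by auto

lemma N_nonneg [simp]: "0 \<le> N x"
  using v_le_N(1)[of x] v_nonneg[of "q0 x"] by linarith

lemma N_add: "N (x + y) \<le> max (N x) (N y)"
  unfolding N_le_iff[of "x + y"] q_add
  by (intro conjI order_trans[OF v_add] max.mono v_le_N)

lemma N_minus [simp]: "N (- x) = N x"
  by (simp add: N_def)

lemma N_diff: "N (x - y) \<le> max (N x) (N y)"
  using N_add[of x "- y"] by simp

lemma N_diff_commute: "N (x - y) = N (y - x)"
  using N_minus[of "x - y"] by simp

lemma N_add_le: "N x \<le> C \<Longrightarrow> N y \<le> C \<Longrightarrow> N (x + y) \<le> C"
  using N_add[of x y] by simp

lemma N_diff_le: "N x \<le> C \<Longrightarrow> N y \<le> C \<Longrightarrow> N (x - y) \<le> C"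
  using N_diff[of x y] by simp

lemma v_add_le: "v x \<le> C \<Longrightarrow> v y \<le> C \<Longrightarrow> v (x + y) \<le> C"
  using v_add[of x y] by simp

lemma v_diff_le: "v x \<le> C \<Longrightarrow> v y \<le> C \<Longrightarrow> v (x - y) \<le> C"
  using v_diff[of x y] by simp

text \<open>As \<open>a\<close> and \<open>b\<close> are integral, so are all structure constants of
  the basis.\<close>

lemma N_mult: "N (x * y) \<le> N x * N y"
proof -
  have vm: "v (s * t) \<le> N x * N y" if "v s \<le> N x" "v t \<le> N y" for s t
    unfolding v_mult using that by (intro mult_mono) auto
  have vc: "v (c * s) \<le> v s" if "v c \<le> 1" for c s
    unfolding v_mult using that by (intro mult_left_le_one_le) auto
  have vab: "v (a * b) \<le> 1" using va vb by (simp add: v_mult mult_le_one)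
  have vm': "v (c * s * t) \<le> N x * N y" if "v s \<le> N x" "v t \<le> N y" "v c \<le> 1" for c s t
    using order_trans[OF vc[OF that(3)] vm[OF that(1,2)]] by (simp add: mult.assoc)
  show ?thesis
    unfolding N_le_iff q_mult
    by (intro conjI v_add_le v_diff_le vm vm' v_le_N va vb vab)
qed

lemma N_smult: "N (emb c * x) = v c * N x"
  by (simp add: N_def v_mult max_mult_distrib_left)

lemma N_emb [simp]: "N (emb c) = v c"
  by (simp add: N_def)

lemma N_zero [simp]: "N 0 = 0"
  by (simp add: N_def)

lemma N_one [simp]: "N 1 = 1"
  by (simp add: N_def)

lemma N_mult_le: "N x \<le> A \<Longrightarrow> N y \<le> B \<Longrightarrow> N (x * y) \<le> A * B"
  using mult_mono[of "N x" A "N y" B] order_trans[OF N_nonneg[of x]] by (intro order_trans[OF N_mult]) auto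

lemma N_le_one_mult: "N x \<le> 1 \<Longrightarrow> N y \<le> C \<Longrightarrow> N (x * y) \<le> C" "N x \<le> C \<Longrightarrow> N y \<le> 1 \<Longrightarrow> N (x * y) \<le> C"
  using N_mult_le[of x 1 y C] N_mult_le[of x C y 1] by auto

definition pure :: "'d \<Rightarrow> bool" where "pure y \<longleftrightarrow> q0 y = 0"

text \<open>On pure quaternions this is \<open>- nrm y\<close>, the scalar equal to
  \<open>y * y\<close>.\<close>

definition sq :: "'d \<Rightarrow> 'k" where
  "sq y = a * (q1 y)\<^sup>2 + b * (q2 y)\<^sup>2 - a * b * (q3 y)\<^sup>2"

lemma pure_sq: "pure y \<Longrightarrow> y * y = emb (sq y)"
  by (rule q_eqI) (simp_all add: pure_def q_mult sq_def power2_eq_square algebra_simps)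

lemma pure_add: "pure x \<Longrightarrow> pure y \<Longrightarrow> pure (x + y)" and pure_minus: "pure x \<Longrightarrow> pure (- x)"
  and pure_diff: "pure x \<Longrightarrow> pure y \<Longrightarrow> pure (x - y)" and pure_smult: "pure x \<Longrightarrow> pure (emb c * x)"
  and pure_zero: "pure 0"
  by (auto simp: pure_def)

lemma sq_minus [simp]: "sq (- y) = sq y"
  by (simp add: sq_def)

lemma v_sq_le: "pure y \<Longrightarrow> v (sq y) \<le> N y * N y"
  using N_mult[of y y] by (simp add: pure_sq)

lemma v_sq_less_one: "pure y \<Longrightarrow> N y < 1 \<Longrightarrow> v (sq y) < 1"
  using v_sq_le[of y] mult_strict_mono[of "N y" 1 "N y" 1] by simp

lemma v_one_minus_sq:
  assumes "pure y" "N y < 1" shows "v (1 - sq y) = 1"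
proof -
  have "v ((1 - sq y) - 1) < v 1" using v_sq_less_one[OF assms] by simp
  from v_eq_of_less[OF this] show ?thesis by simp
qed

text \<open>The inverse of \<open>1 - y\<close> for pure \<open>y\<close> with
  \<open>N y < 1\<close>: the product of \<open>1 - y\<close> and \<open>1 + y\<close> is the scalar
  \<open>1 - sq y\<close>.\<close>

definition inv1 :: "'d \<Rightarrow> 'd" where
  "inv1 y = emb (1 / (1 - sq y)) * (1 + y)"

definition cay :: "'d \<Rightarrow> 'd" where
  "cay y = (1 + y) * inv1 y"

lemma inv1:
  assumes "pure y" "N y < 1"
  shows "inv1 y * (1 - y) = 1" "(1 - y) * inv1 y = 1" "N (inv1 y) \<le> 1"
proof -
  have nz: "1 - sq y \<noteq> 0" using v_one_minus_sq[OF assms] by auto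
  have p: "(1 + y) * (1 - y) = emb (1 - sq y)" "(1 - y) * (1 + y) = emb (1 - sq y)"
    using pure_sq[OF assms(1)] by (simp_all add: algebra_simps emb_diff)
  show "inv1 y * (1 - y) = 1" using nz by (simp add: inv1_def mult.assoc p flip: emb_mult)
  show "(1 - y) * inv1 y = 1" using nz by (simp add: inv1_def emb_comm_left[of "1 - y"] p flip: emb_mult)
  have "N (1 + y) \<le> 1" using assms by (intro N_add_le) auto
  then show "N (inv1 y) \<le> 1"
    unfolding inv1_def N_smult using v_one_minus_sq[OF assms] by (simp add: v_divide)
qed

lemma inv1_minus:
  assumes "pure y" "N y < 1"
  shows "inv1 (- y) * (1 + y) = 1" "(1 + y) * inv1 (- y) = 1" "N (inv1 (- y)) \<le> 1"
  using inv1[of "- y"] assms pure_minus by auto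

lemma N_inv1_minus_one:
  assumes "pure y" "N y < 1" shows "N (inv1 y - 1) \<le> N y"
proof -
  have "inv1 y - 1 = inv1 y * y" using inv1(1)[OF assms] by (simp add: right_diff_distrib algebra_simps)
  then show ?thesis using N_le_one_mult(1)[OF inv1(3)[OF assms], of y "N y"] by simp
qed

text \<open>The resolvent identity; it makes \<open>inv1\<close>, and with it \<open>cay\<close>,
  Lipschitz with constant 1.\<close>

lemma inv1_diff:
  assumes "pure y" "N y < 1" "pure z" "N z < 1"
  shows "inv1 y - inv1 z = inv1 y * (y - z) * inv1 z"
proof -
  have "inv1 y * (y - z) * inv1 z = inv1 y * ((1 - z) - (1 - y)) * inv1 z" by simp
  also have "\<dots> = inv1 y * ((1 - z) * inv1 z) - (inv1 y * (1 - y)) * inv1 z"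
    by (simp only: right_diff_distrib left_diff_distrib mult.assoc)
  finally show ?thesis using inv1[OF assms(1,2)] inv1[OF assms(3,4)] by simp
qed

lemma N_inv1_diff:
  assumes "pure y" "N y < 1" "pure z" "N z < 1"
  shows "N (inv1 y - inv1 z) \<le> N (y - z)"
  unfolding inv1_diff[OF assms]
  by (intro N_le_one_mult inv1 assms) auto

text \<open>As an affine function of the resolvent \<open>inv1\<close>, the Cayley transform
  inherits its estimates and commutator identities.\<close>

lemma cay_eq:
  assumes "pure y" "N y < 1"
  shows "cay y = emb 2 * inv1 y - 1"
proof -
  have e2: "emb 2 = 1 + (1::'d)" using emb_add[of 1 1] by simp
  have "1 + y = emb 2 - (1 - y)" by (simp only: eq_diff_eq e2) simp
  then have "cay y = (emb 2 - (1 - y)) * inv1 y" by (simp only: cay_def)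
  then show ?thesis using inv1(2)[OF assms] by (simp add: left_diff_distrib)
qed

lemma q0_cay: "pure y \<Longrightarrow> q0 (cay y) = (1 + sq y) / (1 - sq y)"
proof -
  assume "pure y"
  then have "q0 ((1 + y) * (1 + y)) = 1 + sq y"
    by (simp add: q_mult pure_def sq_def power2_eq_square algebra_simps)
  then show ?thesis by (simp add: cay_def inv1_def emb_comm_left[of "1 + y"])
qed

lemma cay_zero [simp]: "cay 0 = 1"
  by (simp add: cay_def inv1_def sq_def)

lemma qconj_cay: "pure y \<Longrightarrow> qconj (cay y) = cay (- y)"
  by (rule q_eqI; simp add: cay_def inv1_def emb_comm_left[of "1 + y"] emb_comm_left[of "1 - y"]
      q_mult pure_def sq_def power2_eq_square algebra_simps)

lemma cay_minus_mult:
  assumes "pure y" "N y < 1"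
  shows "cay y * cay (- y) = 1" "cay (- y) * cay y = 1"
proof -
  have c: "(1 + y) * (1 - y) = (1 - y) * (1 + y)" by (simp add: algebra_simps)
  have comm: "inv1 y * (1 + y) = (1 + y) * inv1 y"
    by (simp add: inv1_def emb_comm_left[of "1 + y"] mult.assoc)
  have "cay y * cay (- y) = (1 + y) * (inv1 y * (1 - y)) * inv1 (- y)" by (simp add: cay_def mult.assoc)
  then show 1: "cay y * cay (- y) = 1" using inv1(1)[OF assms] inv1_minus(2)[OF assms] by simp
  have "cay (- y) * cay y = (1 - y) * (inv1 (- y) * (1 + y)) * inv1 y" by (simp add: cay_def mult.assoc)
  then show "cay (- y) * cay y = 1" using inv1(2)[OF assms] inv1_minus(1)[OF assms] by simp
qed

lemma nrm_cay: "pure y \<Longrightarrow> N y < 1 \<Longrightarrow> nrm (cay y) = 1"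
  using mult_qconj(1)[of "cay y"] qconj_cay[of y] cay_minus_mult(1)[of y] emb_eq_iff[of "nrm (cay y)" 1] by simp

lemma N_two_le: "N (emb 2 * x) \<le> N x"
  unfolding N_smult using v_numeral_le by (intro mult_left_le_one_le) auto

lemma N_cay_diff:
  assumes "pure y" "N y < 1" "pure z" "N z < 1"
  shows "N (cay y - cay z) \<le> N (y - z)"
proof -
  have "cay y - cay z = emb 2 * (inv1 y - inv1 z)"
    using cay_eq[OF assms(1,2)] cay_eq[OF assms(3,4)] by (simp add: right_diff_distrib)
  then show ?thesis using order_trans[OF N_two_le N_inv1_diff[OF assms]] by simp
qed

lemma N_cay_minus_one: "pure y \<Longrightarrow> N y < 1 \<Longrightarrow> N (cay y - 1) \<le> N y"
  using N_cay_diff[of y 0] pure_zero by simp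

lemma N_cay_le_one: "pure y \<Longrightarrow> N y < 1 \<Longrightarrow> N (cay y) \<le> 1"
  using N_add_le[of "cay y - 1" 1 1] N_cay_minus_one[of y] by simp

text \<open>The remainder is \<open>2 * (inv1 y - 1) * y\<close>, and \<open>inv1 y - 1\<close> is
  itself of size at most \<open>N y\<close>.\<close>

lemma N_cay_second_order:
  assumes "pure y" "N y < 1"
  shows "N (cay y - 1 - emb 2 * y) \<le> N y * N y"
proof -
  have "cay y - 1 - emb 2 * y = emb 2 * ((inv1 y - 1) * y)"
  proof -
    have "inv1 y - 1 = inv1 y * y" using inv1(1)[OF assms] by (simp add: right_diff_distrib algebra_simps)
    moreover have "cay y - 1 = emb 2 * (inv1 y - 1)"
      using cay_eq[OF assms] emb_add[of 1 1] by (simp add: right_diff_distrib)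
    ultimately have "cay y - 1 = emb 2 * (inv1 y * y)" by simp
    then show ?thesis by (simp add: left_diff_distrib right_diff_distrib)
  qed
  then show ?thesis
    using order_trans[OF N_two_le N_mult_le[OF N_inv1_minus_one[OF assms] order_refl[of "N y"]]] by simp
qed

text \<open>Each factor is \<open>1 + 2 * y\<close> up to second order, so multiplication becomes
  addition with error \<open>r * r\<close>. On the ball of radius \<open>w ^ l\<close> with
  \<open>2 * l\<close> at least \<open>m + \<kappa>\<close> this error will be invisible at level
  \<open>m\<close>.\<close>

lemma N_cay_mult:
  assumes y: "pure y" "N y \<le> r" and z: "pure z" "N z \<le> r" and r: "r < 1"
  shows "N (cay y * cay z - cay (y + z)) \<le> r * r"
proof -
  have r0: "0 \<le> r" using y(2) N_nonneg[of y] by linarith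
  have yz: "pure (y + z)" "N (y + z) \<le> r" using y z by (auto intro: pure_add N_add_le)
  define e where "e u = cay u - 1 - emb 2 * u" for u
  have e: "N (e u) \<le> r * r" if "pure u" "N u \<le> r" for u
    using N_cay_second_order[of u] that r mult_mono[OF that(2,2)] r0 unfolding e_def by force
  have "cay y * cay z - cay (y + z) = e y + e z - e (y + z) + (cay y - 1) * (cay z - 1)"
    by (simp add: e_def algebra_simps)
  moreover have "N ((cay y - 1) * (cay z - 1)) \<le> r * r"
    using N_cay_minus_one[of y] N_cay_minus_one[of z] y z r by (intro N_mult_le) auto
  moreover have "N (e y + e z - e (y + z)) \<le> r * r" using e y z yz by (intro N_add_le N_diff_le) auto
  ultimately show ?thesis using N_add_le by metis
qed

lemma q0_mult_commute: "q0 (x * y) = q0 (y * x)"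
  by (simp add: q_mult algebra_simps)

text \<open>\<open>cay z\<close> is a polynomial in \<open>z\<close> divided by the scalar
  \<open>1 - sq z\<close>, and conjugation preserves \<open>sq\<close>.\<close>

lemma conj_cay:
  assumes "pure z" "g' * g = 1" "g * g' = 1"
  shows "pure (g * z * g')" "g * cay z * g' = cay (g * z * g')"
proof -
  have "q0 (g * z * g') = q0 (g' * (g * z))" by (rule q0_mult_commute)
  also have "\<dots> = q0 z" using assms by (simp flip: mult.assoc)
  finally show p: "pure (g * z * g')" using assms(1) by (simp add: pure_def)
  have "(g * z * g') * (g * z * g') = g * z * (g' * g) * z * g'" by (simp add: mult.assoc)
  also have "\<dots> = g * (z * z) * g'" using assms by (simp add: mult.assoc)
  also have "\<dots> = emb (sq z)" using pure_sq[OF assms(1)] assms(3) by (simp add: emb_comm[of g] mult.assoc)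
  finally have s: "sq (g * z * g') = sq z" using pure_sq[OF p] by simp
  have lin: "g * (1 + z) * g' = 1 + g * z * g'" using assms(3) by (simp add: distrib_left distrib_right)
  have "cay z = emb (1 / (1 - sq z)) * ((1 + z) * (1 + z))"
    by (simp add: cay_def inv1_def emb_comm_left[of "1 + z"])
  then have "g * cay z * g' = emb (1 / (1 - sq z)) * (g * ((1 + z) * (1 + z)) * g')"
    by (simp add: emb_comm_left[of g] mult.assoc)
  also have "g * ((1 + z) * (1 + z)) * g' = (g * (1 + z) * g') * (g * (1 + z) * g')"
  proof -
    have "(g * (1 + z) * g') * (g * (1 + z) * g') = g * (1 + z) * (g' * g) * ((1 + z) * g')" by (simp only: mult.assoc)
    then show ?thesis using assms(2) by (simp add: mult.assoc)
  qed
  also have "emb (1 / (1 - sq z)) * \<dots> = cay (g * z * g')"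
    unfolding lin cay_def inv1_def s by (simp add: emb_comm_left[of "1 + g * z * g'"])
  finally show "g * cay z * g' = cay (g * z * g')" .
qed

section \<open>Displacement under conjugation by a Cayley element\<close>

definition comm :: "'d \<Rightarrow> 'd \<Rightarrow> 'd" where "comm x y = x * y - y * x"

text \<open>Half the displacement of \<open>z\<close> under conjugation by \<open>cay Y\<close>,
  with reversed sign; to first order in \<open>Y\<close> it is the commutator.\<close>

definition hc :: "'d \<Rightarrow> 'd \<Rightarrow> 'd" where "hc Y z = inv1 (- Y) * comm Y z * inv1 Y"

text \<open>Up to sign, the commutator of \<open>z\<close> with the resolvent is the commutator of
  \<open>Y\<close> and \<open>z\<close> multiplied by the resolvent on both sides;
  \<open>cay_eq\<close> carries this over to \<open>cay Y\<close>.\<close>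

lemma conj_by_cay:
  assumes Y: "pure Y" "N Y < 1"
  shows "cay (- Y) * z * cay Y = z - emb 2 * hc Y z"
proof -
  let ?P = "inv1 Y" and ?R = "inv1 (- Y)"
  note P = inv1[OF Y] and R = inv1_minus[OF Y]
  have "z * ?P - ?P * z = ?P * ((1 - Y) * z - z * (1 - Y)) * ?P"
  proof -
    have "?P * ((1 - Y) * z - z * (1 - Y)) * ?P = (?P * (1 - Y)) * z * ?P - ?P * z * ((1 - Y) * ?P)"
      by (simp only: right_diff_distrib left_diff_distrib mult.assoc)
    then show ?thesis using P by simp
  qed
  also have "(1 - Y) * z - z * (1 - Y) = - comm Y z" by (simp add: comm_def algebra_simps)
  finally have zP: "z * ?P - ?P * z = - (?P * comm Y z * ?P)" by simp
  have comm_zc: "z * cay Y - cay Y * z = emb 2 * (z * ?P - ?P * z)"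
    unfolding cay_eq[OF Y] by (simp add: right_diff_distrib left_diff_distrib emb_comm_left[of z] mult.assoc)
  have "cay (- Y) * z * cay Y - z = cay (- Y) * (z * cay Y - cay Y * z)"
    using cay_minus_mult(2)[OF Y] by (simp add: right_diff_distrib flip: mult.assoc)
  also have "\<dots> = - (emb 2 * (cay (- Y) * ?P * comm Y z * ?P))"
    unfolding comm_zc zP by (simp add: emb_comm_left[of "cay (- Y)"] mult.assoc)
  also have "cay (- Y) * ?P = ?R"
  proof -
    have "cay (- Y) = ?R * (1 - Y)"
      by (simp add: cay_def inv1_def emb_comm_left[of "1 - Y"] mult.assoc)
    then show ?thesis using P(2) by (simp add: mult.assoc)
  qed
  finally show ?thesis by (simp add: hc_def algebra_simps)
qed

lemma comm_diff_left: "comm (x - y) z = comm x z - comm y z"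
  by (simp add: comm_def algebra_simps)

lemma N_comm: "N (comm x y) \<le> N x * N y"
  unfolding comm_def using N_mult[of x y] N_mult[of y x] by (intro N_diff_le) (auto simp: mult.commute)

text \<open>Telescoping over the two resolvents. The error is proportional to
  \<open>N (Y - Y')\<close> with an extra factor \<open>r\<close>, so even for close parameters the
  commutator with \<open>Y - Y'\<close> can stay the dominant term.\<close>

lemma hc_lipschitz:
  assumes Y: "pure Y" "N Y \<le> r" and Y': "pure Y'" "N Y' \<le> r" and r: "r < 1"
  shows "N (hc Y z - hc Y' z - comm (Y - Y') z) \<le> r * N (Y - Y') * N z"
proof -
  have lt: "N Y < 1" "N Y' < 1" using Y Y' r by auto
  have r0: "0 \<le> r" using Y(2) N_nonneg[of Y] by linarith
  let ?P = "inv1 Y" and ?R = "inv1 (- Y)" and ?P' = "inv1 Y'" and ?R' = "inv1 (- Y')"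
  let ?D = "N (Y - Y')"
  note P = inv1[OF Y(1) lt(1)] and R = inv1_minus[OF Y(1) lt(1)]
  note P' = inv1[OF Y'(1) lt(2)] and R' = inv1_minus[OF Y'(1) lt(2)]
  have dP: "N (?P - ?P') \<le> ?D" using N_inv1_diff[OF Y(1) lt(1) Y'(1) lt(2)] .
  have dR: "N (?R - ?R') \<le> ?D"
    using N_inv1_diff[of "- Y" "- Y'"] Y Y' lt pure_minus N_diff_commute[of Y' Y] by (simp add: add.commute)
  have cY: "N (comm Y z) \<le> r * N z"
    using order_trans[OF N_comm mult_right_mono[OF Y(2)]] by simp
  have cD: "N (comm (Y - Y') z) \<le> ?D * N z" by (rule N_comm)
  have P1: "N (?P' - 1) \<le> r" using N_inv1_minus_one[OF Y'(1) lt(2)] Y' by linarith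
  have R1: "N (?R' - 1) \<le> r" using N_inv1_minus_one[of "- Y'"] pure_minus[OF Y'(1)] lt(2) Y'(2) by simp
  let ?B = "r * ?D * N z"
  have 1: "N ((?R - ?R') * comm Y z * ?P) \<le> ?B"
    using N_mult_le[OF N_mult_le[OF dR cY] P(3)] by (simp add: mult_ac)
  have 2: "N (?R' * comm Y z * (?P - ?P')) \<le> ?B"
    using N_mult_le[OF N_mult_le[OF R'(3) cY] dP] by (simp add: mult_ac)
  have 3: "N ((?R' - 1) * comm (Y - Y') z * ?P') \<le> ?B"
    using N_mult_le[OF N_mult_le[OF R1 cD] P'(3)] by (simp add: mult_ac)
  have 4: "N (comm (Y - Y') z * (?P' - 1)) \<le> ?B"
    using N_mult_le[OF cD P1] by (simp add: mult_ac)
  have "hc Y z - hc Y' z - comm (Y - Y') z =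
     (?R - ?R') * comm Y z * ?P + ?R' * comm Y z * (?P - ?P')
     + ((?R' - 1) * comm (Y - Y') z * ?P' + comm (Y - Y') z * (?P' - 1))"
    unfolding hc_def comm_diff_left by (simp add: algebra_simps)
  then show ?thesis using 1 2 3 4 by (auto intro: N_add_le)
qed

text \<open>For reduced norm 1 this is \<open>(x - 1) / (x + 1)\<close>: extending the fraction by
  \<open>qconj x + 1\<close> gives \<open>x - qconj x\<close> over \<open>2 * (1 + q0 x)\<close>,
  which is visibly pure.\<close>

definition uncay :: "'d \<Rightarrow> 'd" where
  "uncay x = emb (1 / (1 + q0 x)) * (x - emb (q0 x))"

text \<open>\<open>1 + q0 x\<close> differs from 2 by less than the size of 2, so it has the value
  \<open>v 2\<close>, and dividing by it costs the exponent \<open>\<kappa>\<close>. The last claim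
  rests on \<open>sq (uncay x) = (q0 x - 1) / (1 + q0 x)\<close>.\<close>

lemma uncay:
  assumes x: "nrm x = 1" and small: "N (x - 1) \<le> w ^ s" and s: "2 * \<kappa> < s"
  shows "pure (uncay x)" "N (uncay x) \<le> w ^ (s - \<kappa>)" "cay (uncay x) = x"
proof -
  have "v (q0 x - 1) \<le> w ^ s" using v_le_N(1)[of "x - 1"] small by simp
  also have "\<dots> < w ^ \<kappa>" using s by (intro w_pow_strict) simp
  also have "\<dots> \<le> v 2" by (rule v2_ge)
  finally have "v ((1 + q0 x) - 2) < v 2" by (simp add: algebra_simps)
  then have v1: "v (1 + q0 x) = v 2" by (rule v_eq_of_less)
  then have nz: "1 + q0 x \<noteq> 0" using two by (metis v_zero_iff)
  show p: "pure (uncay x)" by (simp add: uncay_def pure_def)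
  have "N (x - emb (q0 x)) \<le> N (x - 1)" by (auto simp: N_le_iff v_le_N) (use v_le_N[of "x - 1"] in auto)
  then have "N (uncay x) \<le> w ^ s / v 2"
    unfolding uncay_def N_smult using small two v1 by (simp add: v_divide field_simps v_pos_iff)
  also have "\<dots> \<le> w ^ s / w ^ \<kappa>"
    using v2_ge w_pow_pos two by (intro divide_left_mono) (auto simp: v_pos_iff)
  also have "\<dots> = w ^ (s - \<kappa>)" using s pi_pos by (simp add: power_diff)
  finally show b: "N (uncay x) \<le> w ^ (s - \<kappa>)" .
  have sqx: "sq (x - emb (q0 x)) = (q0 x)\<^sup>2 - 1" using x by (simp add: sq_def nrm_def algebra_simps)
  have "sq (uncay x) = sq (x - emb (q0 x)) / (1 + q0 x)\<^sup>2"
    unfolding sq_def uncay_def by (simp add: power_divide add_divide_distrib diff_divide_distrib)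
  also have "\<dots> = (q0 x - 1) / (1 + q0 x)"
  proof -
    have "(q0 x)\<^sup>2 - 1 = (q0 x - 1) * (1 + q0 x)" by (simp add: power2_eq_square algebra_simps)
    then show ?thesis unfolding sqx power2_eq_square[of "1 + q0 x"] using nz by simp
  qed
  finally have sq: "sq (uncay x) = (q0 x - 1) / (1 + q0 x)" .
  have om: "1 / (1 - sq (uncay x)) = (1 + q0 x) / 2" unfolding sq using nz two by (simp add: field_simps)
  have op: "1 + sq (uncay x) = 2 * q0 x / (1 + q0 x)" unfolding sq using nz by (simp add: field_simps)
  have "cay (uncay x) = emb (1 / (1 - sq (uncay x))) * ((1 + uncay x) * (1 + uncay x))"
    by (simp add: cay_def inv1_def emb_comm_left[of "1 + uncay x"])
  also have "(1 + uncay x) * (1 + uncay x) = emb (1 + sq (uncay x)) + emb 2 * uncay x"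
    using pure_sq[OF p] emb_add[of 1 1] by (simp add: algebra_simps emb_add mult_2)
  also have "emb (1 / (1 - sq (uncay x))) * \<dots> = emb (q0 x) + (x - emb (q0 x))"
  proof -
    have "t / 2 * (2 * s / t) = s \<and> t / 2 * 2 * (1 / t) = 1" if "t \<noteq> 0" for s t :: 'k
      using that two by simp
    then have k1: "(1 + q0 x) / 2 * (2 * q0 x / (1 + q0 x)) = q0 x"
      and k2: "(1 + q0 x) / 2 * 2 * (1 / (1 + q0 x)) = 1" using nz by blast+
    show ?thesis unfolding om op unfolding uncay_def distrib_left
      by (simp only: emb_mult[symmetric] mult.assoc[symmetric] k1 k2) simp
  qed
  finally show "cay (uncay x) = x" by simp
qed

end

section \<open>Congruence quotients\<close>

text \<open>From here on \<open>\<kappa>\<close> also places \<open>D0\<close> between two balls of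
  \<open>N\<close>, and \<open>K\<close> compares \<open>N\<close> with the norm that defines the
  topology.\<close>

locale quaternion_order = quaternion_lattice emb i j a b v \<pi> \<kappa>
  for emb :: "'k::field \<Rightarrow> 'd::ring_1" and i j a b and v :: "'k \<Rightarrow> real" and \<pi> \<kappa> +
  fixes D0 :: "'d set" and K :: real
  assumes D0_one: "1 \<in> D0" and D0_add: "\<And>x y. x \<in> D0 \<Longrightarrow> y \<in> D0 \<Longrightarrow> x + y \<in> D0"
    and D0_minus: "\<And>x. x \<in> D0 \<Longrightarrow> - x \<in> D0" and D0_mult: "\<And>x y. x \<in> D0 \<Longrightarrow> y \<in> D0 \<Longrightarrow> x * y \<in> D0"
    and D0_bound: "\<And>x. x \<in> D0 \<Longrightarrow> v \<pi> ^ \<kappa> * N x \<le> 1"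
    and D0_ball: "\<And>x. N x \<le> v \<pi> ^ \<kappa> \<Longrightarrow> x \<in> D0"
    and K_pos: "K > 0" and N_le_dnorm: "\<And>x. N x \<le> K * dnorm v emb x"
    and dnorm_le_N: "\<And>x. dnorm v emb x \<le> K * N x"
begin

lemma D0_diff: "x \<in> D0 \<Longrightarrow> y \<in> D0 \<Longrightarrow> x - y \<in> D0"
  using D0_add[of x "- y"] D0_minus[of y] by simp

lemma D0_zero: "0 \<in> D0"
  using D0_diff[OF D0_one D0_one] by simp

definition U :: "'d set" where
  "U = units_of_set D0 \<inter> {x. Nrd emb x = 1}"

text \<open>For reduced norm 1 the only possible inverse is the conjugate.\<close>

lemma U_iff: "x \<in> U \<longleftrightarrow> x \<in> D0 \<and> qconj x \<in> D0 \<and> nrm x = 1"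
proof
  assume "x \<in> U"
  then obtain y where y: "x \<in> D0" "y \<in> D0" "x * y = 1" "y * x = 1" "nrm x = 1"
    by (auto simp: U_def units_of_set_def Nrd_eq_nrm)
  have "y = y * (x * qconj x)" using y(5) by (simp add: mult_qconj)
  also have "\<dots> = qconj x" using y(4) by (simp flip: mult.assoc)
  finally show "x \<in> D0 \<and> qconj x \<in> D0 \<and> nrm x = 1" using y by simp
next
  assume "x \<in> D0 \<and> qconj x \<in> D0 \<and> nrm x = 1"
  then show "x \<in> U" using mult_qconj[of x] by (auto simp: U_def units_of_set_def Nrd_eq_nrm)
qed

lemma qconj_qconj [simp]: "qconj (qconj x) = x"
  by (rule q_eqI) auto

lemma nrm_qconj [simp]: "nrm (qconj x) = nrm x"
  by (simp add: nrm_def)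

lemma U_D0: "x \<in> U \<Longrightarrow> x \<in> D0" and U_nrm: "x \<in> U \<Longrightarrow> nrm x = 1"
  by (auto simp: U_iff)

lemma U_one: "1 \<in> U"
proof -
  have "qconj 1 = 1" by (rule q_eqI) auto
  then show ?thesis by (simp add: U_iff D0_one)
qed

lemma U_mult: "x \<in> U \<Longrightarrow> y \<in> U \<Longrightarrow> x * y \<in> U"
  by (auto simp: U_iff qconj_mult nrm_mult D0_mult)

lemma U_qconj: "x \<in> U \<Longrightarrow> qconj x \<in> U"
  by (auto simp: U_iff)

lemma U_inv: "x \<in> U \<Longrightarrow> x * qconj x = 1" "x \<in> U \<Longrightarrow> qconj x * x = 1"
  by (simp_all add: mult_qconj U_nrm)

lemma cay_in_U:
  assumes "pure y" "N y \<le> w ^ s" "\<kappa> \<le> s" "0 < s"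
  shows "cay y \<in> U"
proof -
  have lt: "N y < 1" using assms(2,4) w_pow_strict[of 0 s] by simp
  have D: "cay z \<in> D0" if "pure z" "N z \<le> w ^ s" "N z < 1" for z
  proof -
    have "N (cay z - 1) \<le> w ^ \<kappa>" using N_cay_minus_one[OF that(1,3)] that(2) w_pow_mono[OF assms(3)] by linarith
    then have "cay z - 1 \<in> D0" by (rule D0_ball)
    then show ?thesis using D0_add[OF _ D0_one, of "cay z - 1"] by simp
  qed
  show ?thesis
    unfolding U_iff using D[of y] D[of "- y"] assms lt pure_minus nrm_cay qconj_cay by simp
qed

text \<open>The congruence subgroup of level \<open>m\<close> consists of the \<open>x \<in> U\<close> with \<open>x - 1 \<in> ideal m\<close>.\<close>
definition ideal :: "nat \<Rightarrow> 'd set" where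
  "ideal m = (\<lambda>z. emb (\<pi> ^ m) * z) ` D0"

lemma ideal_zero: "0 \<in> ideal m"
  unfolding ideal_def using D0_zero by (intro image_eqI[of _ _ 0]) auto

lemma ideal_add: "x \<in> ideal m \<Longrightarrow> y \<in> ideal m \<Longrightarrow> x + y \<in> ideal m"
  unfolding ideal_def using D0_add by (auto simp flip: distrib_left)

lemma ideal_minus: "x \<in> ideal m \<Longrightarrow> - x \<in> ideal m"
  unfolding ideal_def using D0_minus by (auto simp flip: mult_minus_right)

lemma ideal_left: "c \<in> D0 \<Longrightarrow> x \<in> ideal m \<Longrightarrow> c * x \<in> ideal m"
  unfolding ideal_def using D0_mult by (auto simp: emb_comm_left[of c])

lemma ideal_right: "c \<in> D0 \<Longrightarrow> x \<in> ideal m \<Longrightarrow> x * c \<in> ideal m"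
  unfolding ideal_def using D0_mult by (auto simp: mult.assoc)

lemma ideal_ball: "N x \<le> w ^ (m + \<kappa>) \<Longrightarrow> x \<in> ideal m"
proof -
  assume le: "N x \<le> w ^ (m + \<kappa>)"
  have "N (emb (1 / \<pi> ^ m) * x) \<le> w ^ \<kappa>"
    unfolding N_smult using le pi_pos by (simp add: v_divide v_power field_simps power_add)
  then have "emb (1 / \<pi> ^ m) * x \<in> D0" by (rule D0_ball)
  moreover have "x = emb (\<pi> ^ m) * (emb (1 / \<pi> ^ m) * x)" by (simp flip: mult.assoc emb_mult)
  ultimately show ?thesis unfolding ideal_def by blast
qed

lemma ideal_bound: "x \<in> ideal m \<Longrightarrow> w ^ \<kappa> * N x \<le> w ^ m"
proof -
  assume "x \<in> ideal m"
  then obtain z where z: "z \<in> D0" "x = emb (\<pi> ^ m) * z" by (auto simp: ideal_def)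
  have "w ^ \<kappa> * N x = w ^ m * (w ^ \<kappa> * N z)" by (simp add: z(2) N_smult v_power)
  also have "\<dots> \<le> w ^ m * 1" using D0_bound[OF z(1)] by (intro mult_left_mono) auto
  finally show ?thesis by simp
qed

lemma ideal_bound': "x \<in> ideal (m + \<kappa>) \<Longrightarrow> N x \<le> w ^ m"
  using ideal_bound[of x "m + \<kappa>"] by (simp add: power_add mult.commute)

lemma ideal_minus_commute: "x - y \<in> ideal m \<longleftrightarrow> y - x \<in> ideal m"
  using ideal_minus[of "x - y" m] ideal_minus[of "y - x" m] by auto

lemma ideal_trans: "x - y \<in> ideal m \<Longrightarrow> y - z \<in> ideal m \<Longrightarrow> x - z \<in> ideal m"
  using ideal_add[of "x - y" m "y - z"] by simp

lemma ideal_mult: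
  assumes "x \<in> U" "x' \<in> U" "y \<in> U" "y' \<in> U" "x - x' \<in> ideal m" "y - y' \<in> ideal m"
  shows "x * y - x' * y' \<in> ideal m"
proof -
  have "x * y - x' * y' = x * (y - y') + (x - x') * y'" by (simp add: algebra_simps)
  then show ?thesis
    using ideal_add[OF ideal_left[OF U_D0[OF assms(1)] assms(6)] ideal_right[OF U_D0[OF assms(4)] assms(5)]] by simp
qed

text \<open>A transversal of the congruence subgroup of level \<open>m\<close>, containing \<open>1\<close>.\<close>
definition rep :: "nat \<Rightarrow> 'd \<Rightarrow> 'd" where
  "rep m x = (if x - 1 \<in> ideal m then 1 else SOME y. y \<in> U \<and> y - x \<in> ideal m)"

lemma rep: assumes "x \<in> U" shows "rep m x \<in> U" "rep m x - x \<in> ideal m"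
proof -
  have "rep m x \<in> U \<and> rep m x - x \<in> ideal m"
  proof (cases "x - 1 \<in> ideal m")
    case True
    then show ?thesis using U_one ideal_minus_commute[of x 1] by (simp add: rep_def)
  next
    case False
    have "\<exists>y. y \<in> U \<and> y - x \<in> ideal m" using assms ideal_zero by (intro exI[of _ x]) simp
    from someI_ex[OF this] False show ?thesis by (simp add: rep_def)
  qed
  then show "rep m x \<in> U" "rep m x - x \<in> ideal m" by auto
qed

lemma rep_cong: "x - y \<in> ideal m \<Longrightarrow> rep m x = rep m y"
proof -
  assume xy: "x - y \<in> ideal m"
  have "z - x \<in> ideal m \<longleftrightarrow> z - y \<in> ideal m" for z
    using ideal_trans[of z x m y] ideal_trans[of z y m x] xy ideal_minus_commute[of x y] by blast
  moreover have "x - 1 \<in> ideal m \<longleftrightarrow> y - 1 \<in> ideal m"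
    using ideal_trans[of x y m 1] ideal_trans[of y x m 1] xy ideal_minus_commute[of x y] by blast
  ultimately show ?thesis by (simp add: rep_def)
qed

lemma rep_eqD: "x \<in> U \<Longrightarrow> y \<in> U \<Longrightarrow> rep m x = rep m y \<Longrightarrow> x - y \<in> ideal m"
  using rep(2)[of x m] rep(2)[of y m] ideal_trans[of x "rep m x" m y] ideal_minus_commute[of x "rep m x"] by simp

lemma rep_one: "rep m 1 = 1"
  by (simp add: rep_def ideal_zero)

lemma rep_rep: "x \<in> U \<Longrightarrow> rep m (rep m x) = rep m x"
  by (intro rep_cong rep)

text \<open>The quotient by the congruence subgroup, carried by representatives instead of cosets: a
  representation of \<open>U\<close> that is trivial at level \<open>m\<close> is then, without any
  change, a representation of this group.\<close>

definition Grp :: "nat \<Rightarrow> 'd monoid" where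
  "Grp m = \<lparr>carrier = rep m ` U, mult = (\<lambda>x y. rep m (x * y)), one = 1\<rparr>"

lemma Grp_simps: "carrier (Grp m) = rep m ` U" "x \<otimes>\<^bsub>Grp m\<^esub> y = rep m (x * y)" "\<one>\<^bsub>Grp m\<^esub> = 1"
  by (simp_all add: Grp_def)

lemma Grp_U: "x \<in> carrier (Grp m) \<Longrightarrow> x \<in> U"
  using rep by (auto simp: Grp_simps)

lemma rep_Grp: "x \<in> carrier (Grp m) \<Longrightarrow> rep m x = x"
  using rep_rep by (auto simp: Grp_simps)

lemma rep_mult_rep: "x \<in> U \<Longrightarrow> y \<in> U \<Longrightarrow> rep m (rep m x * rep m y) = rep m (x * y)"
  using rep by (intro rep_cong ideal_mult) auto

lemma group_Grp: "group (Grp m)"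
proof (rule groupI)
  show "x \<otimes>\<^bsub>Grp m\<^esub> y \<in> carrier (Grp m)" if "x \<in> carrier (Grp m)" "y \<in> carrier (Grp m)" for x y
    using Grp_U[OF that(1)] Grp_U[OF that(2)] U_mult by (simp add: Grp_simps)
  show "\<one>\<^bsub>Grp m\<^esub> \<in> carrier (Grp m)"
    using U_one rep_one[of m] by (simp add: Grp_simps image_iff) metis
  show "x \<otimes>\<^bsub>Grp m\<^esub> y \<otimes>\<^bsub>Grp m\<^esub> z = x \<otimes>\<^bsub>Grp m\<^esub> (y \<otimes>\<^bsub>Grp m\<^esub> z)"
    if "x \<in> carrier (Grp m)" "y \<in> carrier (Grp m)" "z \<in> carrier (Grp m)" for x y z
  proof -
    have u: "x \<in> U" "y \<in> U" "z \<in> U" using that Grp_U by auto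
    have "rep m (rep m (x * y) * z) = rep m (x * y * z)"
      using rep_mult_rep[of "x * y" z m] rep_Grp[OF that(3)] u U_mult by simp
    moreover have "rep m (x * rep m (y * z)) = rep m (x * (y * z))"
      using rep_mult_rep[of x "y * z" m] rep_Grp[OF that(1)] u U_mult by simp
    ultimately show ?thesis by (simp add: Grp_simps mult.assoc)
  qed
  show "\<one>\<^bsub>Grp m\<^esub> \<otimes>\<^bsub>Grp m\<^esub> x = x" if "x \<in> carrier (Grp m)" for x
    using rep_Grp[OF that] by (simp add: Grp_simps)
  show "\<exists>y\<in>carrier (Grp m). y \<otimes>\<^bsub>Grp m\<^esub> x = \<one>\<^bsub>Grp m\<^esub>" if x: "x \<in> carrier (Grp m)" for x
  proof (intro bexI[of _ "rep m (qconj x)"])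
    have u: "x \<in> U" "qconj x \<in> U" using Grp_U[OF x] U_qconj by auto
    show "rep m (qconj x) \<in> carrier (Grp m)" using u by (simp add: Grp_simps)
    show "rep m (qconj x) \<otimes>\<^bsub>Grp m\<^esub> x = \<one>\<^bsub>Grp m\<^esub>"
      using rep_mult_rep[of "qconj x" x m] rep_Grp[OF x] u U_inv rep_one by (simp add: Grp_simps)
  qed
qed

lemma inv_Grp:
  assumes x: "x \<in> carrier (Grp m)" shows "inv\<^bsub>Grp m\<^esub> x = rep m (qconj x)"
proof -
  interpret group "Grp m" by (rule group_Grp)
  have u: "x \<in> U" "qconj x \<in> U" using Grp_U[OF x] U_qconj by auto
  show ?thesis
  proof (rule inv_equality[OF _ x])
    show "rep m (qconj x) \<otimes>\<^bsub>Grp m\<^esub> x = \<one>\<^bsub>Grp m\<^esub>"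
      using rep_mult_rep[of "qconj x" x m] rep_Grp[OF x] u U_inv rep_one by (simp add: Grp_simps)
    show "rep m (qconj x) \<in> carrier (Grp m)" using u by (simp add: Grp_simps)
  qed
qed

section \<open>Residue systems and the order of the congruence quotient\<close>

definition residues :: "nat \<Rightarrow> 'k set" where
  "residues M = (SOME S. finite S \<and> card S = q ^ M \<and> (\<forall>s\<in>S. v s \<le> 1) \<and>
     (\<forall>x. v x \<le> 1 \<longrightarrow> (\<exists>s\<in>S. v (x - s) \<le> w ^ M)) \<and>
     (\<forall>s\<in>S. \<forall>t\<in>S. v (s - t) \<le> w ^ M \<longrightarrow> s = t))"

lemma residues: "finite (residues M)" "card (residues M) = q ^ M" "s \<in> residues M \<Longrightarrow> v s \<le> 1"
    "v x \<le> 1 \<Longrightarrow> \<exists>s\<in>residues M. v (x - s) \<le> w ^ M"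
    "s \<in> residues M \<Longrightarrow> t \<in> residues M \<Longrightarrow> v (s - t) \<le> w ^ M \<Longrightarrow> s = t"
  using someI_ex[OF residue_system[of M]] unfolding residues_def[symmetric] by blast+

definition red :: "nat \<Rightarrow> 'k \<Rightarrow> 'k" where
  "red M x = (SOME s. s \<in> residues M \<and> v (x - s) \<le> w ^ M)"

lemma red: assumes "v x \<le> 1" shows "red M x \<in> residues M" "v (x - red M x) \<le> w ^ M"
  using someI_ex[of "\<lambda>s. s \<in> residues M \<and> v (x - s) \<le> w ^ M"] residues(4)[OF assms, of M]
  unfolding red_def by blast+

lemma red_eqD: "v x \<le> 1 \<Longrightarrow> v y \<le> 1 \<Longrightarrow> red M x = red M y \<Longrightarrow> v (x - y) \<le> w ^ M"
  using v_diff_le[of "x - red M x" "w ^ M" "y - red M y"] red[of x M] red[of y M] by simp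

text \<open>Each coset of the congruence subgroup of level \<open>s\<close> is parametrised by three coordinates via the
  inverse Cayley transform.\<close>
lemma card_Grp: "finite (carrier (Grp m)) \<and>
  card (carrier (Grp m)) \<le> q ^ (26 * \<kappa> + 4) * q ^ (3 * m)"
proof -
  \<comment> \<open>After the loss of \<open>\<kappa>\<close> in \<open>ideal_bound'\<close> this
    level gives \<open>N (qconj g * x - 1) \<le> w ^ (2 * \<kappa> + 1)\<close>, just inside the
    range of \<open>uncay\<close>.\<close>
  define s where "s = 3 * \<kappa> + 1"
  \<comment> \<open>The four coordinates of \<open>x\<close> only fix the coset of level
    \<open>s\<close>, at a precision independent of \<open>m\<close>; the factor
    \<open>\<pi>^\<kappa>\<close> makes them integral. The part that grows with \<open>m\<close> has
    three coordinates, whence the exponent \<open>3 * m\<close>.\<close>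
  define f where "f x =
     (((red (s + 2*\<kappa>) (\<pi>^\<kappa> * q0 x), red (s + 2*\<kappa>) (\<pi>^\<kappa> * q1 x)),
       (red (s + 2*\<kappa>) (\<pi>^\<kappa> * q2 x), red (s + 2*\<kappa>) (\<pi>^\<kappa> * q3 x))),
      (red (m + 2*\<kappa>) (q1 (uncay (qconj (rep s x) * x))),
       red (m + 2*\<kappa>) (q2 (uncay (qconj (rep s x) * x))),
       red (m + 2*\<kappa>) (q3 (uncay (qconj (rep s x) * x)))))" for x
  let ?A = "residues (s + 2*\<kappa>)" and ?B = "residues (m + 2*\<kappa>)"
  let ?T = "((?A \<times> ?A) \<times> (?A \<times> ?A)) \<times> ?B \<times> ?B \<times> ?B"
  have coord_le: "v (\<pi>^\<kappa> * c) \<le> 1" if "v c \<le> N x" "x \<in> U" for c x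
  proof -
    have "w ^ \<kappa> * v c \<le> w ^ \<kappa> * N x" using that(1) by (intro mult_left_mono) auto
    also have "\<dots> \<le> 1" by (rule D0_bound[OF U_D0[OF that(2)]])
    finally show ?thesis by (simp add: v_mult v_power)
  qed
  have unc: "pure (uncay (qconj (rep s x) * x))" "N (uncay (qconj (rep s x) * x)) < 1"
    "cay (uncay (qconj (rep s x) * x)) = qconj (rep s x) * x" if x: "x \<in> U" for x
  proof -
    let ?g = "rep s x"
    have g: "?g \<in> U" "?g - x \<in> ideal s" using rep[OF x] by auto
    have "qconj ?g * x - 1 = qconj ?g * (x - ?g)" using U_inv[OF g(1)] by (simp add: right_diff_distrib)
    also have "\<dots> \<in> ideal s"
      using g ideal_minus_commute[of x ?g] by (intro ideal_left) (auto simp: U_iff)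
    finally have "qconj ?g * x - 1 \<in> ideal ((2 * \<kappa> + 1) + \<kappa>)" by (simp add: s_def)
    then have n: "N (qconj ?g * x - 1) \<le> w ^ (2 * \<kappa> + 1)" by (rule ideal_bound')
    have u: "nrm (qconj ?g * x) = 1" using g x by (simp add: nrm_mult U_nrm)
    from uncay[OF u n] show "pure (uncay (qconj ?g * x))" "cay (uncay (qconj ?g * x)) = qconj ?g * x"
      by auto
    have "N (uncay (qconj ?g * x)) \<le> w ^ (2 * \<kappa> + 1 - \<kappa>)" using uncay(2)[OF u n] by simp
    also have "\<dots> < 1" using w_pow_strict[of 0 "2 * \<kappa> + 1 - \<kappa>"] by simp
    finally show "N (uncay (qconj ?g * x)) < 1" .
  qed
  have y_le: "v (q1 (uncay (qconj (rep s x) * x))) \<le> 1" "v (q2 (uncay (qconj (rep s x) * x))) \<le> 1"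
    "v (q3 (uncay (qconj (rep s x) * x))) \<le> 1" if "x \<in> U" for x
    using unc(2)[OF that] v_le_N[of "uncay (qconj (rep s x) * x)"] by linarith+
  have sub: "f ` carrier (Grp m) \<subseteq> ?T"
  proof (rule image_subsetI)
    fix x assume "x \<in> carrier (Grp m)"
    then have x: "x \<in> U" by (rule Grp_U)
    note cl = coord_le[OF _ x]
    show "f x \<in> ?T" unfolding f_def
      by (intro SigmaI red(1) cl v_le_N y_le x)
  qed
  have inj: "inj_on f (carrier (Grp m))"
  proof (rule inj_onI)
    fix x x' assume xc: "x \<in> carrier (Grp m)" and xc': "x' \<in> carrier (Grp m)" and eq: "f x = f x'"
    have x: "x \<in> U" and x': "x' \<in> U" using xc xc' Grp_U by auto
    have e: "v (\<pi>^\<kappa> * c - \<pi>^\<kappa> * c') \<le> w ^ (s + 2*\<kappa>)"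
      if "v c \<le> N x" "v c' \<le> N x'" "red (s + 2*\<kappa>) (\<pi>^\<kappa> * c) = red (s + 2*\<kappa>) (\<pi>^\<kappa> * c')" for c c'
      by (rule red_eqD[OF coord_le[OF that(1) x] coord_le[OF that(2) x'] that(3)])
    have "N (emb (\<pi>^\<kappa>) * (x - x')) \<le> w ^ (s + 2*\<kappa>)"
      unfolding N_le_iff q_smult q_diff right_diff_distrib
      using e v_le_N eq unfolding f_def by simp
    then have "w ^ \<kappa> * N (x - x') \<le> w ^ \<kappa> * w ^ (s + \<kappa>)"
      unfolding N_smult by (simp add: v_power mult_2 flip: power_add) (simp add: add_ac)
    then have "N (x - x') \<le> w ^ (s + \<kappa>)" by simp
    then have "x - x' \<in> ideal s" by (rule ideal_ball)
    then have r: "rep s x' = rep s x" by (metis rep_cong)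
    let ?g = "rep s x"
    let ?y = "uncay (qconj ?g * x)" and ?y' = "uncay (qconj ?g * x')"
    have g: "?g \<in> U" using rep[OF x] by auto
    have "N (?y - ?y') \<le> w ^ (m + 2*\<kappa>)"
      using eq y_le[OF x] y_le[OF x'] unc(1)[OF x] unc(1)[OF x'] red_eqD
      unfolding N_le_iff q_diff f_def r pure_def by simp
    then have "N (cay ?y - cay ?y') \<le> w ^ (m + 2*\<kappa>)"
      using N_cay_diff[OF unc(1,2)[OF x] unc(1,2)[OF x', unfolded r]] by linarith
    then have "N (qconj ?g * x - qconj ?g * x') \<le> w ^ ((m + \<kappa>) + \<kappa>)"
      using unc(3)[OF x] unc(3)[OF x'] r by (simp add: mult_2 add.assoc)
    then have "qconj ?g * x - qconj ?g * x' \<in> ideal (m + \<kappa>)" by (rule ideal_ball)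
    then have "qconj ?g * x - qconj ?g * x' \<in> ideal m"
    proof -
      assume "qconj ?g * x - qconj ?g * x' \<in> ideal (m + \<kappa>)"
      then show ?thesis using \<open>N (qconj ?g * x - qconj ?g * x') \<le> w ^ ((m + \<kappa>) + \<kappa>)\<close>
          order_trans[OF _ w_pow_mono[of "m + \<kappa>" "m + \<kappa> + \<kappa>"]] ideal_ball by simp
    qed
    then have "?g * (qconj ?g * x - qconj ?g * x') \<in> ideal m" using U_D0[OF g] by (intro ideal_left)
    moreover have "?g * (qconj ?g * x - qconj ?g * x') = x - x'"
      using U_inv(1)[OF g] by (simp add: right_diff_distrib flip: mult.assoc)
    ultimately have "x - x' \<in> ideal m" by simp
    from rep_cong[OF this] show "x = x'" using rep_Grp xc xc' by simp
  qed
  have finT: "finite ?T" by (intro finite_cartesian_product residues)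
  have "finite (carrier (Grp m))" using inj sub finT by (meson finite_imageD finite_subset)
  moreover have "card (carrier (Grp m)) \<le> card ?T" by (rule card_inj_on_le[OF inj sub finT])
  \<comment> \<open>The exponent is
    \<open>4 * (s + 2 * \<kappa>) + 3 * (m + 2 * \<kappa>)\<close>.\<close>
  moreover have "card ?T = q ^ (26 * \<kappa> + 4) * q ^ (3 * m)"
    by (simp only: card_cartesian_product residues(2) s_def power_add[symmetric])
      (rule arg_cong[of _ _ "\<lambda>n. q ^ n"], simp)
  ultimately show ?thesis by simp
qed

end

section \<open>Continuous representations\<close>

context quaternion_order
begin

definition trivial_at :: "nat \<Rightarrow> nat \<Rightarrow> ('d \<Rightarrow> complex mat) \<Rightarrow> bool" where
  "trivial_at m n \<rho> \<longleftrightarrow> (\<forall>u\<in>U. u - 1 \<in> ideal m \<longrightarrow> \<rho> u = 1\<^sub>m n)"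

lemma cont_repD:
  assumes "cont_rep v emb U n \<rho>"
  shows "g \<in> U \<Longrightarrow> \<rho> g \<in> carrier_mat n n" "\<rho> 1 = 1\<^sub>m n"
    "g \<in> U \<Longrightarrow> h \<in> U \<Longrightarrow> \<rho> (g * h) = \<rho> g * \<rho> h"
  using assms unfolding cont_rep_def by auto

lemma ideal_small:
  assumes "\<epsilon> > 0"
  shows "\<exists>m. \<forall>x\<in>ideal m. dnorm v emb x < \<epsilon>"
proof -
  obtain k where k: "w ^ k \<le> \<epsilon> / (2 * K)" using ex_power_le[of "\<epsilon> / (2 * K)"] assms K_pos by auto
  have "dnorm v emb x < \<epsilon>" if "x \<in> ideal (k + \<kappa>)" for x
  proof -
    have "K * N x \<le> K * (\<epsilon> / (2 * K))"
      using ideal_bound'[OF that] k K_pos by (intro mult_left_mono) auto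
    also have "\<dots> = \<epsilon> / 2" using K_pos by simp
    finally show ?thesis using dnorm_le_N[of x] assms by linarith
  qed
  then show ?thesis by blast
qed

text \<open>The general linear group has no small subgroups, so a continuous representation has open kernel.\<close>
lemma cont_rep_trivial_at:
  assumes \<rho>: "cont_rep v emb U n \<rho>"
  shows "\<exists>m. trivial_at m n \<rho>"
proof -
  define \<epsilon> where "\<epsilon> = 1 / (2 * (real n)\<^sup>2 + 1)"
  have "\<epsilon> > 0" by (simp add: \<epsilon>_def add_nonneg_pos)
  then obtain \<delta> where \<delta>: "\<delta> > 0" "\<And>h i j. h \<in> U \<Longrightarrow> dnorm v emb (h - 1) < \<delta> \<Longrightarrow> i < n \<Longrightarrow> j < n \<Longrightarrow>
      cmod (\<rho> h $$ (i,j) - \<rho> 1 $$ (i,j)) < \<epsilon>"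
    using \<rho> U_one unfolding cont_rep_def by blast
  obtain m where m: "\<And>x. x \<in> ideal m \<Longrightarrow> dnorm v emb x < \<delta>" using ideal_small[OF \<delta>(1)] by blast
  let ?M = "\<rho> ` {u\<in>U. u - 1 \<in> ideal m}"
  have "\<rho> u = 1\<^sub>m n" if u: "u \<in> U" "u - 1 \<in> ideal m" for u
  proof (rule squares_near_one_imp_one[of ?M])
    show "?M \<subseteq> carrier_mat n n" using cont_repD(1)[OF \<rho>] by auto
    show "A * A \<in> ?M" if A: "A \<in> ?M" for A
    proof -
      from A obtain x where x: "x \<in> U" "x - 1 \<in> ideal m" "A = \<rho> x" by auto
      have "x * x - 1 * 1 \<in> ideal m" using x U_one by (intro ideal_mult) auto
      then show ?thesis using x U_mult cont_repD(3)[OF \<rho> x(1,1)] by (intro image_eqI[of _ _ "x * x"]) auto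
    qed
    show "cmod (A $$ (i,j) - 1\<^sub>m n $$ (i,j)) \<le> 1 / (2 * (real n)\<^sup>2 + 1)"
      if A: "A \<in> ?M" and ij: "i < n" "j < n" for A i j
    proof -
      from A obtain x where x: "x \<in> U" "x - 1 \<in> ideal m" "A = \<rho> x" by auto
      have "cmod (\<rho> x $$ (i,j) - \<rho> 1 $$ (i,j)) < \<epsilon>" by (rule \<delta>(2)[OF x(1) m[OF x(2)] ij])
      then show ?thesis unfolding x(3) cont_repD(2)[OF \<rho>] \<epsilon>_def by (rule less_imp_le)
    qed
    show "\<rho> u \<in> ?M" using u by auto
  qed
  then show ?thesis unfolding trivial_at_def by blast
qed

lemma trivial_at_cong:
  assumes \<rho>: "cont_rep v emb U n \<rho>" and t: "trivial_at m n \<rho>" and xy: "x \<in> U" "y \<in> U" "x - y \<in> ideal m"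
  shows "\<rho> x = \<rho> y"
proof -
  have u: "qconj y * x \<in> U" using xy U_mult U_qconj by simp
  have "qconj y * x - 1 = qconj y * (x - y)" using U_inv[OF xy(2)] by (simp add: right_diff_distrib)
  then have "qconj y * x - 1 \<in> ideal m" using xy U_qconj U_D0 ideal_left by simp
  then have one: "\<rho> (qconj y * x) = 1\<^sub>m n" using t u unfolding trivial_at_def by blast
  have "x = y * (qconj y * x)" using U_inv(1)[OF xy(2)] by (simp flip: mult.assoc)
  then have "\<rho> x = \<rho> (y * (qconj y * x))" by simp
  also have "\<dots> = \<rho> y * 1\<^sub>m n" using cont_repD(3)[OF \<rho> xy(2) u] one by simp
  also have "\<dots> = \<rho> y" by (rule right_mult_one_mat[OF cont_repD(1)[OF \<rho> xy(2)]])
  finally show ?thesis .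
qed

lemma trivial_at_rep:
  "cont_rep v emb U n \<rho> \<Longrightarrow> trivial_at m n \<rho> \<Longrightarrow> x \<in> U \<Longrightarrow> \<rho> (rep m x) = \<rho> x"
  using trivial_at_cong[of n \<rho> m "rep m x" x] rep by blast

lemma group_rep_of_cont_rep:
  assumes \<rho>: "cont_rep v emb U n \<rho>" "trivial_at m n \<rho>"
  shows "group_rep (Grp m) n \<rho>"
  unfolding group_rep_def
proof (intro conjI ballI)
  fix x y assume "x \<in> carrier (Grp m)" "y \<in> carrier (Grp m)"
  then have u: "x \<in> U" "y \<in> U" using Grp_U by auto
  show "\<rho> (x \<otimes>\<^bsub>Grp m\<^esub> y) = \<rho> x * \<rho> y"
    using trivial_at_rep[OF \<rho> U_mult[OF u]] cont_repD(3)[OF \<rho>(1) u] by (simp add: Grp_simps)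
qed (use cont_repD[OF \<rho>(1)] Grp_U in \<open>auto simp: Grp_simps(3)\<close>)

lemma irreducible_Grp:
  assumes "irreducible_rep U n \<rho>" "\<And>x. x \<in> U \<Longrightarrow> \<rho> (rep m x) = \<rho> x"
  shows "irreducible_rep (carrier (Grp m)) n \<rho>"
proof -
  have "(\<forall>g\<in>carrier (Grp m). \<forall>x\<in>W. \<rho> g *\<^sub>v x \<in> W) \<longrightarrow> (\<forall>g\<in>U. \<forall>x\<in>W. \<rho> g *\<^sub>v x \<in> W)" for W
    using assms(2) by (metis Grp_simps(1) imageI)
  then show ?thesis using assms(1) unfolding irreducible_rep_iff by meson
qed

text \<open>Inflation to \<open>U\<close>. Continuity holds because the inflated map is constant on
  a ball around each point.\<close>

lemma cont_rep_of_group_rep: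
  assumes \<sigma>: "group_rep (Grp m) n \<sigma>" and irr: "irreducible_rep (carrier (Grp m)) n \<sigma>"
  shows "\<sigma> \<circ> rep m \<in> irr_reps v emb U n" "trivial_at m n (\<sigma> \<circ> rep m)"
proof -
  have rc: "rep m x \<in> carrier (Grp m)" if "x \<in> U" for x using that by (simp add: Grp_simps)
  have s: "x \<in> carrier (Grp m) \<Longrightarrow> \<sigma> x \<in> carrier_mat n n" "\<sigma> 1 = 1\<^sub>m n"
    "x \<in> carrier (Grp m) \<Longrightarrow> y \<in> carrier (Grp m) \<Longrightarrow> \<sigma> (rep m (x * y)) = \<sigma> x * \<sigma> y" for x y
    using \<sigma> unfolding group_rep_def by (auto simp: Grp_simps(2,3))
  have "cont_rep v emb U n (\<sigma> \<circ> rep m)"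
    unfolding cont_rep_def
  proof (intro conjI ballI allI impI)
    show "(\<sigma> \<circ> rep m) 1 = 1\<^sub>m n" by (simp add: rep_one s)
    fix g assume g: "g \<in> U"
    show "(\<sigma> \<circ> rep m) g \<in> carrier_mat n n" using s(1)[OF rc[OF g]] by simp
    show "(\<sigma> \<circ> rep m) (g * h) = (\<sigma> \<circ> rep m) g * (\<sigma> \<circ> rep m) h" if h: "h \<in> U" for h
      using s(3)[OF rc[OF g] rc[OF h]] rep_mult_rep[OF g h] by simp
    fix \<epsilon> :: real assume "\<epsilon> > 0"
    have "h - g \<in> ideal m" if "dnorm v emb (h - g) < w ^ (m + \<kappa>) / K" for h
    proof (rule ideal_ball)
      have "N (h - g) \<le> K * dnorm v emb (h - g)" by (rule N_le_dnorm)
      also have "\<dots> \<le> K * (w ^ (m + \<kappa>) / K)" using that K_pos by (intro mult_left_mono) auto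
      finally show "N (h - g) \<le> w ^ (m + \<kappa>)" using K_pos by simp
    qed
    then have "rep m h = rep m g" if "dnorm v emb (h - g) < w ^ (m + \<kappa>) / K" for h
      using that rep_cong by blast
    then show "\<exists>\<delta>>0. \<forall>h\<in>U. dnorm v emb (h - g) < \<delta> \<longrightarrow>
        (\<forall>i<n. \<forall>j<n. cmod ((\<sigma> \<circ> rep m) h $$ (i,j) - (\<sigma> \<circ> rep m) g $$ (i,j)) < \<epsilon>)"
      using \<open>\<epsilon> > 0\<close> K_pos by (intro exI[of _ "w ^ (m + \<kappa>) / K"]) auto
  qed
  moreover have "irreducible_rep U n (\<sigma> \<circ> rep m)"
  proof -
    have "(\<forall>g\<in>U. \<forall>x\<in>W. (\<sigma> \<circ> rep m) g *\<^sub>v x \<in> W) \<longrightarrow> (\<forall>g\<in>carrier (Grp m). \<forall>x\<in>W. \<sigma> g *\<^sub>v x \<in> W)" for W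
      using Grp_U rep_Grp by (metis comp_apply)
    then show ?thesis using irr unfolding irreducible_rep_iff by meson
  qed
  ultimately show "\<sigma> \<circ> rep m \<in> irr_reps v emb U n" by (simp add: irr_reps_def)
  show "trivial_at m n (\<sigma> \<circ> rep m)" unfolding trivial_at_def
    using rep_cong[of _ 1 m] rep_one s(2) by simp
qed

lemma rep_iso_iff_rep_equiv:
  assumes \<rho>: "cont_rep v emb U n \<rho>" and \<sigma>: "cont_rep v emb U n' \<sigma>"
  shows "rep_iso U \<rho> \<sigma> \<longleftrightarrow> rep_equiv U n \<rho> n' \<sigma>"
proof -
  have "\<rho> 1 \<in> carrier_mat k k \<longleftrightarrow> k = n" "\<sigma> 1 \<in> carrier_mat k k \<longleftrightarrow> k = n'" for k
    using cont_repD(2)[OF \<rho>] cont_repD(2)[OF \<sigma>] by auto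
  then show ?thesis unfolding rep_iso_def rep_equiv_def by auto
qed

lemma rep_equiv_U_iff_Grp:
  assumes "\<And>x. x \<in> U \<Longrightarrow> \<rho> (rep m x) = \<rho> x" "\<And>x. x \<in> U \<Longrightarrow> \<sigma> (rep m x) = \<sigma> x"
  shows "rep_equiv U n \<rho> n' \<sigma> \<longleftrightarrow> rep_equiv (carrier (Grp m)) n \<rho> n' \<sigma>"
  unfolding rep_equiv_def Grp_simps(1) using assms rep(1) by auto

lemma v_le_zero_iff: "v x \<le> 0 \<longleftrightarrow> x = 0"
  using v_pos_iff[of x] by (simp add: linorder_not_less[symmetric])

lemma sum_three_parts: "pure y \<Longrightarrow> y = mk 0 (q1 y) 0 0 + (mk 0 0 (q2 y) 0 + mk 0 0 0 (q3 y))"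
  by (rule q_eqI) (auto simp: pure_def)

text \<open>With \<open>k = i * j\<close> one has \<open>[j, k] = - 2 b i\<close>,
  \<open>[k, i] = - 2 a j\<close> and \<open>[i, j] = 2 k\<close>. The bound for
  \<open>\<eta>\<close> pays \<open>\<kappa>\<close> for the factor 2 and \<open>\<kappa>\<close>
  for \<open>a\<close> or \<open>b\<close>.\<close>

lemma direction_commutator:
  assumes "e \<in> {mk 0 1 0 0, mk 0 0 1 0, mk 0 0 0 1}"
  obtains f1 f2 \<eta> where "pure f1" "pure f2" "N f1 \<le> 1" "N f2 \<le> 1" "comm f1 f2 = emb \<eta> * e"
    "w ^ (2 * \<kappa>) \<le> v \<eta>"
    "\<And>c d. N (emb c * f1 + emb d * f2) = max (v c) (v d)"
proof -
  have pp: "w ^ (2 * \<kappa>) = w ^ \<kappa> * w ^ \<kappa>" by (simp only: mult_2 power_add)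
  have h1: "w ^ (2 * \<kappa>) \<le> v (2 * a)" unfolding pp v_mult
    by (rule mult_mono[OF v2_ge va_ge v_nonneg less_imp_le[OF w_pow_pos]])
  have h2: "w ^ (2 * \<kappa>) \<le> v (2 * b)" unfolding pp v_mult
    by (rule mult_mono[OF v2_ge vb_ge v_nonneg less_imp_le[OF w_pow_pos]])
  have h3: "w ^ (2 * \<kappa>) \<le> v 2" using order_trans[OF w_pow_mono[of \<kappa> "2 * \<kappa>"] v2_ge] by linarith
  have h': "v (- (2 * a)) \<ge> w ^ (2 * \<kappa>)" "v (- (2 * b)) \<ge> w ^ (2 * \<kappa>)" using h1 h2 by (simp_all only: v_minus)
  have c: "comm (mk 0 0 1 0) (mk 0 0 0 1) = emb (- (2 * b)) * mk 0 1 0 0"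
    "comm (mk 0 0 0 1) (mk 0 1 0 0) = emb (- (2 * a)) * mk 0 0 1 0"
    "comm (mk 0 1 0 0) (mk 0 0 1 0) = emb 2 * mk 0 0 0 1"
    by (rule q_eqI; simp add: comm_def q_mult)+
  have n: "N (emb c * mk 0 0 1 0 + emb d * mk 0 0 0 1) = max (v c) (v d)"
    "N (emb c * mk 0 0 0 1 + emb d * mk 0 1 0 0) = max (v c) (v d)"
    "N (emb c * mk 0 1 0 0 + emb d * mk 0 0 1 0) = max (v c) (v d)" for c d
    using v_nonneg[of c] v_nonneg[of d] by (auto simp: N_def max_def v_le_zero_iff)
  have p: "pure (mk 0 x1 x2 x3)" for x1 x2 x3 by (simp add: pure_def)
  have l: "N (mk 0 1 0 0) \<le> 1" "N (mk 0 0 1 0) \<le> 1" "N (mk 0 0 0 1) \<le> 1" by (simp_all add: N_def)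
  consider "e = mk 0 1 0 0" | "e = mk 0 0 1 0" | "e = mk 0 0 0 1" using assms by auto
  then show ?thesis
  proof cases
    case 1
    show ?thesis
      by (rule that[of "mk 0 0 1 0" "mk 0 0 0 1" "- (2 * b)"]) (simp_all only: 1 p l c h' n)
  next
    case 2
    show ?thesis
      by (rule that[of "mk 0 0 0 1" "mk 0 1 0 0" "- (2 * a)"]) (simp_all only: 2 p l c h' n)
  next
    case 3
    show ?thesis
      by (rule that[of "mk 0 1 0 0" "mk 0 0 1 0" 2]) (simp_all only: 3 p l c h3 n)
  qed
qed

end

lemma smult_vec_cancel:
  fixes u :: "'a::field vec"
  assumes "u \<in> carrier_vec n" "u \<noteq> 0\<^sub>v n" "c \<cdot>\<^sub>v u = d \<cdot>\<^sub>v u"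
  shows "c = d"
proof (rule ccontr)
  assume "c \<noteq> d"
  have "u $ i = 0" if "i < n" for i
    using arg_cong[OF assms(3), of "\<lambda>x. x $ i"] that assms(1) \<open>c \<noteq> d\<close> by simp
  then have "u = 0\<^sub>v n" using assms(1) by (intro eq_vecI) auto
  then show False using assms(2) by simp
qed

section \<open>Dimension of a representation of exact level\<close>

context quaternion_order
begin

text \<open>Exact level enters twice: triviality at \<open>m\<close> lets the Cayley images of a
  ball act as a commuting family, and nontriviality at \<open>m - 1\<close> forces the resulting
  character to be nontrivial on very small elements.\<close>

lemma dim_bound:
  assumes \<rho>: "cont_rep v emb U n \<rho>" and irr: "irreducible_rep U n \<rho>"
    and triv: "trivial_at m n \<rho>" and ntriv: "\<not> trivial_at (m - 1) n \<rho>" and m1: "m \<ge> 1"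
  shows "q ^ m \<le> n * q ^ (17 * \<kappa> + 6)"
proof (cases "m \<le> 17 * \<kappa> + 6")
  case True
  have "n \<ge> 1" using irr by (simp add: irreducible_rep_def)
  moreover have "q ^ m \<le> q ^ (17 * \<kappa> + 6)" using True q_ge by (intro power_increasing) auto
  ultimately show ?thesis by (metis mult_1 mult_le_mono)
next
  case False
  note \<rho>c = cont_repD(1)[OF \<rho>] and \<rho>m = cont_repD(3)[OF \<rho>]
  have n1: "n \<ge> 1" using irr by (simp add: irreducible_rep_def)
  \<comment> \<open>The least \<open>l\<close> with \<open>m + \<kappa> \<le> 2 * l\<close>: on the
    ball \<open>A\<close> the product of two Cayley elements then agrees modulo
    \<open>ideal m\<close> with the Cayley element of the sum.\<close>
  define l where "l = (m + \<kappa> + 1) div 2"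
  have l: "m + \<kappa> \<le> 2 * l" "2 * l \<le> m + \<kappa> + 1" by (auto simp: l_def)
  then have l': "\<kappa> \<le> l" "1 \<le> l" "l \<le> m - 1 - 2 * \<kappa>" using False by auto
  have wl1: "w ^ l < 1" using w_pow_strict[of 0 l] l' by simp
  define A where "A = {y. pure y \<and> N y \<le> w ^ l}"
  have Ad: "x + y \<in> A" "- x \<in> A" if "x \<in> A" "y \<in> A" for x y
    using that by (auto simp: A_def pure_add pure_minus N_add_le)
  have A0: "0 \<in> A" by (simp add: A_def pure_zero)
  have cayU: "cay y \<in> U" if "y \<in> A" for y using cay_in_U[of y l] that l' by (simp add: A_def)
  define E where "E y = \<rho> (cay y)" for y
  have Ec: "E y \<in> carrier_mat n n" if "y \<in> A" for y using \<rho>c cayU that by (simp add: E_def)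
  have Eadd: "E (y + z) = E y * E z" if y: "y \<in> A" and z: "z \<in> A" for y z
  proof -
    have "N (cay y * cay z - cay (y + z)) \<le> w ^ l * w ^ l"
      using y z wl1 by (intro N_cay_mult) (auto simp: A_def)
    also have "\<dots> = w ^ (2 * l)" by (simp add: mult_2 power_add)
    also have "\<dots> \<le> w ^ (m + \<kappa>)" using l(1) by (rule w_pow_mono)
    finally have "cay y * cay z - cay (y + z) \<in> ideal m" by (rule ideal_ball)
    from trivial_at_cong[OF \<rho> triv _ _ this] show ?thesis
      using cayU[OF y] cayU[OF z] cayU[OF Ad(1)[OF y z]] U_mult \<rho>m by (simp add: E_def)
  qed
  have Ecomm: "E y * E z = E z * E y" if "y \<in> A" "z \<in> A" for y z
    using Eadd[OF that] Eadd[OF that(2,1)] by (simp add: add.commute)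
  obtain u0 \<phi> where u0: "u0 \<in> carrier_vec n" "u0 \<noteq> 0\<^sub>v n" and ev: "\<And>y. y \<in> A \<Longrightarrow> E y *\<^sub>v u0 = \<phi> y \<cdot>\<^sub>v u0"
    by (rule common_eigenvector[of A E n, OF Ec n1 Ecomm]) (assumption+, rule that)
  have cancel: "c = d" if "c \<cdot>\<^sub>v u0 = d \<cdot>\<^sub>v u0" for c d by (rule smult_vec_cancel[OF u0 that])
  have \<phi>_add: "\<phi> (y + z) = \<phi> y * \<phi> z" if y: "y \<in> A" and z: "z \<in> A" for y z
  proof (rule cancel)
    have "\<phi> (y + z) \<cdot>\<^sub>v u0 = E y *\<^sub>v (E z *\<^sub>v u0)"
      unfolding ev[OF Ad(1)[OF y z], symmetric] Eadd[OF y z]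
      by (rule assoc_mult_mat_vec[OF Ec[OF y] Ec[OF z] u0(1)])
    also have "\<dots> = \<phi> z \<cdot>\<^sub>v (E y *\<^sub>v u0)" unfolding ev[OF z] by (rule mult_mat_vec[OF Ec[OF y] u0(1)])
    also have "\<dots> = (\<phi> y * \<phi> z) \<cdot>\<^sub>v u0" unfolding ev[OF y] by (simp add: smult_smult_assoc mult.commute)
    finally show "\<phi> (y + z) \<cdot>\<^sub>v u0 = (\<phi> y * \<phi> z) \<cdot>\<^sub>v u0" .
  qed
  have \<phi>_one: "\<phi> y = 1" if "y \<in> A" "E y *\<^sub>v u0 = u0" for y
    by (rule cancel) (use ev[OF that(1)] that(2) in simp)
  have \<phi>0: "\<phi> 0 = 1"
    by (rule \<phi>_one[OF A0]) (use u0 cont_repD(2)[OF \<rho>] in \<open>simp add: E_def\<close>)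
  have \<phi>_small: "\<phi> y = 1" if "y \<in> A" "N y \<le> w ^ (m + \<kappa>)" for y
  proof (rule \<phi>_one[OF that(1)])
    have "N (cay y - 1) \<le> w ^ (m + \<kappa>)" using N_cay_minus_one[of y] that wl1 by (simp add: A_def)
    then have "cay y - 1 \<in> ideal m" by (rule ideal_ball)
    then have "E y = 1\<^sub>m n" using triv cayU[OF that(1)] by (simp add: E_def trivial_at_def)
    then show "E y *\<^sub>v u0 = u0" using u0 by simp
  qed
  have \<phi>_nz: "\<phi> y \<noteq> 0" if "y \<in> A" for y using \<phi>_add[OF that Ad(2)[OF that that]] \<phi>0 by auto

  \<comment> \<open>Otherwise every \<open>u\<close> of level \<open>m - 1\<close> fixes
    \<open>u0\<close>: it is \<open>cay y\<close> with
    \<open>N y \<le> w ^ (m - 1 - 2 * \<kappa>)\<close>, one \<open>\<kappa>\<close> being lost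
    between the ideal and \<open>N\<close>, the other in \<open>uncay\<close>.\<close>
  have "\<exists>y\<in>A. N y \<le> w ^ (m - 1 - 2 * \<kappa>) \<and> \<phi> y \<noteq> 1"
  proof (rule ccontr)
    assume neg: "\<not> ?thesis"
    define C where "C = {u\<in>U. u - 1 \<in> ideal (m - 1)}"
    have fixu0: "\<rho> u *\<^sub>v u0 = u0" if "u \<in> C" for u
    proof -
      have u: "u \<in> U" "u - 1 \<in> ideal (m - 1 - \<kappa> + \<kappa>)" using that False by (auto simp: C_def)
      have b: "N (u - 1) \<le> w ^ (m - 1 - \<kappa>)" by (rule ideal_bound'[OF u(2)])
      have s: "2 * \<kappa> < m - 1 - \<kappa>" using False by auto
      note y = uncay[OF U_nrm[OF u(1)] b s]
      have y2: "N (uncay u) \<le> w ^ (m - 1 - 2 * \<kappa>)" using y(2) by (simp add: mult_2)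
      then have yA: "uncay u \<in> A" using y(1) w_pow_mono[OF l'(3)] by (simp add: A_def)
      have "\<phi> (uncay u) = 1" using neg yA y2 by blast
      then show ?thesis using ev[OF yA] y(3) by (simp add: E_def)
    qed
    \<comment> \<open>The fixed space of a normal subgroup is invariant; as it contains
      \<open>u0\<close>, it is everything, against nontriviality at level
      \<open>m - 1\<close>.\<close>
    define W where "W = {x \<in> carrier_vec n. \<forall>u\<in>C. \<rho> u *\<^sub>v x = x}"
    have Cc: "\<rho> u \<in> carrier_mat n n" if "u \<in> C" for u using that \<rho>c by (simp add: C_def)
    have "vsubspace n W" unfolding vsubspace_def W_def
      using Cc by (auto simp: mat_mult_zero_vec mult_add_distrib_mat_vec[OF Cc] mult_mat_vec[OF Cc])
    moreover have "\<forall>g\<in>U. \<forall>x\<in>W. \<rho> g *\<^sub>v x \<in> W"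
    proof (intro ballI)
      fix g x assume g: "g \<in> U" and x: "x \<in> W"
      then have xc: "x \<in> carrier_vec n" by (simp add: W_def)
      have "\<rho> u *\<^sub>v (\<rho> g *\<^sub>v x) = \<rho> g *\<^sub>v x" if u: "u \<in> C" for u
      proof -
        have uU: "u \<in> U" "u - 1 \<in> ideal (m - 1)" using u by (auto simp: C_def)
        let ?c = "qconj g * (u * g)"
        have cU: "?c \<in> U" using g uU U_mult U_qconj by simp
        have "?c - 1 = qconj g * ((u - 1) * g)" using U_inv(2)[OF g] by (simp add: left_diff_distrib right_diff_distrib)
        then have "?c - 1 \<in> ideal (m - 1)"
          using ideal_left[OF U_D0[OF U_qconj[OF g]] ideal_right[OF U_D0[OF g] uU(2)]] by simp
        then have cx: "\<rho> ?c *\<^sub>v x = x" using x cU by (simp add: W_def C_def)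
        have e: "u * g = g * ?c" using U_inv(1)[OF g] by (simp flip: mult.assoc)
        have "\<rho> u *\<^sub>v (\<rho> g *\<^sub>v x) = \<rho> (u * g) *\<^sub>v x"
          unfolding \<rho>m[OF uU(1) g] by (rule assoc_mult_mat_vec[OF \<rho>c[OF uU(1)] \<rho>c[OF g] xc, symmetric])
        also have "\<dots> = \<rho> g *\<^sub>v (\<rho> ?c *\<^sub>v x)"
        proof -
          have "\<rho> (u * g) = \<rho> g * \<rho> ?c" by (subst e) (rule \<rho>m[OF g cU])
          then show ?thesis using assoc_mult_mat_vec[OF \<rho>c[OF g] \<rho>c[OF cU] xc] by (simp only:)
        qed
        finally show ?thesis by (simp only: cx)
      qed
      then show "\<rho> g *\<^sub>v x \<in> W" using mult_mat_vec_carrier[OF \<rho>c[OF g] xc] by (simp add: W_def)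
    qed
    ultimately have "W = {0\<^sub>v n} \<or> W = carrier_vec n" using irr unfolding irreducible_rep_iff by meson
    moreover have "u0 \<in> W" using u0 fixu0 by (simp add: W_def)
    ultimately have Wall: "W = carrier_vec n" using u0(2) by blast
    have "\<rho> u = 1\<^sub>m n" if u: "u \<in> C" for u
    proof (rule mat_eq_if_mult_vec_eq[OF Cc[OF u] one_carrier_mat])
      fix x :: "complex vec" assume x: "x \<in> carrier_vec n"
      then have "x \<in> W" by (simp only: Wall)
      then have "\<rho> u *\<^sub>v x = x" using u unfolding W_def by blast
      then show "\<rho> u *\<^sub>v x = 1\<^sub>m n *\<^sub>v x" using x by simp
    qed
    then show False using ntriv by (auto simp: trivial_at_def C_def)
  qed
  then obtain y0 where y0: "y0 \<in> A" "N y0 \<le> w ^ (m - 1 - 2 * \<kappa>)" "\<phi> y0 \<noteq> 1" by blast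

  define Ds where "Ds = {mk 0 1 0 0, mk 0 0 1 0, mk 0 0 0 1}"
  \<comment> \<open>The character is nontrivial on a multiple of an axis with coefficient of exact
    value \<open>w ^ t\<close>. Looking at axes suffices, because \<open>\<phi>\<close> turns the
    sum of the axis components of \<open>y\<close> into a product.\<close>
  define Q where "Q t \<longleftrightarrow> l \<le> t \<and> (\<exists>e\<in>Ds. \<exists>c. v c = w ^ t \<and> \<phi> (emb c * e) \<noteq> 1)" for t
  have DsN: "pure e" "N e \<le> 1" if "e \<in> Ds" for e using that by (auto simp: Ds_def pure_def N_def)
  have DsA: "emb c * e \<in> A" if "e \<in> Ds" "v c \<le> w ^ l" for e c
    using DsN[OF that(1)] that(2) mult_mono[OF that(2) DsN(2)[OF that(1)]] by (simp add: A_def pure_smult N_smult)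
  have parts: "\<exists>e\<in>Ds. \<exists>c. \<phi> (emb c * e) \<noteq> 1 \<and> v c \<le> N y" if y: "y \<in> A" "\<phi> y \<noteq> 1" for y
  proof (rule ccontr)
    assume neg: "\<not> ?thesis"
    have yl: "N y \<le> w ^ l" and yp: "pure y" using y by (auto simp: A_def)
    have c: "emb (q1 y) * mk 0 1 0 0 = mk 0 (q1 y) 0 0" "emb (q2 y) * mk 0 0 1 0 = mk 0 0 (q2 y) 0"
      "emb (q3 y) * mk 0 0 0 1 = mk 0 0 0 (q3 y)" by (simp_all add: emb_mk mk_mult)
    have one: "\<phi> (mk 0 (q1 y) 0 0) = 1" "\<phi> (mk 0 0 (q2 y) 0) = 1" "\<phi> (mk 0 0 0 (q3 y)) = 1"
      unfolding c[symmetric] using neg v_le_N[of y] by (auto simp: Ds_def)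
    have mA: "mk 0 (q1 y) 0 0 \<in> A" "mk 0 0 (q2 y) 0 \<in> A" "mk 0 0 0 (q3 y) \<in> A"
      unfolding c[symmetric] using v_le_N[of y] yl by (auto intro!: DsA simp: Ds_def)
    have "\<phi> y = \<phi> (mk 0 (q1 y) 0 0) * (\<phi> (mk 0 0 (q2 y) 0) * \<phi> (mk 0 0 0 (q3 y)))"
      using sum_three_parts[OF yp] \<phi>_add[OF mA(1) Ad(1)[OF mA(2,3)]] \<phi>_add[OF mA(2,3)] by simp
    then show False using one y(2) by simp
  qed
  have val: "\<exists>t. v c = w ^ t" if "c \<noteq> 0" "v c \<le> 1" for c
  proof -
    from discrete[OF that(1)] obtain k :: int where k: "v c = w powi k" by blast
    have "k \<ge> 0"
    proof (rule ccontr)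
      assume "\<not> k \<ge> 0"
      then have "w powi 0 < w powi k" using pi_pos pi_less by (intro power_int_strict_decreasing) auto
      then show False using k that(2) by simp
    qed
    then have "v c = w ^ nat k" using k by (simp add: power_int_def)
    then show ?thesis by blast
  qed
  have exQ: "\<exists>t. Q t \<and> w ^ t \<le> N y" if y: "y \<in> A" "\<phi> y \<noteq> 1" for y
  proof -
    from parts[OF y] obtain e c where ec: "e \<in> Ds" "\<phi> (emb c * e) \<noteq> 1" "v c \<le> N y" by blast
    have c0: "c \<noteq> 0" using ec(2) \<phi>0 by auto
    have cl: "v c \<le> w ^ l" using ec(3) y by (simp add: A_def)
    then obtain t where t: "v c = w ^ t" using val[OF c0] wl1 by fastforce
    have "l \<le> t" using cl t w_pow_strict[of t l] by (metis linorder_not_less)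
    then show ?thesis using ec t unfolding Q_def by (intro exI[of _ t]) auto
  qed
  have Qbd: "t \<le> m + \<kappa>" if "Q t" for t
  proof (rule ccontr)
    assume "\<not> t \<le> m + \<kappa>"
    from that obtain e c where ec: "e \<in> Ds" "v c = w ^ t" "\<phi> (emb c * e) \<noteq> 1" "l \<le> t" by (auto simp: Q_def)
    have "v c * N e \<le> w ^ t * 1" using ec DsN(2) by (intro mult_mono) auto
    also have "\<dots> \<le> w ^ (m + \<kappa>)" using w_pow_mono[of "m + \<kappa>" t] \<open>\<not> t \<le> m + \<kappa>\<close> by simp
    finally have "\<phi> (emb c * e) = 1"
      using ec w_pow_mono[OF ec(4)] by (intro \<phi>_small DsA) (auto simp: N_smult)
    then show False using ec by simp
  qed
  text \<open>\<open>T\<close> is the exact conductor: \<open>\<phi> y = 1\<close> whenever \<open>N y < w ^ T\<close>, but not for some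
    \<open>y = emb c * e\<close> with \<open>v c = w ^ T\<close>.\<close>
  define T where "T = (GREATEST t. Q t)"
  from exQ[OF y0(1,3)] obtain t0 where t0: "Q t0" "w ^ t0 \<le> N y0" by blast
  have QT: "Q T" unfolding T_def by (rule GreatestI_nat[of Q t0, OF t0(1)]) (use Qbd in blast)
  have Tge: "t \<le> T" if "Q t" for t unfolding T_def by (rule Greatest_le_nat[of Q t, OF that]) (use Qbd in blast)
  have T_low: "m - 1 - 2 * \<kappa> \<le> T"
  proof -
    have "m - 1 - 2 * \<kappa> \<le> t0"
      using t0(2) y0(2) w_pow_strict[of t0 "m - 1 - 2 * \<kappa>"] by (metis linorder_not_less order_trans)
    then show ?thesis using Tge[OF t0(1)] by simp
  qed
  have below: "\<phi> y = 1" if y: "pure y" "N y < w ^ T" for y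
  proof (rule ccontr)
    assume "\<phi> y \<noteq> 1"
    moreover have "y \<in> A" using y w_pow_mono[of l T] T_low l'(3) by (simp add: A_def)
    ultimately obtain t where t: "Q t" "w ^ t \<le> N y" using exQ by blast
    have "w ^ T \<le> w ^ t" by (rule w_pow_mono[OF Tge[OF t(1)]])
    then show False using t(2) y(2) by simp
  qed
  from QT obtain e c where ec: "e \<in> Ds" "v c = w ^ T" "\<phi> (emb c * e) \<noteq> 1" and lT: "l \<le> T" by (auto simp: Q_def)
  have ceA: "emb c * e \<in> A" using ec w_pow_mono[OF lT] by (intro DsA) auto
  obtain f1 f2 \<eta> where f: "pure f1" "pure f2" "N f1 \<le> 1" "N f2 \<le> 1" "comm f1 f2 = emb \<eta> * e"
    "w ^ (2 * \<kappa>) \<le> v \<eta>" and Nf: "\<And>c d. N (emb c * f1 + emb d * f2) = max (v c) (v d)"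
    by (rule direction_commutator[OF ec(1)[unfolded Ds_def]]) (rule that)

  \<comment> \<open>One more than \<open>3 * \<kappa>\<close>, the price of dividing by
    \<open>2 * \<eta>\<close>: the error from \<open>hc_lipschitz\<close> then falls strictly below
    \<open>w ^ T\<close>, where \<open>\<phi>\<close> is 1.\<close>
  define c3 where "c3 = 3 * \<kappa> + 1"
  \<comment> \<open>Chosen so that \<open>c3 + ee + 3 * \<kappa> + l\<close> equals the lower bound
    for \<open>T\<close>, which keeps the test element \<open>z\<close> of \<open>sep\<close> inside
    \<open>A\<close>. As \<open>2 * l \<le> m + \<kappa> + 1\<close>, the final loss
    \<open>m - 2 * ee\<close> is at most \<open>17 * \<kappa> + 5\<close>.\<close>
  define ee where "ee = m - 2 - 8 * \<kappa> - l"
  have ee: "c3 + ee + 3 * \<kappa> + l = m - 1 - 2 * \<kappa>" using l False by (auto simp: c3_def ee_def)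
  define R where "R = residues ee"
  define Y where "Y p = emb (\<pi> ^ c3 * fst p) * f1 + emb (\<pi> ^ c3 * snd p) * f2" for p
  have Yp: "pure (Y p)" for p unfolding Y_def by (intro pure_add pure_smult f)
  have YN: "N (Y p) \<le> w ^ c3" if "p \<in> R \<times> R" for p
  proof -
    have "v (fst p) \<le> 1" "v (snd p) \<le> 1" using that residues(3) by (auto simp: R_def)
    then show ?thesis unfolding Y_def Nf by (simp add: v_mult v_power mult_left_le)
  qed
  have wc3: "w ^ c3 < 1" using w_pow_strict[of 0 c3] by (simp add: c3_def)
  have Ylt: "N (Y p) < 1" if "p \<in> R \<times> R" for p using YN[OF that] wc3 by simp
  have gU: "cay (Y p) \<in> U" if "p \<in> R \<times> R" for p
    using cay_in_U[OF Yp YN[OF that]] by (simp add: c3_def)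
  \<comment> \<open>\<open>\<phi>\<close> composed with \<open>ac p\<close> is the conjugate of
    \<open>\<phi>\<close> by \<open>cay (Y p)\<close>; it is the weight of the translated
    eigenvector \<open>vec p\<close>.\<close>
  define ac where "ac p z = cay (- Y p) * z * cay (Y p)" for p z
  have acA: "ac p z \<in> A" "cay (ac p z) = cay (- Y p) * cay z * cay (Y p)" if p: "p \<in> R \<times> R" and z: "z \<in> A" for p z
  proof -
    note cm = cay_minus_mult[OF Yp Ylt[OF p]]
    have zp: "pure z" "N z \<le> w ^ l" using z by (auto simp: A_def)
    note cc = conj_cay[OF zp(1) cm(1) cm(2)]
    have "N (cay (- Y p)) \<le> 1" "N (cay (Y p)) \<le> 1"
      using N_cay_le_one[of "- Y p"] N_cay_le_one[of "Y p"] Yp[of p] Ylt[OF p] pure_minus by auto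
    then have "N (ac p z) \<le> w ^ l" unfolding ac_def by (intro N_le_one_mult zp)
    then show "ac p z \<in> A" using cc(1) by (simp add: A_def ac_def)
    show "cay (ac p z) = cay (- Y p) * cay z * cay (Y p)" using cc(2) by (simp add: ac_def)
  qed
  define vec where "vec p = \<rho> (cay (Y p)) *\<^sub>v u0" for p
  have vec_c: "vec p \<in> carrier_vec n" if "p \<in> R \<times> R" for p
    unfolding vec_def by (rule mult_mat_vec_carrier[OF \<rho>c[OF gU[OF that]] u0(1)])
  have vec_nz: "vec p \<noteq> 0\<^sub>v n" if p: "p \<in> R \<times> R" for p
  proof
    assume z: "vec p = 0\<^sub>v n"
    let ?g = "cay (Y p)"
    have g: "?g \<in> U" "qconj ?g \<in> U" using gU[OF p] U_qconj by auto
    have "u0 = \<rho> (qconj ?g * ?g) *\<^sub>v u0" using U_inv(2)[OF g(1)] cont_repD(2)[OF \<rho>] u0(1) by simp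
    also have "\<dots> = \<rho> (qconj ?g) *\<^sub>v vec p"
      unfolding vec_def \<rho>m[OF g(2,1)] by (rule assoc_mult_mat_vec[OF \<rho>c[OF g(2)] \<rho>c[OF g(1)] u0(1)])
    also have "\<dots> = 0\<^sub>v n" unfolding z by (rule mat_mult_zero_vec[OF \<rho>c[OF g(2)]])
    finally show False using u0(2) by simp
  qed
  have vec_ev: "E z *\<^sub>v vec p = \<phi> (ac p z) \<cdot>\<^sub>v vec p" if p: "p \<in> R \<times> R" and z: "z \<in> A" for p z
  proof -
    let ?g = "cay (Y p)" and ?z = "ac p z"
    note zc = cayU[OF z] and zc' = cayU[OF acA(1)[OF p z]]
    have "?g * cay ?z = (?g * cay (- Y p)) * (cay z * ?g)" unfolding acA(2)[OF p z] by (simp only: mult.assoc)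
    then have e: "cay z * ?g = ?g * cay ?z" using cay_minus_mult(1)[OF Yp Ylt[OF p]] by simp
    have "E z *\<^sub>v vec p = \<rho> (cay z * ?g) *\<^sub>v u0"
      unfolding vec_def E_def \<rho>m[OF zc gU[OF p]] by (rule assoc_mult_mat_vec[OF \<rho>c[OF zc] \<rho>c[OF gU[OF p]] u0(1), symmetric])
    also have "\<dots> = \<rho> ?g *\<^sub>v (E ?z *\<^sub>v u0)"
      unfolding e E_def \<rho>m[OF gU[OF p] zc'] by (rule assoc_mult_mat_vec[OF \<rho>c[OF gU[OF p]] \<rho>c[OF zc'] u0(1)])
    also have "\<dots> = \<phi> ?z \<cdot>\<^sub>v vec p"
      unfolding ev[OF acA(1)[OF p z]] vec_def by (rule mult_mat_vec[OF \<rho>c[OF gU[OF p]] u0(1)])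
    finally show ?thesis .
  qed
  \<comment> \<open>\<open>\<chi>\<close> stands for the dominant coefficient of
    \<open>Y p - Y p'\<close>, and \<open>g\<close> for the vector that carries the other one:
    multiples of \<open>g\<close> do not see that other coefficient, so the commutator is an exact
    multiple of \<open>e\<close>.\<close>
  have sep: "\<exists>z\<in>A. \<phi> (ac p z) \<noteq> \<phi> (ac p' z)"
    if p: "p \<in> R \<times> R" and p': "p' \<in> R \<times> R"
      and g: "pure g" "N g \<le> 1" and \<chi>: "v \<chi> = N (Y p - Y p')" "w ^ (c3 + ee) < v \<chi>"
      and \<zeta>: "v \<zeta> = v \<eta>" and cm: "\<And>lam. comm (Y p - Y p') (emb lam * g) = emb (\<chi> * lam * \<zeta>) * e"
    for p p' g \<chi> \<zeta>
  proof -
    have \<chi>0: "\<chi> \<noteq> 0" using less_trans[OF w_pow_pos \<chi>(2)] unfolding v_pos_iff .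
    have \<zeta>0: "\<zeta> \<noteq> 0" using less_le_trans[OF w_pow_pos f(6)] unfolding \<zeta>[symmetric] v_pos_iff .
    \<comment> \<open>Solves \<open>2 * \<chi> * lam * \<zeta> = - c\<close>, so that the main term
      in the difference of the two conjugates is \<open>emb c * e\<close>, where
      \<open>\<phi>\<close> is not 1.\<close>
    define lam where "lam = - c / (2 * \<chi> * \<zeta>)"
    have vlam: "v lam * (v 2 * v \<zeta>) * v \<chi> = w ^ T"
      using \<chi>0 \<zeta>0 two ec(2) unfolding lam_def by (simp add: v_divide v_mult)
    have v2z: "w ^ (3 * \<kappa>) \<le> v 2 * v \<zeta>"
      using mult_mono[OF v2_ge f(6)] \<zeta> by (simp add: power_add[symmetric])
    have lam_le: "v lam \<le> w ^ l"
    proof (rule ccontr)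
      assume "\<not> v lam \<le> w ^ l"
      then have "w ^ l * w ^ (3 * \<kappa>) * w ^ (c3 + ee) \<le> v lam * (v 2 * v \<zeta>) * w ^ (c3 + ee)"
        using v2z by (intro mult_right_mono mult_mono) auto
      also have "\<dots> < v lam * (v 2 * v \<zeta>) * v \<chi>"
      proof (rule mult_strict_left_mono[OF \<chi>(2)])
        have "v lam > 0" using \<open>\<not> v lam \<le> w ^ l\<close> w_pow_pos[of l] by linarith
        moreover have "0 < v 2 * v \<zeta>" using v2z w_pow_pos[of "3 * \<kappa>"] by linarith
        ultimately show "0 < v lam * (v 2 * v \<zeta>)" by (rule mult_pos_pos)
      qed
      also have "\<dots> = w ^ T" by (rule vlam)
      finally have "w ^ (l + 3 * \<kappa> + (c3 + ee)) < w ^ T" by (simp add: power_add mult_ac)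
      moreover have "w ^ T \<le> w ^ (l + 3 * \<kappa> + (c3 + ee))" using ee T_low by (intro w_pow_mono) linarith
      ultimately show False by simp
    qed
    define z where "z = emb lam * g"
    have zN: "N z \<le> v lam" unfolding z_def N_smult using g(2) by (simp add: mult_left_le)
    have zA: "z \<in> A" using zN lam_le g(1) by (simp add: A_def z_def pure_smult)
    define er where "er = emb 2 * (hc (Y p) z - hc (Y p') z - comm (Y p - Y p') z)"
    have ace: "ac p z = z - emb 2 * hc (Y p) z" "ac p' z = z - emb 2 * hc (Y p') z"
      unfolding ac_def using conj_by_cay[OF Yp Ylt[OF p]] conj_by_cay[OF Yp Ylt[OF p']] by auto
    have "emb 2 * comm (Y p - Y p') z = - (emb c * e)"
    proof -
      have "2 * (\<chi> * lam * \<zeta>) = - c" unfolding lam_def using \<chi>0 \<zeta>0 two by simp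
      then show ?thesis unfolding z_def cm mult.assoc[symmetric] emb_mult[symmetric] by (simp add: emb_minus)
    qed
    then have diff: "ac p z = ac p' z + (emb c * e + (- er))"
      unfolding ace er_def by (simp add: right_diff_distrib algebra_simps)
    have "- er = ac p z - ac p' z - emb c * e" using diff by (simp add: algebra_simps)
    then have erp: "pure (- er)"
      using acA(1)[OF p zA] acA(1)[OF p' zA] ceA by (auto simp: A_def intro!: pure_diff)
    have "N (- er) \<le> w ^ c3 * N (Y p - Y p') * N z"
      unfolding er_def N_minus using hc_lipschitz[OF Yp YN[OF p] Yp YN[OF p'] wc3, of z] N_two_le order_trans by blast
    also have "\<dots> \<le> w ^ c3 * v \<chi> * v lam" unfolding \<chi>(1) using zN by (intro mult_left_mono) auto
    finally have 1: "N (- er) \<le> w ^ c3 * v \<chi> * v lam" .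
    have "N (- er) * w ^ (3 * \<kappa>) \<le> (w ^ c3 * v \<chi> * v lam) * (v 2 * v \<zeta>)"
      using 1 v2z by (intro mult_mono) auto
    also have "\<dots> = w ^ c3 * w ^ T" unfolding vlam[symmetric] by (simp add: mult_ac)
    also have "\<dots> = w ^ (3 * \<kappa>) * w * w ^ T" by (simp add: c3_def)
    also have "\<dots> < w ^ (3 * \<kappa>) * 1 * w ^ T" using pi_less by (intro mult_strict_right_mono mult_strict_left_mono) auto
    finally have "N (- er) < w ^ T" by (simp add: mult.commute)
    then have er1: "\<phi> (- er) = 1" and erA: "- er \<in> A"
      using below[OF erp] erp w_pow_mono[OF lT] by (auto simp: A_def)
    have "\<phi> (ac p z) = \<phi> (ac p' z) * \<phi> (emb c * e)"
      unfolding diff using \<phi>_add[OF acA(1)[OF p' zA] Ad(1)[OF ceA erA]] \<phi>_add[OF ceA erA] er1 by simp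
    then show ?thesis using ec(3) \<phi>_nz[OF acA(1)[OF p' zA]] zA by (intro bexI[of _ z]) auto
  qed
  have dist: "\<exists>z\<in>A. \<phi> (ac p z) \<noteq> \<phi> (ac p' z)" if p: "p \<in> R \<times> R" and p': "p' \<in> R \<times> R" and ne: "p \<noteq> p'" for p p'
  proof -
    define \<sigma> where "\<sigma> = \<pi> ^ c3 * (fst p - fst p')"
    define \<tau> where "\<tau> = \<pi> ^ c3 * (snd p - snd p')"
    have D: "Y p - Y p' = emb \<sigma> * f1 + emb \<tau> * f2"
      unfolding Y_def \<sigma>_def \<tau>_def right_diff_distrib emb_diff left_diff_distrib by (simp add: algebra_simps)
    have ND: "N (Y p - Y p') = max (v \<sigma>) (v \<tau>)" unfolding D by (rule Nf)
    have big: "w ^ (c3 + ee) < v (\<pi> ^ c3 * (s - s'))" if "s \<in> R" "s' \<in> R" "s \<noteq> s'" for s s'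
    proof -
      have "w ^ ee < v (s - s')" using residues(5)[of s ee s'] that unfolding R_def by (meson linorder_not_less)
      then show ?thesis by (simp add: v_mult v_power power_add)
    qed
    have pr: "fst p \<in> R" "snd p \<in> R" "fst p' \<in> R" "snd p' \<in> R" using p p' by auto
    have ff: "comm f f = 0" for f by (simp add: comm_def)
    show ?thesis
    \<comment> \<open>The larger coefficient has to serve as \<open>\<chi>\<close>, because the
      error in \<open>hc_lipschitz\<close> is measured by \<open>N (Y p - Y p')\<close>.\<close>
    proof (cases "v \<tau> \<le> v \<sigma>")
      case True
      have "fst p \<noteq> fst p'"
      proof
        assume "fst p = fst p'"
        then have "\<tau> = 0" using True by (simp add: \<sigma>_def v_le_zero_iff)
        then have "snd p = snd p'" by (simp add: \<tau>_def)
        then show False using ne \<open>fst p = fst p'\<close> by (simp add: prod_eq_iff)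
      qed
      then have b: "w ^ (c3 + ee) < v \<sigma>" unfolding \<sigma>_def using big pr by blast
      have cm: "comm (Y p - Y p') (emb lam * f2) = emb (\<sigma> * lam * \<eta>) * e" for lam
      proof -
        have "comm (emb \<sigma> * f1 + emb \<tau> * f2) (emb lam * f2) = emb (\<sigma> * lam) * comm f1 f2 + emb (\<tau> * lam) * comm f2 f2"
          by (simp add: comm_def distrib_left distrib_right right_diff_distrib emb_smult_mult mult.commute)
        then show ?thesis unfolding D ff f(5) by (simp add: emb_mult mult.assoc)
      qed
      show ?thesis by (rule sep[OF p p' f(2) f(4) _ b refl cm]) (use True ND in simp)
    next
      case False
      have "snd p \<noteq> snd p'" using False by (auto simp: \<tau>_def)
      then have b: "w ^ (c3 + ee) < v \<tau>" unfolding \<tau>_def using big pr by blast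
      have cm: "comm (Y p - Y p') (emb lam * f1) = emb (\<tau> * lam * (- \<eta>)) * e" for lam
      proof -
        have "comm (emb \<sigma> * f1 + emb \<tau> * f2) (emb lam * f1) = emb (\<sigma> * lam) * comm f1 f1 - emb (\<tau> * lam) * comm f1 f2"
          by (simp add: comm_def distrib_left distrib_right right_diff_distrib emb_smult_mult mult.commute)
        then show ?thesis unfolding D ff f(5) by (simp add: emb_mult emb_minus mult.assoc)
      qed
      show ?thesis by (rule sep[OF p p' f(1) f(3) _ b _ cm]) (use False ND in auto)
    qed
  qed
  have "card (R \<times> R) \<le> n"
    by (rule card_distinct_weights_le[where A = A and R = E and w = vec and \<phi> = "\<lambda>p z. \<phi> (ac p z)"])
      (use residues(1) Ec vec_c vec_nz vec_ev dist in \<open>auto simp: R_def\<close>)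
  then have "q ^ (ee + ee) \<le> n" by (simp add: R_def residues(2) card_cartesian_product power_add)
  then have le: "q ^ (ee + ee) * q ^ (17 * \<kappa> + 6) \<le> n * q ^ (17 * \<kappa> + 6)" by (rule mult_le_mono1)
  have "q ^ m \<le> q ^ (ee + ee + (17 * \<kappa> + 6))"
    using q_ge l False by (intro power_increasing) (auto simp: ee_def)
  then show ?thesis using le unfolding power_add[of q "ee + ee"] by (rule order_trans)
qed

end

text \<open>No assumption on \<open>A\<close>: \<open>rep_iso\<close> also relates functions whose values have arbitrary shape.\<close>
lemma assoc_mult_mat_any:
  fixes A :: "'a::semiring_0 mat"
  assumes "P \<in> carrier_mat n n" "Q \<in> carrier_mat n k"
  shows "A * (P * Q) = A * P * Q"
proof (rule eq_matI)
  fix i j assume "i < dim_row (A * P * Q)" "j < dim_col (A * P * Q)"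
  then have ij: "i < dim_row A" "j < k" using assms by auto
  have "(A * (P * Q)) $$ (i,j) = (\<Sum>l<n. row A i $ l * (\<Sum>p<n. P $$ (l,p) * Q $$ (p,j)))"
    using ij assms by (auto simp: scalar_prod_def atLeast0LessThan intro!: sum.cong)
  also have "\<dots> = (\<Sum>p<n. (\<Sum>l<n. row A i $ l * P $$ (l,p)) * Q $$ (p,j))"
    by (simp add: sum_distrib_left sum_distrib_right mult.assoc) (rule sum.swap)
  also have "\<dots> = (A * P * Q) $$ (i,j)"
    using ij assms by (auto simp: scalar_prod_def atLeast0LessThan intro!: sum.cong)
  finally show "(A * (P * Q)) $$ (i,j) = (A * P * Q) $$ (i,j)" .
qed (use assms in auto)

section \<open>Non-conjugate elements of a torus\<close>

context quaternion_order
begin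

lemma finite_group_Grp: "finite_group (Grp m)"
  using card_Grp group_Grp by (intro finite_group.intro finite_group_axioms.intro) auto

text \<open>\<open>q0\<close>, half the reduced trace, of \<open>cay y\<close> depends only on
  \<open>sq y\<close>, hence on the square of the coefficient. The shape
  \<open>1 + 2 * \<pi> * t\<close> makes squaring injective: two squares differ by
  \<open>4 * \<pi> * (t - t')\<close> times the unit \<open>1 + \<pi> * (t + t')\<close>. The
  exponent adds \<open>2 * \<kappa> + 2\<close> from the squared prefactor, 1 from
  \<open>\<pi>\<close>, and \<open>\<kappa>\<close> for \<open>a\<close> and for each of three
  factors 2.\<close>

lemma separated_traces:
  assumes t: "v t \<le> 1" "v t' \<le> 1"
  defines "Z \<equiv> \<lambda>t. emb (\<pi> ^ (\<kappa> + 1) * (1 + 2 * \<pi> * t)) * mk 0 1 0 0"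
  shows "w ^ (6 * \<kappa> + 3) * v (t - t') \<le> v (q0 (cay (Z t)) - q0 (cay (Z t')))"
    "pure (Z t)" "N (Z t) \<le> w ^ (\<kappa> + 1)"
proof -
  have unit: "v (1 + \<pi> * c) = 1" if "v c \<le> 1" for c
  proof -
    have "w * v c \<le> w * 1" using that pi_pos by (intro mult_left_mono) auto
    then have "v ((1 + \<pi> * c) - 1) < v 1" using pi_less by (simp add: v_mult)
    from v_eq_of_less[OF this] show ?thesis by simp
  qed
  have u2: "v (1 + 2 * \<pi> * c) = 1" if "v c \<le> 1" for c
    using unit[of "2 * c"] that v_numeral_le[of num.One] mult_le_one[OF v_numeral_le[of "num.Bit0 num.One"] v_nonneg that]
    by (simp add: v_mult mult_ac)
  have p: "pure (Z c)" for c unfolding Z_def by (simp add: pure_def)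
  have nZ: "N (Z c) = w ^ (\<kappa> + 1)" if "v c \<le> 1" for c
    unfolding Z_def N_smult using u2[OF that] by (simp add: v_mult v_power N_def)
  have lt: "N (Z c) < 1" if "v c \<le> 1" for c
    unfolding nZ[OF that] using w_pow_strict[of 0 "\<kappa> + 1"] by simp
  show "pure (Z t)" "N (Z t) \<le> w ^ (\<kappa> + 1)" using p nZ[OF t(1)] by auto
  let ?d = "sq (Z t)" and ?d' = "sq (Z t')"
  have v1: "v (1 - ?d) = 1" "v (1 - ?d') = 1" using v_one_minus_sq[OF p lt] t by auto
  then have nz: "1 - ?d \<noteq> 0" "1 - ?d' \<noteq> 0" by auto
  have "q0 (cay (Z t)) - q0 (cay (Z t')) = 2 * (?d - ?d') / ((1 - ?d) * (1 - ?d'))"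
    unfolding q0_cay[OF p] using nz by (simp add: field_simps)
  then have e1: "v (q0 (cay (Z t)) - q0 (cay (Z t'))) = v 2 * v (?d - ?d')"
    by (simp only: v_divide v_mult v1 mult_1_left div_by_1)
  have sqZ: "sq (Z c) = a * (\<pi> ^ (\<kappa> + 1) * (1 + 2 * \<pi> * c))\<^sup>2" for c
    by (simp add: Z_def sq_def)
  have id: "a * (P * (1 + 2 * \<pi> * t))\<^sup>2 - a * (P * (1 + 2 * \<pi> * t'))\<^sup>2
      = a * (P * P) * (2 * \<pi>) * (t - t') * 2 * (1 + \<pi> * (t + t'))" for P
    by (simp add: power2_eq_square algebra_simps)
  have "?d - ?d' = a * (\<pi> ^ (\<kappa> + 1) * \<pi> ^ (\<kappa> + 1)) * (2 * \<pi>) * (t - t') * 2 * (1 + \<pi> * (t + t'))"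
    unfolding sqZ by (rule id)
  then have e2: "v (?d - ?d') = v a * (w ^ (\<kappa> + 1) * w ^ (\<kappa> + 1)) * (v 2 * w) * v (t - t') * v 2"
    by (simp only: v_mult v_power unit[OF v_add_le[OF t]] mult_1_right)
  have "w ^ (6 * \<kappa> + 3) * v (t - t') = w ^ \<kappa> * (w ^ \<kappa> * (w ^ (\<kappa> + 1) * w ^ (\<kappa> + 1)) * (w ^ \<kappa> * w) * v (t - t') * w ^ \<kappa>)"
    by (simp add: power_add[symmetric] mult_ac) (simp add: power_add power_mult_distrib mult_ac numeral_eq_Suc)
  also have "\<dots> \<le> v 2 * (v a * (w ^ (\<kappa> + 1) * w ^ (\<kappa> + 1)) * (v 2 * w) * v (t - t') * v 2)"
    using va_ge v2_ge pi_pos by (intro mult_mono mult_nonneg_nonneg order_refl) auto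
  finally show "w ^ (6 * \<kappa> + 3) * v (t - t') \<le> v (q0 (cay (Z t)) - q0 (cay (Z t')))"
    unfolding e1 e2 .
qed

text \<open>Conjugation preserves \<open>q0\<close>, so conjugacy in the quotient makes traces
  congruent, and the \<open>X t\<close> for \<open>t\<close> in a residue system modulo
  \<open>\<pi> ^ M\<close> are pairwise non-conjugate. The offset is the separation loss
  \<open>6 * \<kappa> + 3\<close> plus the \<open>\<kappa>\<close> of
  \<open>ideal_bound\<close>.\<close>

lemma many_irreducible_reps:
  assumes m: "7 * \<kappa> + 3 \<le> m"
  shows "\<exists>F. finite F \<and> q ^ (m - (7 * \<kappa> + 3)) \<le> card F \<and> (\<Sum>f\<in>F. (fst f)\<^sup>2) \<le> card (carrier (Grp m)) \<and>
    (\<forall>f\<in>F. group_rep (Grp m) (fst f) (snd f) \<and> irreducible_rep (carrier (Grp m)) (fst f) (snd f)) \<and>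
    (\<forall>f\<in>F. \<forall>f'\<in>F. f \<noteq> f' \<longrightarrow> \<not> rep_equiv (carrier (Grp m)) (fst f) (snd f) (fst f') (snd f'))"
proof -
  interpret FG: finite_group "Grp m" by (rule finite_group_Grp)
  define M where "M = m - (7 * \<kappa> + 3)"
  define X where "X t = cay (emb (\<pi> ^ (\<kappa> + 1) * (1 + 2 * \<pi> * t)) * mk 0 1 0 0)" for t
  have XU: "X t \<in> U" if "t \<in> residues M" for t
  proof -
    note r = residues(3)[OF that]
    show ?thesis unfolding X_def
      by (rule cay_in_U[OF separated_traces(2)[OF r r] separated_traces(3)[OF r r]]) auto
  qed
  have "t = t'" if t: "t \<in> residues M" and t': "t' \<in> residues M"
    and conj: "FG.conjugate_in (rep m (X t)) (rep m (X t'))" for t t'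
  proof (rule ccontr)
    assume "t \<noteq> t'"
    then have big: "w ^ M < v (t - t')" using residues(5)[OF t t'] by (meson linorder_not_less)
    obtain h where h: "h \<in> carrier (Grp m)"
      and e: "rep m (X t') = h \<otimes>\<^bsub>Grp m\<^esub> rep m (X t) \<otimes>\<^bsub>Grp m\<^esub> inv\<^bsub>Grp m\<^esub> h"
      using conj unfolding FG.conjugate_in_def by blast
    have hU: "h \<in> U" "qconj h \<in> U" using Grp_U[OF h] U_qconj by auto
    have "rep m (X t') = rep m (rep m (h * rep m (X t)) * rep m (qconj h))"
      unfolding e inv_Grp[OF h] Grp_simps(2) ..
    also have "rep m (h * rep m (X t)) = rep m (h * X t)"
      using rep_mult_rep[OF hU(1) XU[OF t], of m] rep_Grp[OF h] by simp
    also have "rep m (rep m (h * X t) * rep m (qconj h)) = rep m (h * X t * qconj h)"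
      by (rule rep_mult_rep[OF U_mult[OF hU(1) XU[OF t]] hU(2)])
    finally have "X t' - h * X t * qconj h \<in> ideal m"
      by (rule rep_eqD[OF XU[OF t'] U_mult[OF U_mult[OF hU(1) XU[OF t]] hU(2)]])
    then have b: "w ^ \<kappa> * N (X t' - h * X t * qconj h) \<le> w ^ m" by (rule ideal_bound)
    have "q0 (h * X t * qconj h) = q0 (qconj h * (h * X t))" by (rule q0_mult_commute)
    also have "\<dots> = q0 (X t)" using U_inv(2)[OF hU(1)] by (simp flip: mult.assoc)
    finally have "v (q0 (X t') - q0 (X t)) \<le> N (X t' - h * X t * qconj h)"
      using v_le_N(1)[of "X t' - h * X t * qconj h"] by simp
    then have "w ^ (6 * \<kappa> + 3) * v (t - t') \<le> N (X t' - h * X t * qconj h)"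
      using separated_traces(1)[OF residues(3)[OF t] residues(3)[OF t']] v_minus_commute[of "q0 (X t')" "q0 (X t)"]
      unfolding X_def by simp
    then have "w ^ \<kappa> * (w ^ (6 * \<kappa> + 3) * v (t - t')) \<le> w ^ m"
      using b mult_left_mono[of "w ^ (6 * \<kappa> + 3) * v (t - t')" _ "w ^ \<kappa>"] by (meson less_imp_le order_trans w_pow_pos)
    moreover have "w ^ \<kappa> * (w ^ (6 * \<kappa> + 3) * w ^ M) < w ^ \<kappa> * (w ^ (6 * \<kappa> + 3) * v (t - t'))"
      using big by (intro mult_strict_left_mono w_pow_pos)
    moreover have "w ^ \<kappa> * (w ^ (6 * \<kappa> + 3) * w ^ M) = w ^ m"
      unfolding power_add[symmetric] by (rule arg_cong[of _ _ "\<lambda>k. w ^ k"]) (use m in \<open>simp add: M_def\<close>)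
    ultimately show False by linarith
  qed
  moreover have "rep m (X t) \<in> carrier (Grp m)" if "t \<in> residues M" for t using XU[OF that] by (simp add: Grp_simps)
  ultimately have "\<exists>F. finite F \<and> card (residues M) \<le> card F \<and> (\<Sum>f\<in>F. (fst f)\<^sup>2) \<le> card (carrier (Grp m)) \<and>
    (\<forall>f\<in>F. group_rep (Grp m) (fst f) (snd f) \<and> irreducible_rep (carrier (Grp m)) (fst f) (snd f)) \<and>
    (\<forall>f\<in>F. \<forall>f'\<in>F. f \<noteq> f' \<longrightarrow> \<not> rep_equiv (carrier (Grp m)) (fst f) (snd f) (fst f') (snd f'))"
    by (intro FG.many_irreps[where x = "\<lambda>t. rep m (X t)"] residues(1)) auto
  then show ?thesis by (simp only: residues(2) M_def)
qed

section \<open>Isomorphism classes and their number\<close>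

lemma irr_repsD:
  assumes "\<rho> \<in> irr_reps v emb U n"
  shows "cont_rep v emb U n \<rho>" "irreducible_rep U n \<rho>"
  using assms by (auto simp: irr_reps_def)

text \<open>The classes in \<open>irr_classes_le\<close> consist of arbitrary matrix-valued
  functions, so transitivity must be shown for a third member \<open>\<sigma>\<close> whose values
  other than at 1 have unknown shape; hence \<open>assoc_mult_mat_any\<close>.\<close>

lemma rep_iso_class_eq:
  assumes \<rho>: "cont_rep v emb U n \<rho>" and \<rho>': "cont_rep v emb U n' \<rho>'" and iso: "rep_iso U \<rho> \<rho>'"
  shows "{\<sigma>. rep_iso U \<rho> \<sigma>} = {\<sigma>. rep_iso U \<rho>' \<sigma>}"
proof -
  have step: "rep_iso U \<rho>1 \<sigma>" if c: "cont_rep v emb U n1 \<rho>1" "cont_rep v emb U n2 \<rho>2"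
    and e: "rep_equiv U n1 \<rho>1 n2 \<rho>2" and s: "rep_iso U \<rho>2 \<sigma>" for \<rho>1 \<rho>2 n1 n2 \<sigma>
  proof -
    obtain Q where n: "n1 = n2" and Q: "Q \<in> carrier_mat n1 n1" "invertible_mat Q"
      "\<And>g. g \<in> U \<Longrightarrow> Q * \<rho>1 g = \<rho>2 g * Q" using e unfolding rep_equiv_def by auto
    obtain k P where P: "\<rho>2 1 \<in> carrier_mat k k" "\<sigma> 1 \<in> carrier_mat k k" "P \<in> carrier_mat k k" "invertible_mat P"
      "\<And>g. g \<in> U \<Longrightarrow> P * \<rho>2 g = \<sigma> g * P" using s unfolding rep_iso_def by auto
    have k: "k = n1" using P(1) cont_repD(2)[OF c(2)] n by auto
    obtain Qi where Qi: "Qi \<in> carrier_mat n1 n1" "Qi * Q = 1\<^sub>m n1" "Q * Qi = 1\<^sub>m n1" by (rule invertible_matE[OF Q(2,1)])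
    have Pc: "P \<in> carrier_mat n1 n1" using P(3) k by simp
    obtain Pi where Pi: "Pi \<in> carrier_mat n1 n1" "Pi * P = 1\<^sub>m n1" "P * Pi = 1\<^sub>m n1" by (rule invertible_matE[OF P(4) Pc])
    have inv: "invertible_mat (P * Q)"
    proof (rule invertible_matI[of _ n1 "Qi * Pi"])
      have "Qi * Pi * (P * Q) = Qi * (Pi * (P * Q))" by (rule assoc_mult_mat) (use Qi Pi Pc Q in auto)
      also have "Pi * (P * Q) = Pi * P * Q" by (rule assoc_mult_mat[symmetric]) (use Qi Pi Pc Q in auto)
      finally show "Qi * Pi * (P * Q) = 1\<^sub>m n1" using Pi(2) Qi(2) Q(1) by simp
      have "P * Q * (Qi * Pi) = P * (Q * (Qi * Pi))" by (rule assoc_mult_mat) (use Qi Pi Pc Q in auto)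
      also have "Q * (Qi * Pi) = Q * Qi * Pi" by (rule assoc_mult_mat[symmetric]) (use Qi Pi Pc Q in auto)
      finally show "P * Q * (Qi * Pi) = 1\<^sub>m n1" using Pi Qi(3) by simp
    qed (use Qi Pi Pc Q in auto)
    have "P * Q * \<rho>1 g = \<sigma> g * (P * Q)" if g: "g \<in> U" for g
    proof -
      note r1 = cont_repD(1)[OF c(1) g] and r2 = cont_repD(1)[OF c(2) g, folded n]
      have "P * Q * \<rho>1 g = P * (\<rho>2 g * Q)" unfolding Q(3)[OF g, symmetric] by (rule assoc_mult_mat[OF Pc Q(1) r1])
      also have "\<dots> = P * \<rho>2 g * Q" by (rule assoc_mult_mat[OF Pc r2 Q(1), symmetric])
      also have "\<dots> = \<sigma> g * (P * Q)" unfolding P(5)[OF g] by (rule assoc_mult_mat_any[OF Pc Q(1), symmetric])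
      finally show ?thesis .
    qed
    then show ?thesis
      unfolding rep_iso_def using inv Pc Q(1) P(2) k cont_repD(2)[OF c(1)]
      by (intro exI[of _ n1] conjI bexI[of _ "P * Q"]) auto
  qed
  have e: "rep_equiv U n \<rho> n' \<rho>'" using iso rep_iso_iff_rep_equiv[OF \<rho> \<rho>'] by simp
  have e': "rep_equiv U n' \<rho>' n \<rho>" by (rule rep_equiv_sym[OF e]) (use cont_repD(1)[OF \<rho>] cont_repD(1)[OF \<rho>'] in auto)
  show ?thesis using step[OF \<rho> \<rho>' e] step[OF \<rho>' \<rho> e'] by blast
qed

text \<open>Bounding all finite families of pairwise non-isomorphic representations gives finiteness
  of the quotient together with its size; without finiteness \<open>card\<close> would be 0 and say
  nothing.\<close>

lemma finite_irr_classes: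
  assumes B: "\<And>F. finite F \<Longrightarrow> F \<subseteq> (\<Union>k\<in>{1..n}. irr_reps v emb U k) \<Longrightarrow>
      (\<And>\<rho> \<sigma>. \<rho> \<in> F \<Longrightarrow> \<sigma> \<in> F \<Longrightarrow> rep_iso U \<rho> \<sigma> \<Longrightarrow> \<rho> = \<sigma>) \<Longrightarrow> card F \<le> B"
  shows "finite (irr_classes_le v emb U n)" "R_count v emb U n \<le> B"
proof -
  let ?A = "\<Union>k\<in>{1..n}. irr_reps v emb U k"
  let ?C = "irr_classes_le v emb U n"
  have "\<forall>c\<in>?C. \<exists>\<rho>\<in>?A. c = {\<sigma>. rep_iso U \<rho> \<sigma>}"
    unfolding irr_classes_le_def quotient_def by auto
  then obtain f where f: "\<And>c. c \<in> ?C \<Longrightarrow> f c \<in> ?A" "\<And>c. c \<in> ?C \<Longrightarrow> c = {\<sigma>. rep_iso U (f c) \<sigma>}" by metis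
  have inj: "inj_on f ?C" by (rule inj_onI) (metis f(2))
  have bd: "card C \<le> B" if C: "finite C" "C \<subseteq> ?C" for C
  proof -
    have "card (f ` C) \<le> B"
    proof (rule B)
      show "finite (f ` C)" using C by simp
      show "f ` C \<subseteq> ?A" using C f(1) by blast
      fix \<rho> \<sigma> assume "\<rho> \<in> f ` C" "\<sigma> \<in> f ` C" and iso: "rep_iso U \<rho> \<sigma>"
      then obtain c d where c: "c \<in> ?C" "\<rho> = f c" and d: "d \<in> ?C" "\<sigma> = f d" using C by auto
      have "\<exists>k. cont_rep v emb U k (f c)" "\<exists>k. cont_rep v emb U k (f d)"
        using f(1)[OF c(1)] f(1)[OF d(1)] irr_repsD(1) by blast+
      then have "{\<sigma>. rep_iso U (f c) \<sigma>} = {\<sigma>. rep_iso U (f d) \<sigma>}"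
        using rep_iso_class_eq iso c d by blast
      then have "c = d" using f(2)[OF c(1)] f(2)[OF d(1)] by simp
      then show "\<rho> = \<sigma>" using c d by simp
    qed
    moreover have "card (f ` C) = card C" using inj C by (intro card_image) (rule inj_on_subset)
    ultimately show ?thesis by simp
  qed
  show fin: "finite ?C"
  proof (rule ccontr)
    assume "infinite ?C"
    then obtain C where "finite C" "card C = Suc B" "C \<subseteq> ?C"
      using infinite_arbitrarily_large[of ?C "Suc B"] by blast
    then show False using bd[of C] by simp
  qed
  show "R_count v emb U n \<le> B" unfolding R_count_def using bd[OF fin] by simp
qed

lemma card_le_R_count:
  assumes fin: "finite (irr_classes_le v emb U n)" and F: "F \<subseteq> (\<Union>k\<in>{1..n}. irr_reps v emb U k)"
    and ne: "\<And>\<rho> \<sigma>. \<rho> \<in> F \<Longrightarrow> \<sigma> \<in> F \<Longrightarrow> rep_iso U \<rho> \<sigma> \<Longrightarrow> \<rho> = \<sigma>"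
  shows "card F \<le> R_count v emb U n"
proof -
  let ?R = "{(\<rho>, \<sigma>). rep_iso U \<rho> \<sigma>}"
  have "inj_on (\<lambda>\<rho>. ?R `` {\<rho>}) F"
  proof (rule inj_onI)
    fix \<rho> \<sigma> assume r: "\<rho> \<in> F" "\<sigma> \<in> F" "?R `` {\<rho>} = ?R `` {\<sigma>}"
    obtain k where k: "cont_rep v emb U k \<sigma>" using F r(2) irr_repsD(1) by blast
    have "rep_iso U \<sigma> \<sigma>" using rep_iso_iff_rep_equiv[OF k k] rep_equiv_refl[of U \<sigma> k] cont_repD(1)[OF k] by blast
    then have "\<sigma> \<in> ?R `` {\<sigma>}" by blast
    then have "rep_iso U \<rho> \<sigma>" unfolding r(3)[symmetric] by blast
    then show "\<rho> = \<sigma>" using ne r by blast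
  qed
  moreover have "(\<lambda>\<rho>. ?R `` {\<rho>}) ` F \<subseteq> irr_classes_le v emb U n"
    unfolding irr_classes_le_def
    by (rule image_subsetI, rule quotientI) (use F in blast)
  ultimately show ?thesis unfolding R_count_def using fin by (intro card_inj_on_le)
qed

end

section \<open>Representation growth\<close>

lemma sum_powers_le:
  fixes q :: nat assumes "2 \<le> q" shows "(\<Sum>m\<le>L. q ^ m) \<le> q ^ Suc L"
proof (induction L)
  case (Suc L)
  have "(\<Sum>m\<le>Suc L. q ^ m) \<le> q ^ Suc L + q ^ Suc L" using Suc by simp
  also have "\<dots> = 2 * q ^ Suc L" by simp
  also have "\<dots> \<le> q * q ^ Suc L" using assms by (intro mult_right_mono) auto
  finally show ?case by simp
qed (use assms in simp)

text \<open>A limsup needs the lower bound only along the subsequence \<open>q ^ M\<close>; the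
  constants \<open>D\<close> and \<open>H\<close> disappear in the quotient of logarithms.\<close>

lemma limsup_growth_eq_one:
  fixes R :: "nat \<Rightarrow> nat" and q D H :: nat
  assumes q: "2 \<le> q" and D: "1 \<le> D" and upper: "\<And>n. n \<ge> 1 \<Longrightarrow> R n \<le> D * n"
    and lower: "\<And>M. M \<ge> H \<Longrightarrow> q ^ (M - H) \<le> R (q ^ M)"
  shows "limsup (\<lambda>n. ereal (ln (real (R n)) / ln (real n))) = 1"
proof (rule antisym)
  let ?f = "\<lambda>n. ereal (ln (real (R n)) / ln (real n))"
  have "\<forall>\<^sub>F n in sequentially. ?f n \<le> ereal (1 + ln (real D) / ln (real n))"
    using eventually_ge_at_top[of 2]
  proof eventually_elim
    case (elim n)
    have ln: "ln (real n) > 0" using elim by simp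
    have "ln (real (R n)) \<le> ln (real (D * n))"
    proof (cases "R n = 0")
      \<comment> \<open>Here \<open>ln 0 = 0\<close> by convention, so the right-hand side has to be
        shown nonnegative.\<close>
      case True
      have "1 * 1 \<le> D * n" using D elim by (intro mult_le_mono) auto
      then have "real (1 * 1) \<le> real (D * n)" by (rule of_nat_mono)
      then have "0 \<le> ln (real (D * n))" by (intro ln_ge_zero) simp
      then show ?thesis using True by simp
    next
      case False
      have "real (R n) \<le> real (D * n)" using upper[of n] elim by (intro of_nat_mono) auto
      then show ?thesis using False by (intro ln_mono) auto
    qed
    also have "\<dots> = ln (real D) + ln (real n)" using D elim by (simp add: ln_mult)
    finally have "ln (real (R n)) / ln (real n) \<le> (ln (real D) + ln (real n)) / ln (real n)"
      using ln by (intro divide_right_mono) auto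
    then show ?case using ln by (simp add: add_divide_distrib)
  qed
  then have "limsup ?f \<le> limsup (\<lambda>n. ereal (1 + ln (real D) / ln (real n)))" by (rule Limsup_mono)
  also have "\<dots> = ereal (1 + 0)"
  proof (rule lim_imp_Limsup)
    have "filterlim (\<lambda>n. ln (real n)) at_top sequentially"
      by (rule filterlim_compose[OF ln_at_top filterlim_real_sequentially])
    then have "(\<lambda>n. ln (real D) / ln (real n)) \<longlonglongrightarrow> 0"
      by (intro tendsto_divide_0[OF tendsto_const]) (rule filterlim_at_top_imp_at_infinity)
    then show "(\<lambda>n. ereal (1 + ln (real D) / ln (real n))) \<longlonglongrightarrow> ereal (1 + 0)"
      by (intro tendsto_ereal tendsto_add tendsto_const)
  qed simp
  finally show "limsup ?f \<le> 1" by (simp add: one_ereal_def)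
  have lq: "ln (real q) > 0" using q by simp
  have sm: "strict_mono (\<lambda>M. q ^ M)" using q by (intro strict_monoI power_strict_increasing) auto
  have "(\<lambda>M. 1 - real H / real M) \<longlonglongrightarrow> 1 - 0"
    by (intro tendsto_diff tendsto_const tendsto_divide_0[OF tendsto_const]
        filterlim_at_top_imp_at_infinity filterlim_real_sequentially)
  then have "(\<lambda>M. ereal (1 - real H / real M)) \<longlonglongrightarrow> ereal (1 - 0)" by (rule tendsto_ereal)
  then have "limsup (\<lambda>M. ereal (1 - real H / real M)) = ereal (1 - 0)"
    by (rule lim_imp_Limsup[OF sequentially_bot])
  then have "1 = limsup (\<lambda>M. ereal (1 - real H / real M))" by (simp add: one_ereal_def)
  also have "\<dots> \<le> limsup (?f \<circ> (\<lambda>M. q ^ M))"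
  proof (rule Limsup_mono)
    show "\<forall>\<^sub>F M in sequentially. ereal (1 - real H / real M) \<le> (?f \<circ> (\<lambda>M. q ^ M)) M"
      using eventually_ge_at_top[of "H + 1"]
    proof eventually_elim
      case (elim M)
      have "real (q ^ (M - H)) \<le> real (R (q ^ M))" using lower[of M] elim by (intro of_nat_mono) auto
      then have "ln (real (q ^ (M - H))) \<le> ln (real (R (q ^ M)))" using q by (intro ln_mono) auto
      then have "real (M - H) * ln (real q) \<le> ln (real (R (q ^ M)))" using q by (simp add: ln_realpow)
      moreover have "real (M - H) = real M - real H" using elim by simp
      ultimately have h: "(real M - real H) * ln (real q) \<le> ln (real (R (q ^ M)))" by simp
      have "ln (real (q ^ M)) = real M * ln (real q)" using q by (simp add: ln_realpow)
      then have "(real M - real H) * ln (real q) / (real M * ln (real q)) \<le> ln (real (R (q ^ M))) / ln (real (q ^ M))"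
        using divide_right_mono[OF h, of "real M * ln (real q)"] lq by (simp only: mult_nonneg_nonneg of_nat_0_le_iff less_imp_le)
      moreover have "(real M - real H) * ln (real q) / (real M * ln (real q)) = 1 - real H / real M"
        using lq elim by (simp add: field_simps)
      ultimately show ?case by simp
    qed
  qed
  also have "\<dots> \<le> limsup ?f" by (rule limsup_subseq_mono[OF sm])
  finally show "1 \<le> limsup ?f" .
qed

section \<open>Linear bounds for the representation count\<close>

context quaternion_order
begin

text \<open>The bounds for the single levels form a geometric sum, dominated by the highest level
  \<open>L\<close> that occurs, and there \<open>q ^ L \<le> n * q ^ C\<close> by the dimension
  bound. The resulting exponent is \<open>3 * C + C2 + 1\<close>.\<close>

lemma card_inequivalent_le:
  assumes F: "finite F" "F \<subseteq> (\<Union>k\<in>{1..n}. irr_reps v emb U k)"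
    and ne: "\<And>\<rho> \<sigma>. \<rho> \<in> F \<Longrightarrow> \<sigma> \<in> F \<Longrightarrow> rep_iso U \<rho> \<sigma> \<Longrightarrow> \<rho> = \<sigma>"
  shows "card F \<le> q ^ (77 * \<kappa> + 23) * n"
proof (cases "F = {}")
  case False
  define C where "C = 17 * \<kappa> + 6"
  define C2 where "C2 = 26 * \<kappa> + 4"
  have "\<forall>\<rho>\<in>F. \<exists>k. k \<le> n \<and> \<rho> \<in> irr_reps v emb U k"
  proof
    fix \<rho> assume "\<rho> \<in> F"
    then obtain k where "k \<in> {1..n}" "\<rho> \<in> irr_reps v emb U k" using F(2) by blast
    then show "\<exists>k. k \<le> n \<and> \<rho> \<in> irr_reps v emb U k" by auto
  qed
  then obtain d where d: "\<And>\<rho>. \<rho> \<in> F \<Longrightarrow> d \<rho> \<le> n" "\<And>\<rho>. \<rho> \<in> F \<Longrightarrow> \<rho> \<in> irr_reps v emb U (d \<rho>)" by metis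
  note dD = irr_repsD[OF d(2)]
  define lev where "lev \<rho> = (LEAST m. trivial_at m (d \<rho>) \<rho>)" for \<rho>
  have lev: "trivial_at (lev \<rho>) (d \<rho>) \<rho>" if "\<rho> \<in> F" for \<rho>
    unfolding lev_def by (rule LeastI_ex) (rule cont_rep_trivial_at[OF dD(1)[OF that]])
  have dim: "q ^ lev \<rho> \<le> d \<rho> * q ^ C" if \<rho>: "\<rho> \<in> F" for \<rho>
  \<comment> \<open>\<open>dim_bound\<close> starts at level 1; at level 0 the claim only says that
    the dimension is positive.\<close>
  proof (cases "lev \<rho> = 0")
    case True
    have "1 \<le> d \<rho>" using dD(2)[OF \<rho>] by (simp add: irreducible_rep_def)
    moreover have "1 \<le> q ^ C" using q_ge by (intro one_le_power) simp
    ultimately have "1 * 1 \<le> d \<rho> * q ^ C" by (rule mult_le_mono)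
    then show ?thesis using True by simp
  next
    case False
    then have "\<not> trivial_at (lev \<rho> - 1) (d \<rho>) \<rho>" unfolding lev_def by (intro not_less_Least) simp
    then show ?thesis unfolding C_def using dim_bound[OF dD(1,2)[OF \<rho>] lev[OF \<rho>]] False by simp
  qed
  have level: "card {\<rho>\<in>F. lev \<rho> = m} \<le> q ^ (2 * C + C2) * q ^ m" for m
  proof -
    interpret FG: finite_group "Grp m" by (rule finite_group_Grp)
    let ?F = "{\<rho>\<in>F. lev \<rho> = m}"
    have tr: "trivial_at m (d \<rho>) \<rho>" if "\<rho> \<in> ?F" for \<rho> using that lev by auto
    have "(\<Sum>\<rho>\<in>?F. (d \<rho>)\<^sup>2) \<le> card (carrier (Grp m))"
    proof (rule FG.sum_dim_squares_le[where \<rho> = "\<lambda>\<rho>. \<rho>"])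
      show "finite ?F" using F by simp
      fix \<rho> assume r: "\<rho> \<in> ?F"
      then have rF: "\<rho> \<in> F" by simp
      note c = dD(1)[OF rF]
      show "group_rep (Grp m) (d \<rho>) \<rho>" by (rule group_rep_of_cont_rep[OF c tr[OF r]])
      show "irreducible_rep (carrier (Grp m)) (d \<rho>) \<rho>"
        by (rule irreducible_Grp[OF dD(2)[OF rF] trivial_at_rep[OF c tr[OF r]]])
      fix \<sigma> assume s: "\<sigma> \<in> ?F" "\<rho> \<noteq> \<sigma>"
      then have sF: "\<sigma> \<in> F" by simp
      have "\<not> rep_iso U \<rho> \<sigma>" using ne[OF rF sF] s by blast
      moreover have "rep_equiv U (d \<rho>) \<rho> (d \<sigma>) \<sigma> = rep_equiv (carrier (Grp m)) (d \<rho>) \<rho> (d \<sigma>) \<sigma>"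
        by (rule rep_equiv_U_iff_Grp)
          (rule trivial_at_rep[OF c tr[OF r]] trivial_at_rep[OF dD(1)[OF sF] tr[OF s(1)]]; assumption)+
      ultimately show "\<not> rep_equiv (carrier (Grp m)) (d \<rho>) \<rho> (d \<sigma>) \<sigma>"
        using rep_iso_iff_rep_equiv[OF c dD(1)[OF sF]] by blast
    qed
    also have "\<dots> \<le> q ^ C2 * q ^ (3 * m)" using card_Grp[of m] by (simp only: C2_def)
    finally have S: "(\<Sum>\<rho>\<in>?F. (d \<rho>)\<^sup>2) \<le> q ^ C2 * q ^ (3 * m)" .
    have "card ?F * q ^ (2 * m) = (\<Sum>\<rho>\<in>?F. (q ^ m)\<^sup>2)" by (simp add: power_mult[symmetric] mult.commute)
    also have "\<dots> \<le> (\<Sum>\<rho>\<in>?F. (d \<rho> * q ^ C)\<^sup>2)"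
      using dim by (intro sum_mono power_mono) auto
    also have "\<dots> = (\<Sum>\<rho>\<in>?F. (d \<rho>)\<^sup>2) * q ^ (2 * C)"
      by (simp only: sum_distrib_right power_mult_distrib power_mult[symmetric] mult.commute[of 2 C])
    also have "\<dots> \<le> q ^ C2 * q ^ (3 * m) * q ^ (2 * C)" using S by (rule mult_le_mono1)
    also have "\<dots> = (q ^ (2 * C + C2) * q ^ m) * q ^ (2 * m)"
      unfolding power_add[symmetric] by (rule arg_cong[of _ _ "\<lambda>k. q ^ k"]) simp
    finally show ?thesis using q_ge by simp
  qed
  define L where "L = Max (lev ` F)"
  have L: "lev \<rho> \<le> L" if "\<rho> \<in> F" for \<rho> unfolding L_def using F that by (intro Max_ge) auto
  have "L \<in> lev ` F" unfolding L_def using F False by (intro Max_in) auto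
  then obtain \<rho>0 where r0: "\<rho>0 \<in> F" "L = lev \<rho>0" by auto
  have "q ^ L \<le> d \<rho>0 * q ^ C" using dim[OF r0(1)] r0(2) by simp
  also have "\<dots> \<le> n * q ^ C" using d(1)[OF r0(1)] by (rule mult_le_mono1)
  finally have qL: "q ^ L \<le> n * q ^ C" .
  have "F = (\<Union>m\<le>L. {\<rho>\<in>F. lev \<rho> = m})" using L by auto
  then have "card F \<le> (\<Sum>m\<le>L. card {\<rho>\<in>F. lev \<rho> = m})" by (metis card_UN_le finite_atMost)
  also have "\<dots> \<le> (\<Sum>m\<le>L. q ^ (2 * C + C2) * q ^ m)" by (intro sum_mono level)
  also have "\<dots> = q ^ (2 * C + C2) * (\<Sum>m\<le>L. q ^ m)" by (simp only: sum_distrib_left)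
  also have "\<dots> \<le> q ^ (2 * C + C2) * (q * q ^ L)" using sum_powers_le[OF q_ge, of L] by (intro mult_le_mono2) simp
  also have "\<dots> \<le> q ^ (2 * C + C2) * (q * (n * q ^ C))" using qL by (intro mult_le_mono2)
  also have "\<dots> = q ^ (2 * C + C2) * q ^ 1 * q ^ C * n" by simp
  also have "q ^ (2 * C + C2) * q ^ 1 * q ^ C = q ^ (77 * \<kappa> + 23)"
    unfolding power_add[symmetric] by (rule arg_cong[of _ _ "\<lambda>k. q ^ k"]) (simp add: C_def C2_def)
  finally show ?thesis .
qed simp

text \<open>The exponent \<open>7 * \<kappa> + 4\<close> is one more than the offset in
  \<open>many_irreducible_reps\<close>: because \<open>q \<ge> 2\<close>, the representations of too
  large dimension then make up at most half of the guaranteed number.\<close>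

lemma R_count_ge:
  assumes fin: "finite (irr_classes_le v emb U (q ^ (m + h)))"
    and h: "h = 33 * \<kappa> + 8" and m: "7 * \<kappa> + 4 \<le> m"
  shows "q ^ (m - (7 * \<kappa> + 4)) \<le> R_count v emb U (q ^ (m + h))"
proof -
  let ?n = "q ^ (m + h)"
  let ?c = "7 * \<kappa> + 3"
  have "?c \<le> m" using m by simp
  from many_irreducible_reps[OF this] obtain F where F: "finite F" "q ^ (m - ?c) \<le> card F"
    "(\<Sum>f\<in>F. (fst f)\<^sup>2) \<le> card (carrier (Grp m))"
    and reps: "\<forall>f\<in>F. group_rep (Grp m) (fst f) (snd f) \<and> irreducible_rep (carrier (Grp m)) (fst f) (snd f)"
    and ineq: "\<forall>f\<in>F. \<forall>f'\<in>F. f \<noteq> f' \<longrightarrow> \<not> rep_equiv (carrier (Grp m)) (fst f) (snd f) (fst f') (snd f')"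
    by (elim exE conjE)
  note rep = conjunct1[OF bspec[OF reps]] and irr = conjunct2[OF bspec[OF reps]]
    and ne = mp[OF bspec[OF bspec[OF ineq]]]
  define big where "big = {f\<in>F. ?n < fst f}"
  define small where "small = {f\<in>F. fst f \<le> ?n}"
  have "card big * ?n\<^sup>2 = (\<Sum>f\<in>big. ?n\<^sup>2)" by simp
  also have "\<dots> \<le> (\<Sum>f\<in>big. (fst f)\<^sup>2)" by (intro sum_mono power_mono) (auto simp: big_def)
  also have "\<dots> \<le> (\<Sum>f\<in>F. (fst f)\<^sup>2)" using F(1) by (intro sum_mono2) (auto simp: big_def)
  also have "\<dots> \<le> q ^ (26 * \<kappa> + 4) * q ^ (3 * m)" using F(3) card_Grp[of m] by linarith
  \<comment> \<open>\<open>2 * h\<close> outweighs the \<open>26 * \<kappa> + 4\<close> from the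
    order of the quotient together with \<open>7 * \<kappa> + 4\<close>.\<close>
  also have "\<dots> \<le> q ^ (m - (7 * \<kappa> + 4)) * ?n\<^sup>2"
    unfolding power_mult[symmetric] power_add[symmetric]
    using q_ge m h by (intro power_increasing) auto
  finally have big: "card big \<le> q ^ (m - (7 * \<kappa> + 4))" using q_ge by simp
  have "F = big \<union> small" "big \<inter> small = {}" by (auto simp: big_def small_def)
  then have "card F = card big + card small" using F(1) by (metis card_Un_disjoint finite_Un)
  moreover have "2 * q ^ (m - (7 * \<kappa> + 4)) \<le> q ^ (m - ?c)"
  proof -
    have "m - ?c = Suc (m - (7 * \<kappa> + 4))" using m by simp
    then show ?thesis using q_ge by simp
  qed
  ultimately have s: "q ^ (m - (7 * \<kappa> + 4)) \<le> card small" using big F(2) by linarith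
  define g where "g f = snd f \<circ> rep m" for f :: "nat \<times> ('d \<Rightarrow> complex mat)"
  have smallF: "f \<in> F" if "f \<in> small" for f using that by (simp add: small_def)
  have gi: "g f \<in> irr_reps v emb U (fst f)" "trivial_at m (fst f) (g f)" if "f \<in> F" for f
    unfolding g_def using cont_rep_of_group_rep[OF rep[OF that] irr[OF that]] by auto
  have iso: "f = f'" if f: "f \<in> F" and f': "f' \<in> F" and i: "rep_iso U (g f) (g f')" for f f'
  proof (rule ccontr)
    assume "f \<noteq> f'"
    have gr: "g f (rep m x) = g f x" "g f' (rep m x) = g f' x" if "x \<in> U" for x
      using rep_rep[OF that] by (auto simp: g_def)
    have "rep_equiv U (fst f) (g f) (fst f') (g f') = rep_equiv (carrier (Grp m)) (fst f) (g f) (fst f') (g f')"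
      by (rule rep_equiv_U_iff_Grp) (rule gr; assumption)+
    then have "rep_equiv (carrier (Grp m)) (fst f) (g f) (fst f') (g f')"
      using i rep_iso_iff_rep_equiv[OF irr_repsD(1)[OF gi(1)[OF f]] irr_repsD(1)[OF gi(1)[OF f']]] by blast
    then have "rep_equiv (carrier (Grp m)) (fst f) (snd f) (fst f') (snd f')"
      unfolding rep_equiv_def g_def using rep_Grp by auto
    then show False using ne[OF f f' \<open>f \<noteq> f'\<close>] by simp
  qed
  have refl: "rep_iso U (g f) (g f)" if "f \<in> F" for f
    unfolding rep_iso_iff_rep_equiv[OF irr_repsD(1)[OF gi(1)[OF that]] irr_repsD(1)[OF gi(1)[OF that]]]
    by (rule rep_equiv_refl) (rule cont_repD(1)[OF irr_repsD(1)[OF gi(1)[OF that]]])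
  have "inj_on g small"
  proof (rule inj_onI)
    fix f f' assume "f \<in> small" "f' \<in> small" "g f = g f'"
    then show "f = f'" using iso[of f f'] refl[of f] smallF by simp
  qed
  then have "card small = card (g ` small)" by (simp add: card_image)
  also have "\<dots> \<le> R_count v emb U ?n"
  proof (rule card_le_R_count[OF fin])
    show "g ` small \<subseteq> (\<Union>k\<in>{1..?n}. irr_reps v emb U k)"
    proof (rule image_subsetI)
      fix f assume f: "f \<in> small"
      have "fst f \<ge> 1" using irr[OF smallF[OF f]] by (simp add: irreducible_rep_def)
      then show "g f \<in> (\<Union>k\<in>{1..?n}. irr_reps v emb U k)"
        using gi(1)[OF smallF[OF f]] f by (intro UN_I[of "fst f"]) (auto simp: small_def)
    qed
    fix \<rho> \<sigma> assume "\<rho> \<in> g ` small" "\<sigma> \<in> g ` small" "rep_iso U \<rho> \<sigma>"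
    then show "\<rho> = \<sigma>" using iso smallF by blast
  qed
  finally show ?thesis using s by simp
qed

theorem rep_growth_U: "rep_growth v emb U = 1"
proof -
  have fin: "finite (irr_classes_le v emb U n)" and up: "R_count v emb U n \<le> q ^ (77 * \<kappa> + 23) * n" for n
    using finite_irr_classes[of n "q ^ (77 * \<kappa> + 23) * n"] card_inequivalent_le[of _ n] by auto
  have "limsup (\<lambda>n. ereal (ln (real (R_count v emb U n)) / ln (real n))) = 1"
  \<comment> \<open>The last constant is the sum of \<open>33 * \<kappa> + 8\<close> and
    \<open>7 * \<kappa> + 4\<close> from \<open>R_count_ge\<close>.\<close>
  proof (rule limsup_growth_eq_one[OF q_ge, of "q ^ (77 * \<kappa> + 23)" _ "40 * \<kappa> + 12"])
    show "1 \<le> q ^ (77 * \<kappa> + 23)" using q_ge by (intro one_le_power) simp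
    show "R_count v emb U n \<le> q ^ (77 * \<kappa> + 23) * n" for n by (rule up)
    fix M assume M: "40 * \<kappa> + 12 \<le> M"
    have "M - (33 * \<kappa> + 8) + (33 * \<kappa> + 8) = M" "M - (33 * \<kappa> + 8) - (7 * \<kappa> + 4) = M - (40 * \<kappa> + 12)" using M by auto
    then show "q ^ (M - (40 * \<kappa> + 12)) \<le> R_count v emb U (q ^ M)"
      using R_count_ge[OF fin refl, of "M - (33 * \<kappa> + 8)"] M by simp
  qed
  then show ?thesis using fin by (simp add: rep_growth_def)
qed

end

section \<open>Orders as bounded open lattices\<close>

context quaternion_lattice
begin

lemma N_sum_le: "N (\<Sum>s\<in>S. f s) \<le> (\<Sum>s\<in>S. N (f s))"
proof (induction S rule: infinite_finite_induct)
  case (insert s S)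
  have "N (f s + (\<Sum>s\<in>S. f s)) \<le> N (f s) + N (\<Sum>s\<in>S. f s)"
    using N_add[of "f s" "\<Sum>s\<in>S. f s"] N_nonneg[of "f s"] N_nonneg[of "\<Sum>s\<in>S. f s"] by linarith
  then show ?case using insert by simp
qed auto

lemma ex_power_small: "\<exists>k. \<forall>k'\<ge>k. w ^ k' * C \<le> 1"
proof -
  have "0 < 1 / (1 + \<bar>C\<bar>)" by (simp add: add_pos_nonneg)
  from ex_power_le[OF this] obtain k where k: "w ^ k \<le> 1 / (1 + \<bar>C\<bar>)" ..
  have "w ^ k' * C \<le> 1" if "k' \<ge> k" for k'
  proof -
    have "w ^ k' * C \<le> w ^ k' * (1 + \<bar>C\<bar>)" by (intro mult_left_mono) auto
    also have "\<dots> \<le> 1 / (1 + \<bar>C\<bar>) * (1 + \<bar>C\<bar>)"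
      using w_pow_mono[OF that] k by (intro mult_right_mono) auto
    also have "\<dots> = 1"
    proof -
      have "1 + \<bar>C\<bar> \<noteq> 0" using abs_ge_zero[of C] by linarith
      then show ?thesis by simp
    qed
    finally show ?thesis .
  qed
  then show ?thesis by blast
qed

lemma mk_expand: "x = emb (q0 x) * 1 + emb (q1 x) * mk 0 1 0 0 + emb (q2 x) * mk 0 0 1 0 + emb (q3 x) * mk 0 0 0 1"
  by (rule q_eqI) simp_all

text \<open>An order is a module over the integers of the field and contains a basis, so small
  multiples of each of the four quaternion basis vectors lie in it. The claim covers all larger
  exponents in order that several such bounds can be met by one exponent.\<close>

lemma order_contains_ball:
  assumes D0: "is_order v emb D0"
  shows "\<exists>k. \<forall>k'\<ge>k. \<forall>x. N x \<le> w ^ k' \<longrightarrow> x \<in> D0"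
proof -
  from D0 obtain gs where gs: "D0 = {x. \<exists>c. (\<forall>l<length gs. v (c l) \<le> 1) \<and> x = (\<Sum>l<length gs. emb (c l) * gs ! l)}"
    unfolding is_order_def by blast
  from D0 obtain e where e: "K_basis4 emb e" "\<And>l. l < 4 \<Longrightarrow> e l \<in> D0" unfolding is_order_def by blast
  have add: "x + y \<in> D0" if "x \<in> D0" "y \<in> D0" for x y using D0 that unfolding is_order_def by blast
  have smult: "emb c * x \<in> D0" if "x \<in> D0" "v c \<le> 1" for c x
  proof -
    from that(1) obtain d where d: "\<And>l. l < length gs \<Longrightarrow> v (d l) \<le> 1" "x = (\<Sum>l<length gs. emb (d l) * gs ! l)"
      unfolding gs by auto
    have "emb c * x = (\<Sum>l<length gs. emb (c * d l) * gs ! l)"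
      unfolding d(2) by (simp add: sum_distrib_left emb_mult mult.assoc)
    moreover have "v (c * d l) \<le> 1" if "l < length gs" for l
      using d(1)[OF that] \<open>v c \<le> 1\<close> by (simp add: v_mult mult_le_one)
    ultimately show ?thesis
      unfolding gs by (intro CollectI exI[of _ "\<lambda>l. c * d l"] conjI allI impI)
  qed
  have z: "0 \<in> D0" using smult[of 1 0] D0 unfolding is_order_def by simp
  have sum: "(\<Sum>l\<in>S. f l) \<in> D0" if "finite S" "\<And>l. l \<in> S \<Longrightarrow> f l \<in> D0" for S :: "nat set" and f
    using that by (induction S rule: finite_induct) (auto simp: z add)
  have absorb: "\<exists>s. \<forall>c. v c \<le> w ^ s \<longrightarrow> emb c * x \<in> D0" for x
  proof -
    obtain d where d: "x = (\<Sum>l<4. emb (d l) * e l)" using e(1) unfolding K_basis4_def by blast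
    obtain s where s: "w ^ s * (\<Sum>l<4. v (d l)) \<le> 1" using ex_power_small by blast
    have "emb c * x \<in> D0" if c: "v c \<le> w ^ s" for c
    proof -
      have "emb c * x = (\<Sum>l<4. emb (c * d l) * e l)"
        unfolding d by (simp add: sum_distrib_left emb_mult mult.assoc)
      also have "\<dots> \<in> D0"
      proof (intro sum smult e(2))
        fix l assume "l \<in> {..<4::nat}"
        then have "v (d l) \<le> (\<Sum>l<4. v (d l))" by (intro member_le_sum) auto
        then have "v c * v (d l) \<le> w ^ s * (\<Sum>l<4. v (d l))" using c by (intro mult_mono) auto
        then show "v (c * d l) \<le> 1" using s unfolding v_mult by linarith
      qed auto
      finally show ?thesis .
    qed
    then show ?thesis by blast
  qed
  obtain s0 s1 s2 s3 where s: "\<And>c. v c \<le> w ^ s0 \<Longrightarrow> emb c * 1 \<in> D0" "\<And>c. v c \<le> w ^ s1 \<Longrightarrow> emb c * mk 0 1 0 0 \<in> D0"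
    "\<And>c. v c \<le> w ^ s2 \<Longrightarrow> emb c * mk 0 0 1 0 \<in> D0" "\<And>c. v c \<le> w ^ s3 \<Longrightarrow> emb c * mk 0 0 0 1 \<in> D0"
    using absorb[of 1] absorb[of "mk 0 1 0 0"] absorb[of "mk 0 0 1 0"] absorb[of "mk 0 0 0 1"] by blast
  have "x \<in> D0" if k: "k' \<ge> s0 + s1 + s2 + s3" and x: "N x \<le> w ^ k'" for k' x
  proof -
    have "w ^ k' \<le> w ^ s0" "w ^ k' \<le> w ^ s1" "w ^ k' \<le> w ^ s2" "w ^ k' \<le> w ^ s3"
      using k by (auto intro!: w_pow_mono)
    then have "v (q0 x) \<le> w ^ s0" "v (q1 x) \<le> w ^ s1" "v (q2 x) \<le> w ^ s2" "v (q3 x) \<le> w ^ s3"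
      using v_le_N[of x] x by linarith+
    then have "emb (q0 x) * 1 + emb (q1 x) * mk 0 1 0 0 + emb (q2 x) * mk 0 0 1 0 + emb (q3 x) * mk 0 0 0 1 \<in> D0"
      by (intro add s)
    then show ?thesis using mk_expand[of x] by simp
  qed
  then show ?thesis by blast
qed

text \<open>Elements are integral combinations of finitely many generators, so the norms of the
  generators bound the order.\<close>

lemma order_bounded:
  assumes D0: "is_order v emb D0"
  shows "\<exists>k. \<forall>k'\<ge>k. \<forall>x\<in>D0. w ^ k' * N x \<le> 1"
proof -
  from D0 obtain gs where gs: "D0 = {x. \<exists>c. (\<forall>l<length gs. v (c l) \<le> 1) \<and> x = (\<Sum>l<length gs. emb (c l) * gs ! l)}"
    unfolding is_order_def by blast
  define M where "M = (\<Sum>l<length gs. N (gs ! l))"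
  have b: "N x \<le> M" if "x \<in> D0" for x
  proof -
    from that obtain c where c: "\<And>l. l < length gs \<Longrightarrow> v (c l) \<le> 1" "x = (\<Sum>l<length gs. emb (c l) * gs ! l)"
      unfolding gs by auto
    have "N x \<le> (\<Sum>l<length gs. N (emb (c l) * gs ! l))" unfolding c(2) by (rule N_sum_le)
    also have "\<dots> \<le> M" unfolding M_def N_smult using c(1) by (intro sum_mono mult_left_le_one_le) auto
    finally show ?thesis .
  qed
  obtain k where k: "\<And>k'. k' \<ge> k \<Longrightarrow> w ^ k' * M \<le> 1" using ex_power_small[of M] by blast
  have "w ^ k' * N x \<le> 1" if "k' \<ge> k" "x \<in> D0" for k' x
    using k[OF that(1)] mult_left_mono[OF b[OF that(2)], of "w ^ k'"] by (meson less_imp_le order_trans w_pow_pos)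
  then show ?thesis by blast
qed

text \<open>Change of basis between the quaternion basis and \<open>the_basis\<close>, in which the
  topology is defined; one constant serves both directions.\<close>

lemma dnorm_equivalent: "\<exists>K>0. \<forall>x. N x \<le> K * dnorm v emb x \<and> dnorm v emb x \<le> K * N x"
proof -
  let ?f = "\<lambda>r::nat. [1, mk 0 1 0 0, mk 0 0 1 0, mk 0 0 0 1] ! r"
  define K1 where "K1 = (\<Sum>l<4. N (the_basis emb l))"
  define K2 where "K2 = (\<Sum>l<4. v (coord emb 1 l) + v (coord emb (mk 0 1 0 0) l)
      + v (coord emb (mk 0 0 1 0) l) + v (coord emb (mk 0 0 0 1) l))"
  have dn: "v (coord emb x l) \<le> dnorm v emb x" if "l < 4" for x l
    unfolding dnorm_def using that by (intro Max_ge) auto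
  have K0: "K1 \<ge> 0" "K2 \<ge> 0" unfolding K1_def K2_def by (auto intro!: sum_nonneg add_nonneg_nonneg)
  have dnn: "dnorm v emb x \<ge> 0" for x using order_trans[OF v_nonneg dn[of 0 x]] by simp
  have 1: "N x \<le> (1 + K1 + K2) * dnorm v emb x" for x
  proof -
    have "N x \<le> (\<Sum>l<4. N (emb (coord emb x l) * the_basis emb l))"
      by (subst coord_expand[of x, symmetric]) (rule N_sum_le)
    also have "\<dots> \<le> (\<Sum>l<4. dnorm v emb x * N (the_basis emb l))"
      unfolding N_smult using dn by (intro sum_mono mult_right_mono) auto
    also have "\<dots> = dnorm v emb x * K1" by (simp add: K1_def sum_distrib_left)
    also have "\<dots> \<le> dnorm v emb x * (1 + K1 + K2)" using K0 dnn by (intro mult_left_mono) auto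
    finally show ?thesis by (simp only: mult.commute)
  qed
  have 2: "dnorm v emb x \<le> (1 + K1 + K2) * N x" for x
  proof -
    have "v (coord emb x l) \<le> (1 + K1 + K2) * N x" if l: "l < 4" for l
    proof -
      define s where "s = v (coord emb 1 l) + v (coord emb (mk 0 1 0 0) l) + v (coord emb (mk 0 0 1 0) l) + v (coord emb (mk 0 0 0 1) l)"
      have c: "coord emb x l = q0 x * coord emb 1 l + q1 x * coord emb (mk 0 1 0 0) l
          + q2 x * coord emb (mk 0 0 1 0) l + q3 x * coord emb (mk 0 0 0 1) l"
        by (subst mk_expand[of x]) (simp only: coord_add coord_smult)
      have t: "v (c * d) \<le> s * N x" if "v c \<le> N x" "v d \<le> s" for c d
        unfolding v_mult using mult_mono[OF that] by (simp add: mult.commute)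
      have "v (coord emb x l) \<le> s * N x"
        unfolding c by (intro v_add_le t v_le_N) (simp_all add: s_def)
      also have "s \<le> K2"
        unfolding K2_def s_def using l
        by (intro member_le_sum[of l "{..<4}" "\<lambda>l. v (coord emb 1 l) + v (coord emb (mk 0 1 0 0) l)
            + v (coord emb (mk 0 0 1 0) l) + v (coord emb (mk 0 0 0 1) l)"]) auto
      then have "s * N x \<le> (1 + K1 + K2) * N x" using K0 by (intro mult_right_mono) auto
      finally show ?thesis .
    qed
    then show ?thesis unfolding dnorm_def by (subst Max_le_iff) (auto simp: lessThan_empty_iff)
  qed
  show ?thesis using 1 2 K0 by (intro exI[of _ "1 + K1 + K2"]) auto
qed

lemma rep_growth_order:
  assumes D0: "is_order v emb D0"
  shows "rep_growth v emb (units_of_set D0 \<inter> {x. Nrd emb x = 1}) = 1"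
proof -
  obtain k1 where k1: "\<And>k' x. k' \<ge> k1 \<Longrightarrow> N x \<le> w ^ k' \<Longrightarrow> x \<in> D0" using order_contains_ball[OF D0] by blast
  obtain k2 where k2: "\<And>k' x. k' \<ge> k2 \<Longrightarrow> x \<in> D0 \<Longrightarrow> w ^ k' * N x \<le> 1" using order_bounded[OF D0] by blast
  obtain K where K: "K > 0" "\<And>x. N x \<le> K * dnorm v emb x" "\<And>x. dnorm v emb x \<le> K * N x"
    using dnorm_equivalent by blast
  \<comment> \<open>Enlarging \<open>\<kappa>\<close> preserves the inequalities required of it, so
    one exponent can serve the algebra and both bounds on the order.\<close>
  define k where "k = \<kappa> + k1 + k2"
  have wk: "w ^ k \<le> w ^ \<kappa>" by (rule w_pow_mono) (simp add: k_def)
  interpret Q: quaternion_order emb i j a b v \<pi> k D0 K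
  proof unfold_locales
    show "w ^ k \<le> v 2" "w ^ k \<le> v a" "w ^ k \<le> v b" using wk v2_ge va_ge vb_ge by linarith+
    show "w ^ k * N x \<le> 1" if "x \<in> D0" for x using k2[of k x] that by (simp add: k_def)
    show "x \<in> D0" if "N x \<le> w ^ k" for x using k1[of k x] that by (simp add: k_def)
  qed (use D0 K va vb in \<open>auto simp: is_order_def\<close>)
  show ?thesis using Q.rep_growth_U unfolding Q.U_def .
qed

end

theorem theorem7p3:
  fixes v :: "'k::field \<Rightarrow> real" and emb :: "'k \<Rightarrow> 'd::ring_1" and D0 :: "'d set"
  assumes "nonarch_local_field v"
    and "(2::'k) \<noteq> 0"
    and "central_simple_deg2 emb"
    and "maximal_order v emb D0"
  shows "rep_growth v emb (units_of_set D0 \<inter> {x. Nrd emb x = 1}) = 1"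
proof -
  obtain \<pi> where \<pi>: "0 < v \<pi>" "v \<pi> < 1" "\<And>x. x \<noteq> 0 \<Longrightarrow> \<exists>k::int. v x = v \<pi> powi k"
    using assms(1) unfolding nonarch_local_field_def by blast
  interpret discrete_valued_field v \<pi>
    using assms(1) \<pi> unfolding nonarch_local_field_def by unfold_locales auto
  interpret central_simple_quartic emb using assms(2,3) by unfold_locales
  obtain i j a b where g: "a \<noteq> 0" "b \<noteq> 0" "i * i = emb a" "j * j = emb b" "i * j = - (j * i)"
    using quaternion_generators by blast
  text \<open>Rescale the generators so that their squares are integral.\<close>
  have scale: "\<exists>p. p \<noteq> 0 \<and> v (p * p * c) \<le> 1" if "c \<noteq> 0" for c
  proof -
    have "0 < 1 / v c" using that by (simp add: v_pos_iff)
    from ex_power_le[OF this] obtain n where n: "v \<pi> ^ n \<le> 1 / v c" ..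
    have "v (\<pi> ^ n * \<pi> ^ n * c) = v \<pi> ^ n * (v \<pi> ^ n * v c)" by (simp add: v_mult v_power)
    also have "\<dots> \<le> 1 * 1"
      using n that pi_pos pi_less v_pos_iff[of c] by (intro mult_mono power_le_one) (auto simp: field_simps)
    finally show ?thesis by (intro exI[of _ "\<pi> ^ n"]) simp
  qed
  obtain s t where st: "s \<noteq> 0" "v (s * s * a) \<le> 1" "t \<noteq> 0" "v (t * t * b) \<le> 1" using scale g(1,2) by blast
  have sc: "emb c * x * (emb d * y) = emb (c * d) * (x * y)" for c d x y
    by (simp add: emb_comm_left[of x] emb_mult mult.assoc)
  interpret quaternion_basis emb "emb s * i" "emb t * j" "s * s * a" "t * t * b"
  proof unfold_locales
    show "s * s * a \<noteq> 0" "t * t * b \<noteq> 0" using g st by simp_all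
    show "emb s * i * (emb s * i) = emb (s * s * a)" "emb t * j * (emb t * j) = emb (t * t * b)"
      by (simp_all only: sc g emb_mult)
    show "emb s * i * (emb t * j) = - (emb t * j * (emb s * i))"
      by (simp only: sc g(5) mult_minus_right mult.commute[of s t])
  qed
  \<comment> \<open>The three quantities are nonzero, so one power of \<open>\<pi>\<close> lies
    below all of them.\<close>
  have "\<exists>n. v \<pi> ^ n \<le> min (v 2) (min (v (s * s * a)) (v (t * t * b)))"
    using assms(2) g st by (intro ex_power_le) (simp add: v_pos_iff)
  then obtain \<kappa> where "v \<pi> ^ \<kappa> \<le> v 2" "v \<pi> ^ \<kappa> \<le> v (s * s * a)" "v \<pi> ^ \<kappa> \<le> v (t * t * b)" by auto
  then interpret quaternion_lattice emb "emb s * i" "emb t * j" "s * s * a" "t * t * b" v \<pi> \<kappa>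
    using st by unfold_locales auto
  show ?thesis using rep_growth_order assms(4) unfolding maximal_order_def by blast
qed

end
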